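(* Let $B$ be an interpolating Blaschke product with zeros $\{a_j\}_{j\in\mathbb N}$, and let $h\in H^\infty$. Then $h\in K^\infty_B+BH^\infty$ if and only if $$\sup_{k\in\mathbb N}\left|\sum_{j}\frac{h(a_j)}{B'(a_j)\cdot(1-a_j\overline{a_k})}\right|<\infty.$$
   Context: $\mathbb D$ is the open unit disk in $\mathbb C$, $\mathbb T$ its boundary, and $m$ normalized arclength measure on $\mathbb T$. $H^\infty$ is the space of bounded holomorphic functions on $\mathbb D$, identified with their boundary functions (defined a.e. on $\mathbb T$), and $H^\infty_0=\{f\in H^\infty: f(0)=0\}$. Given a sequence $\{a_j\}_{j\in\mathbb N}$ in $\mathbb D$ with $\sum_j(1-|a_j|)<\infty$, the associated Blaschke product is $$B(z)=\prod_j b_j(z),\qquad b_j(z)=\frac{|a_j|}{a_j}\,\frac{a_j-z}{1-\overline{a_j}z},$$ with the convention $|a_j|/a_j=-1$ if $a_j=0$. $B$ is called an interpolating Blaschke product (with zeros $\{a_j\}$) if $\inf_j|B'(a_j)|\,(1-|a_j|)>0$. The star-invariant subspace $K^\infty_B$ is $K^\infty_B:=H^\infty\cap B\,\overline{H^\infty_0}$, i.e. the set of $f\in H^\infty$ for which there is $g\in H^\infty_0$ with $f=B\overline g$ a.e. on $\mathbb T$. Also $K^\infty_B+BH^\infty=\{f+Bg:\ f\in K^\infty_B,\ g\in H^\infty\}$. *)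

theory Defs
  imports "HOL-Complex_Analysis.Complex_Analysis"
begin

text \<open>
  Elements of \<open>H\<^sup>\<infinity>\<close> are represented by total functions on \<^typ>\<open>complex\<close>; only their values on the
  open unit disk matter, and all notions below depend on those values alone.
\<close>

definition Hinf :: "(complex \<Rightarrow> complex) set" where
  "Hinf = {f. f holomorphic_on ball 0 1 \<and> bounded (f ` ball 0 1)}"

definition Hinf0 :: "(complex \<Rightarrow> complex) set" where
  "Hinf0 = {f \<in> Hinf. f 0 = 0}"

definition circle_measure :: "complex measure" where
  "circle_measure =
     distr (uniform_measure lborel {0..<2 * pi}) (restrict_space borel (sphere 0 1)) cis"

text \<open>
  Radial boundary values. For \<open>f\<close> in \<open>H\<^sup>\<infinity>\<close> the limit exists at almost every point of the circle
  (Fatou); at the remaining points the value is unspecified.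
\<close>

definition boundary_fun :: "(complex \<Rightarrow> complex) \<Rightarrow> complex \<Rightarrow> complex" where
  "boundary_fun f \<zeta> = Lim (at_left 1) (\<lambda>r::real. f (of_real r * \<zeta>))"

definition blaschke_factor :: "complex \<Rightarrow> complex \<Rightarrow> complex" where
  "blaschke_factor a z =
     (if a = 0 then -1 else of_real (cmod a) / a) * ((a - z) / (1 - cnj a * z))"

text \<open>
  The value of \<^const>\<open>prodinf\<close> is \<open>0\<close> at a zero of finitely many factors (with the remaining product
  convergent to a nonzero limit), so this is also the intended value at the points \<open>a j\<close>.
\<close>

definition blaschke :: "(nat \<Rightarrow> complex) \<Rightarrow> complex \<Rightarrow> complex" where
  "blaschke a z = (\<Prod>j. blaschke_factor (a j) z)"

definition interpolating_blaschke :: "(nat \<Rightarrow> complex) \<Rightarrow> bool" where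
  "interpolating_blaschke a \<longleftrightarrow>
     (\<forall>j. a j \<in> ball 0 1) \<and>
     summable (\<lambda>j. 1 - cmod (a j)) \<and>
     (INF j. cmod (deriv (blaschke a) (a j)) * (1 - cmod (a j))) > 0"

definition Kinf :: "(complex \<Rightarrow> complex) \<Rightarrow> (complex \<Rightarrow> complex) set" where
  "Kinf B = {f \<in> Hinf. \<exists>g\<in>Hinf0. AE \<zeta> in circle_measure.
     boundary_fun f \<zeta> = boundary_fun B \<zeta> * cnj (boundary_fun g \<zeta>)}"

definition Kinf_plus_BHinf :: "(complex \<Rightarrow> complex) \<Rightarrow> (complex \<Rightarrow> complex) set" where
  "Kinf_plus_BHinf B =
     {h. \<exists>f\<in>Kinf B. \<exists>g\<in>Hinf. \<forall>z\<in>ball 0 1. h z = f z + B z * g z}"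

end

theory Submission
  imports Defs
begin

text \<open>
  Put \<open>u j = h (a j) / B' (a j)\<close>. The only candidate for the component of \<open>h\<close> in the star-invariant
  subspace is \<open>f z = B z * (\<Sum>j. u j / (z - a j))\<close>, and on the circle \<open>f = B * cnj g\<close> with
  \<open>g z = z * (\<Sum>j. cnj (u j) / (1 - cnj (a j) * z))\<close>. The sums in the statement are the conjugates of the
  values of \<open>g z / z\<close> at the zeros. Hence they are bounded if \<open>g\<close> is.

  Conversely, inside the disc \<open>\<bar>f - B * cnj g\<bar> \<le> C * (\<Sum>j. (1 - \<bar>b j\<bar>\<^sup>2) * \<bar>B / b j\<bar>) \<le> 2 * C * (1 - \<bar>B\<bar>)\<close>,
  so that it suffices to bound \<open>g\<close>; the boundary relation then follows because \<open>\<bar>B\<bar> = 1\<close> almost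
  everywhere on the circle. The reflection \<open>\<Psi> z = (\<Sum>j. u j / (z - a j))\<close> of \<open>g\<close> is analytic outside the
  disc. Its partial sums have poles at the \<open>a k\<close>, and on circles around \<open>a k\<close> of radius comparable to
  \<open>1 - \<bar>a k\<bar>\<close> they differ by a bounded amount from the partial sums of the series in the statement.
  The latter converge in the mean with respect to \<open>\<Sum>k. (1 - \<bar>a k\<bar>) * \<delta> (a k)\<close> by the Carleson
  embedding, so Cauchy's formula for products of many partial sums yields a maximum principle:
  \<open>\<Psi>\<close> is bounded by its bound on those circles.
\<close>

section \<open>Differentiability of Lipschitz functions almost everywhere\<close>

text \<open>The obstacle in bounding g is that the partial sums at the zeros converge under control
  only in the mean, not uniformly in k. The mean suffices because Cauchy's formula weights the
  circle around \<open>a k\<close> by its radius, hence by \<open>\<mu> k\<close>. The product of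
  partial sums is not a power of a single one: each length tends to infinity while the earlier
  factors are held fixed, and since their product is bounded on all circles at once, the error of
  the new factor disappears in the limit. The price 1 / (|z| - 1) of Cauchy's formula does not grow
  with the number m of factors, so comparing m-th powers removes it. Real analysis enters because
  boundary functions are radial limits: a bounded holomorphic function has a Lipschitz primitive,
  and the radial limit exists wherever that primitive is differentiable along the circle. For
  necessity the pair (f, g) is arbitrary. Dividing by finitely many factors of B makes the
  evaluation of the sums a finite residue computation; the remaining tails of B tend to 1 in the
  mean on the circle.\<close>

lemma Vitali_covering_intervals:
  fixes S U :: "real set"
  assumes U: "open U"
    and small: "\<And>x d. \<lbrakk>x \<in> S; 0 < d\<rbrakk> \<Longrightarrow> \<exists>c r. 0 < r \<and> r < d \<and> x \<in> cball c r \<and> P c r"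
  obtains C where "countable C" "\<And>i. i \<in> C \<Longrightarrow> 0 < snd i \<and> cball (fst i) (snd i) \<subseteq> U \<and> P (fst i) (snd i)"
    "disjoint_family_on (\<lambda>i. cball (fst i) (snd i)) C" "negligible (S \<inter> U - (\<Union>i\<in>C. cball (fst i) (snd i)))"
proof -
  define K where "K = {i. 0 < snd i \<and> cball (fst i) (snd i) \<subseteq> U \<and> P (fst i) (snd i)}"
  obtain C where C: "countable C" "C \<subseteq> K"
     "pairwise (\<lambda>i j. disjnt (cball (fst i) (snd i)) (cball (fst j) (snd j))) C"
     "negligible (S \<inter> U - (\<Union>i \<in> C. cball (fst i) (snd i)))"
  proof (rule Vitali_covering_theorem_cballs[of K snd "S \<inter> U" fst])
    fix x and d :: real assume x: "x \<in> S \<inter> U" "0 < d"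
    then obtain q where q: "q > 0" "ball x q \<subseteq> U" using U openE by blast
    obtain c r where cr: "0 < r" "r < min d (q/2)" "x \<in> cball c r" "P c r"
      using small[of x "min d (q/2)"] x q by auto
    have "cball c r \<subseteq> ball x q"
    proof
      fix y assume "y \<in> cball c r"
      then show "y \<in> ball x q" using cr(2,3) dist_triangle[of x y c] by (auto simp: dist_commute)
    qed
    then show "\<exists>i. i \<in> K \<and> x \<in> cball (fst i) (snd i) \<and> snd i < d"
      using cr q by (intro exI[of _ "(c,r)"]) (auto simp: K_def)
  next
    show "0 < snd i" if "i \<in> K" for i using that by (auto simp: K_def)
  qed (rule that)
  show thesis
  proof (rule that[OF C(1) _ _ C(4)])
    show "0 < snd i \<and> cball (fst i) (snd i) \<subseteq> U \<and> P (fst i) (snd i)" if "i \<in> C" for i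
      using subsetD[OF C(2) that] by (simp add: K_def)
    show "disjoint_family_on (\<lambda>i. cball (fst i) (snd i)) C"
      using C(3) by (simp add: disjoint_family_on_def pairwise_def disjnt_def)
  qed
qed

text \<open>
  Two Vitali coverings, the second one by intervals inside those of the first, give
  \<open>v s \<le> \<mu> A \<le> \<mu> B \<le> u s\<close> up to epsilon for the Stieltjes measure \<open>\<mu>\<close> of \<open>g\<close> and the outer measure \<open>s\<close>
  of \<open>S\<close>.
\<close>

lemma negligible_two_slopes:
  fixes g :: "real \<Rightarrow> real"
  assumes mono: "mono g" and cont: "continuous_on UNIV g" and uv: "0 < u" "u < v"
    and bS: "bounded S"
    and lo: "\<And>x d. \<lbrakk>x \<in> S; 0 < d\<rbrakk> \<Longrightarrow>
      \<exists>c r. 0 < r \<and> r < d \<and> x \<in> cball c r \<and> g (c + r) - g (c - r) < u * (2 * r)"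
    and hi: "\<And>x d. \<lbrakk>x \<in> S; 0 < d\<rbrakk> \<Longrightarrow>
      \<exists>c r. 0 < r \<and> r < d \<and> x \<in> cball c r \<and> v * (2 * r) < g (c + r) - g (c - r)"
  shows "negligible S"
proof -
  define \<mu> where "\<mu> = interval_measure g"
  have \<mu>_cball: "emeasure \<mu> (cball c r) = ennreal (g (c + r) - g (c - r))" if "0 < r" for c r
    unfolding \<mu>_def cball_eq_atLeastAtMost using that mono cont
    by (subst emeasure_interval_measure_Icc) (auto dest: monoD)
  have lb_cball: "emeasure lborel (cball c r) = ennreal (2 * r)" if "0 < r" for c r :: real
    unfolding cball_eq_atLeastAtMost using that by simp
  have sets_\<mu>: "sets \<mu> = sets borel" by (simp add: \<mu>_def)
  have un: "emeasure N (\<Union>i\<in>C. cball (fst i) (snd i)) = (\<integral>\<^sup>+i. emeasure N (cball (fst i) (snd i)) \<partial>count_space C)"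
    if "sets N = sets borel" "countable C" "disjoint_family_on (\<lambda>i. cball (fst i) (snd i)) C" for N and C :: "(real \<times> real) set"
    using that by (intro emeasure_UN_countable) auto
  \<comment> \<open>\<open>S\<close> is not known to be measurable, so \<open>s\<close> is an
    infimum over measurable supersets.\<close>
  define \<T> where "\<T> = measure lebesgue ` {T. T \<in> lmeasurable \<and> S \<subseteq> T}"
  define s where "s = Inf \<T>"
  have bdd: "bdd_below \<T>" unfolding \<T>_def by (rule bdd_belowI[of _ 0]) auto
  obtain N where N: "S \<subseteq> cbox (-N) (N::real)"
    using bS bounded_subset_cbox_symmetric by blast
  have ne: "\<T> \<noteq> {}" unfolding \<T>_def using N lmeasurable_cbox by blast
  have s0: "0 \<le> s" unfolding s_def \<T>_def using ne[unfolded \<T>_def] by (intro cInf_greatest) auto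
  have key: "v * s \<le> u * (s + e)" if "e > 0" for e
  proof -
    have "\<exists>T\<in>\<T>. T < s + e / 2"
      using cInf_lessD[OF ne, of "s + e/2"] that s_def by auto
    then obtain T where T: "T \<in> lmeasurable" "S \<subseteq> T" "measure lebesgue T < s + e / 2"
      unfolding \<T>_def by auto
    have "T \<in> sets lebesgue" "0 < e / 2" using T that by (simp_all add: fmeasurableD)
    then obtain U where U: "open U" "T \<subseteq> U" "U - T \<in> lmeasurable" "emeasure lebesgue (U - T) < ennreal (e/2)"
      by (rule sets_lebesgue_outer_open)
    have Um: "U \<in> lmeasurable"
      using fmeasurable.Un[OF T(1) U(3)] U(2) by (simp add: Un_absorb1)
    have "measure lebesgue (U - T) < e / 2"
      using U(4) unfolding emeasure_eq_measure2[OF U(3)] by (simp add: ennreal_less_iff)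
    moreover have "measure lebesgue U \<le> measure lebesgue T + measure lebesgue (U - T)"
      using measure_Un_le[of T lebesgue "U - T"] T(1) U(2,3) by (simp add: fmeasurableD Un_absorb1)
    ultimately have mU: "measure lebesgue U < s + e" using T(3) by simp
    obtain C1 where C1: "countable C1"
        "\<And>i. i \<in> C1 \<Longrightarrow> 0 < snd i \<and> cball (fst i) (snd i) \<subseteq> U \<and>
          g (fst i + snd i) - g (fst i - snd i) < u * (2 * snd i)"
        "disjoint_family_on (\<lambda>i. cball (fst i) (snd i)) C1" "negligible (S \<inter> U - (\<Union>i\<in>C1. cball (fst i) (snd i)))"
    proof (rule Vitali_covering_intervals[OF U(1), of S "\<lambda>c r. g (c + r) - g (c - r) < u * (2 * r)"])
      show "\<exists>c r. 0 < r \<and> r < d \<and> x \<in> cball c r \<and> g (c + r) - g (c - r) < u * (2 * r)"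
        if "x \<in> S" "0 < d" for x d by (rule lo[OF that])
    qed (rule that)
    \<comment> \<open>The second covering has to live in an open set, so the intervals of the first
      one are opened; their countably many endpoints are negligible.\<close>
    define O1 where "O1 = (\<Union>i\<in>C1. ball (fst i) (snd i))"
    have oO1: "open O1" unfolding O1_def by auto
    have neg1: "negligible (S - O1)"
    proof (rule negligible_subset)
      show "negligible ((S \<inter> U - (\<Union>i \<in> C1. cball (fst i) (snd i))) \<union> (\<Union>i\<in>C1. sphere (fst i) (snd i)))"
        using C1 by (intro negligible_Un negligible_countable_Union) (auto intro: negligible_sphere)
      show "S - O1 \<subseteq> (S \<inter> U - (\<Union>i \<in> C1. cball (fst i) (snd i))) \<union> (\<Union>i\<in>C1. sphere (fst i) (snd i))"
        using T(2) U(2) unfolding O1_def by force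
    qed
    obtain C2 where C2: "countable C2"
        "\<And>i. i \<in> C2 \<Longrightarrow> 0 < snd i \<and> cball (fst i) (snd i) \<subseteq> O1 \<and>
          v * (2 * snd i) < g (fst i + snd i) - g (fst i - snd i)"
        "disjoint_family_on (\<lambda>i. cball (fst i) (snd i)) C2" "negligible (S \<inter> O1 - (\<Union>i\<in>C2. cball (fst i) (snd i)))"
    proof (rule Vitali_covering_intervals[OF oO1, of S "\<lambda>c r. v * (2 * r) < g (c + r) - g (c - r)"])
      show "\<exists>c r. 0 < r \<and> r < d \<and> x \<in> cball c r \<and> v * (2 * r) < g (c + r) - g (c - r)"
        if "x \<in> S" "0 < d" for x d by (rule hi[OF that])
    qed (rule that)
    define A where "A = (\<Union>i\<in>C2. cball (fst i) (snd i))"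
    define B where "B = (\<Union>i\<in>C1. cball (fst i) (snd i))"
    have AB: "A \<subseteq> B" "B \<subseteq> U"
    proof -
      have "A \<subseteq> O1" using C2(2) unfolding A_def by blast
      also have "O1 \<subseteq> B" unfolding O1_def B_def by (intro UN_mono ball_subset_cball order_refl)
      finally show "A \<subseteq> B" .
      show "B \<subseteq> U" using C1(2) unfolding B_def by blast
    qed
    have [measurable]: "A \<in> sets borel" "B \<in> sets borel"
      unfolding A_def B_def using C1 C2 by (auto intro!: sets.countable_UN'')
    have "ennreal v * emeasure lborel A = (\<integral>\<^sup>+i. ennreal v * emeasure lborel (cball (fst i) (snd i)) \<partial>count_space C2)"
      unfolding A_def un[OF sets_lborel C2(1,3)] by (simp add: nn_integral_cmult)
    also have "\<dots> \<le> (\<integral>\<^sup>+i. emeasure \<mu> (cball (fst i) (snd i)) \<partial>count_space C2)"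
      using C2(2) uv by (intro nn_integral_mono)
        (auto simp: \<mu>_cball lb_cball ennreal_mult[symmetric] less_imp_le intro!: ennreal_leI)
    also have "\<dots> = emeasure \<mu> A" unfolding A_def un[OF sets_\<mu> C2(1,3)] ..
    also have "\<dots> \<le> emeasure \<mu> B"
      using AB by (intro emeasure_mono) (auto simp: sets_\<mu>)
    also have "\<dots> = (\<integral>\<^sup>+i. emeasure \<mu> (cball (fst i) (snd i)) \<partial>count_space C1)"
      unfolding B_def by (rule un[OF sets_\<mu> C1(1,3)])
    also have "\<dots> \<le> (\<integral>\<^sup>+i. ennreal u * emeasure lborel (cball (fst i) (snd i)) \<partial>count_space C1)"
      using C1(2) uv by (intro nn_integral_mono)
        (auto simp: \<mu>_cball lb_cball ennreal_mult[symmetric] less_imp_le intro!: ennreal_leI)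
    also have "\<dots> = ennreal u * emeasure lborel B"
      unfolding B_def un[OF sets_lborel C1(1,3)] by (simp add: nn_integral_cmult)
    finally have 1: "ennreal v * emeasure lborel A \<le> ennreal u * emeasure lborel B" .
    have Bm: "B \<in> lmeasurable" "A \<in> lmeasurable"
      using fmeasurableI2[OF Um, of B] fmeasurableI2[OF Um, of A] AB by auto
    have "emeasure lborel A = ennreal (measure lebesgue A)" "emeasure lborel B = ennreal (measure lebesgue B)"
      using Bm emeasure_eq_measure2[OF Bm(1)] emeasure_eq_measure2[OF Bm(2)] by simp_all
    with 1 have 2: "v * measure lebesgue A \<le> u * measure lebesgue B"
      using uv by (simp add: ennreal_mult[symmetric])
    have "negligible (S - A)"
      by (rule negligible_subset[OF negligible_Un[OF neg1 C2(4)]]) (auto simp: A_def)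
    then have neg: "S - A \<in> lmeasurable" "measure lebesgue (S - A) = 0"
      by (auto simp: negligible_imp_measurable negligible_imp_measure0)
    have "s \<le> measure lebesgue (A \<union> (S - A))"
      unfolding s_def using fmeasurable.Un[OF Bm(2) neg(1)] bdd
      by (intro cInf_lower) (auto simp: \<T>_def intro!: imageI)
    also have "\<dots> \<le> measure lebesgue A + 0"
      using measure_Un_le[of A lebesgue "S - A"] neg Bm by (simp add: fmeasurableD)
    finally have "v * s \<le> v * measure lebesgue A" using uv by (simp add: mult_left_mono)
    also note 2
    also have "u * measure lebesgue B \<le> u * measure lebesgue U"
      using AB Um Bm uv by (intro mult_left_mono measure_mono_fmeasurable) auto
    also have "\<dots> \<le> u * (s + e)" using mU uv by (simp add: mult_left_mono)
    finally show ?thesis .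
  qed
  have "v * s \<le> u * s"
  proof (rule field_le_epsilon)
    fix e :: real assume "e > 0"
    moreover have "u * (s + e / u) = u * s + e" using uv by (simp add: distrib_left)
    ultimately show "v * s \<le> u * s + e" using key[of "e / u"] uv by simp
  qed
  then have "(v - u) * s \<le> 0" by (simp add: algebra_simps)
  then have "s = 0" using s0 uv by (simp add: mult_le_0_iff)
  show ?thesis unfolding negligible_outer_le
  proof (intro allI impI)
    fix e :: real assume "e > 0"
    then obtain y where "y \<in> \<T>" "y < e"
      using cInf_lessD[OF ne, folded s_def, of e] \<open>s = 0\<close> by auto
    then obtain T where "T \<in> lmeasurable" "S \<subseteq> T" "measure lebesgue T < e"
      unfolding \<T>_def by blast
    then show "\<exists>T. S \<subseteq> T \<and> T \<in> lmeasurable \<and> measure lebesgue T \<le> e"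
      using less_imp_le by blast
  qed
qed

text \<open>Bounded quotients have finite lower and upper limits at 0, and equality of the two would
  produce a derivative. Hence there is room for two numbers strictly between them; rational ones are
  chosen so that countably many pairs exhaust the bad points.\<close>

lemma nondifferentiable_two_slopes:
  fixes g :: "real \<Rightarrow> real"
  assumes nd: "\<not> g differentiable (at x)"
    and bnd: "\<And>h. h \<noteq> 0 \<Longrightarrow> \<bar>(g (x + h) - g x) / h\<bar> \<le> M"
  obtains u v where "u \<in> \<rat>" "v \<in> \<rat>" "u < v"
    "\<exists>\<^sub>F h in at 0. (g (x + h) - g x) / h < u" "\<exists>\<^sub>F h in at 0. v < (g (x + h) - g x) / h"
proof -
  define q where "q = (\<lambda>h. (g (x + h) - g x) / h)"
  let ?q = "\<lambda>h. ereal (q h)"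
  have ev: "\<forall>\<^sub>F h in at 0. \<bar>q h\<bar> \<le> M"
    unfolding eventually_at by (rule exI[of _ 1]) (use bnd in \<open>auto simp: q_def\<close>)
  have lo: "ereal (-M) \<le> Liminf (at 0) ?q"
    by (rule Liminf_bounded) (use ev in \<open>auto elim!: eventually_mono\<close>)
  have hi: "Limsup (at 0) ?q \<le> ereal M"
    by (rule Limsup_bounded) (use ev in \<open>auto elim!: eventually_mono\<close>)
  have le: "Liminf (at 0) ?q \<le> Limsup (at 0) ?q"
    by (rule Liminf_le_Limsup) simp
  have "Liminf (at 0) ?q \<noteq> Limsup (at 0) ?q"
  proof
    assume eq: "Liminf (at 0) ?q = Limsup (at 0) ?q"
    obtain l where l: "Limsup (at 0) ?q = ereal l"
      using lo hi eq by (cases "Limsup (at 0) ?q") auto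
    then have "(?q \<longlongrightarrow> ereal l) (at 0)"
      using eq by (intro Liminf_eq_Limsup) auto
    then have "(q \<longlongrightarrow> l) (at 0)" by simp
    then have "(g has_field_derivative l) (at x)"
      by (simp add: DERIV_def q_def)
    with nd show False by (auto simp: differentiable_def has_field_derivative_def)
  qed
  with le have less: "Liminf (at 0) ?q < Limsup (at 0) ?q" by simp
  obtain v where v: "Liminf (at 0) ?q < ereal (of_rat v)" "ereal (of_rat v) < Limsup (at 0) ?q"
    using ereal_dense3[OF less] by auto
  obtain u where u: "Liminf (at 0) ?q < ereal (of_rat u)" "ereal (of_rat u) < ereal (of_rat v)"
    using ereal_dense3[OF v(1)] by auto
  show thesis
  proof (rule that[of "of_rat u" "of_rat v"])
    show "of_rat u < (of_rat v :: real)" using u by simp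
    show "\<exists>\<^sub>F h in at 0. (g (x + h) - g x) / h < of_rat u"
    proof (rule ccontr)
      assume "\<not> ?thesis"
      then have "ereal (of_rat u) \<le> Liminf (at 0) ?q"
        by (intro Liminf_bounded) (auto simp: frequently_def q_def not_less)
      with u show False by simp
    qed
    show "\<exists>\<^sub>F h in at 0. of_rat v < (g (x + h) - g x) / h"
    proof (rule ccontr)
      assume "\<not> ?thesis"
      then have "Limsup (at 0) ?q \<le> ereal (of_rat v)"
        by (intro Limsup_bounded) (auto simp: frequently_def q_def not_less)
      with v show False by simp
    qed
  qed auto
qed

lemma lipschitz_real_differentiable_ae:
  fixes g :: "real \<Rightarrow> real"
  assumes lip: "L-lipschitz_on UNIV g"
  shows "negligible {x. \<not> g differentiable (at x)}"
proof -
  \<comment> \<open>The linear term moves the slopes from [-L, L] to [1, 2 * L + 1]. Thus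
    \<open>G\<close> increases and defines a Stieltjes measure, and no slope lies below a number
    \<open>u <= 0\<close>.\<close>
  define G where "G = (\<lambda>x. g x + (L + 1) * x)"
  define q where "q = (\<lambda>x h. (G (x + h) - G x) / h)"
  have lipb: "\<bar>g x - g y\<bar> \<le> L * \<bar>x - y\<bar>" for x y
    using lipschitz_onD[OF lip, of x y] by (simp add: dist_real_def)
  have q_eq: "q x h = (g (x + h) - g x) / h + (L + 1)" if "h \<noteq> 0" for x h
    using that by (simp add: q_def G_def field_simps)
  have qg: "\<bar>(g (x + h) - g x) / h\<bar> \<le> L" if "h \<noteq> 0" for x h
    using lipb[of "x + h" x] that by (simp add: divide_le_eq)
  have q1: "1 \<le> q x h" and q2: "q x h \<le> 2 * L + 1" if "h \<noteq> 0" for x h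
    using qg[OF that, of x] q_eq[OF that, of x] by linarith+
  have inc: "G x \<le> G y" if "x \<le> y" for x y
    using q1[of "y - x" x] that by (cases "x = y") (auto simp: q_def field_simps)
  have mono: "mono G" using inc by (rule monoI)
  have cont: "continuous_on UNIV G"
    unfolding G_def by (intro continuous_intros lipschitz_on_continuous_on[OF lip])
  define E where "E = (\<lambda>u v. {x. (\<exists>\<^sub>F h in at 0. q x h < u) \<and> (\<exists>\<^sub>F h in at 0. v < q x h)})"
  have freqD: "\<exists>h. h \<noteq> 0 \<and> \<bar>h\<bar> < d \<and> P h" if "\<exists>\<^sub>F h in at 0. P h" "0 < d" for P and d :: real
    using that unfolding frequently_at by (auto simp: dist_real_def)
  \<comment> \<open>The covering intervals have \<open>x\<close> and \<open>x + h\<close> as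
    endpoints, for either sign of \<open>h\<close>; this is why the covering lemma lets a point lie
    anywhere in its interval.\<close>
  have seg: "x \<in> cball (x + h / 2) (\<bar>h\<bar> / 2) \<and>
      G (x + h / 2 + \<bar>h\<bar> / 2) - G (x + h / 2 - \<bar>h\<bar> / 2) = q x h * \<bar>h\<bar>" if "h \<noteq> 0" for x h
  proof (cases "h > 0")
    case True
    then have "x + h / 2 + \<bar>h\<bar> / 2 = x + h" "x + h / 2 - \<bar>h\<bar> / 2 = x" by (simp_all add: field_simps)
    then show ?thesis using True by (simp add: q_def dist_real_def add.commute)
  next
    case False
    then have "x + h / 2 + \<bar>h\<bar> / 2 = x" "x + h / 2 - \<bar>h\<bar> / 2 = x + h" by (simp_all add: field_simps)
    then show ?thesis using False that by (simp add: q_def dist_real_def add.commute)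
  qed
  have neg: "negligible (E u v)" if "u < v" for u v
  proof (cases "u > 0")
    case False
    have "E u v = {}"
    proof (rule ccontr)
      assume "E u v \<noteq> {}"
      then obtain x where "\<exists>\<^sub>F h in at 0. q x h < u" unfolding E_def by auto
      from freqD[OF this, of 1] obtain h where "h \<noteq> 0" "q x h < u" by auto
      then show False using q1[of h x] False by auto
    qed
    then show ?thesis by simp
  next
    case True
    have "negligible (E u v \<inter> cball 0 (real N))" for N
    proof (rule negligible_two_slopes[OF mono cont True that])
      fix x d :: real assume x: "x \<in> E u v \<inter> cball 0 (real N)" and d: "0 < d"
      obtain h where h: "h \<noteq> 0" "\<bar>h\<bar> < d" "q x h < u"
        using x freqD[of "\<lambda>h. q x h < u" d] d by (auto simp: E_def)
      show "\<exists>c r. 0 < r \<and> r < d \<and> x \<in> cball c r \<and> G (c + r) - G (c - r) < u * (2 * r)"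
        using h seg[of h x] by (intro exI[of _ "x + h / 2"] exI[of _ "\<bar>h\<bar> / 2"]) auto
      obtain h where h: "h \<noteq> 0" "\<bar>h\<bar> < d" "v < q x h"
        using x freqD[of "\<lambda>h. v < q x h" d] d by (auto simp: E_def)
      show "\<exists>c r. 0 < r \<and> r < d \<and> x \<in> cball c r \<and> v * (2 * r) < G (c + r) - G (c - r)"
        using h seg[of h x] by (intro exI[of _ "x + h / 2"] exI[of _ "\<bar>h\<bar> / 2"]) auto
    qed (simp add: bounded_Int)
    then have "negligible (\<Union>N. E u v \<inter> cball 0 (real N))"
      by (intro negligible_countable_Union) auto
    moreover have "(\<Union>N. cball 0 (real N)) = (UNIV :: real set)"
      by (auto simp: dist_real_def real_arch_simple)
    then have "(\<Union>N. E u v \<inter> cball 0 (real N)) = E u v" by blast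
    ultimately show ?thesis by simp
  qed
  have "negligible (\<Union>(u, v) \<in> {(u, v). u \<in> \<rat> \<and> v \<in> \<rat> \<and> u < v}. E u v)"
  proof (intro negligible_countable_Union)
    have "countable ((\<rat> :: real set) \<times> (\<rat> :: real set))" by (intro countable_SIGMA countable_rat)
    then show "countable ((\<lambda>(u, v). E u v) ` {(u, v). u \<in> \<rat> \<and> v \<in> \<rat> \<and> u < v})"
      by (intro countable_image) (rule countable_subset[rotated], auto)
  qed (use neg in auto)
  then show ?thesis
  proof (rule negligible_subset)
    show "{x. \<not> g differentiable (at x)} \<subseteq> (\<Union>(u, v) \<in> {(u, v). u \<in> \<rat> \<and> v \<in> \<rat> \<and> u < v}. E u v)"
    proof
      fix x assume "x \<in> {x. \<not> g differentiable (at x)}"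
      moreover have "g differentiable (at x)" if "G differentiable (at x)"
      proof -
        have "(\<lambda>y. G y - (L + 1) * y) differentiable (at x)"
          using that by (intro derivative_intros) auto
        then show ?thesis by (simp add: G_def)
      qed
      ultimately have nd: "\<not> G differentiable (at x)" by auto
      have "\<bar>(G (x + h) - G x) / h\<bar> \<le> 2 * L + 1" if "h \<noteq> 0" for h
        using q1[OF that, of x] q2[OF that, of x] by (simp add: q_def)
      from nondifferentiable_two_slopes[OF nd this]
      obtain u v where "u \<in> \<rat>" "v \<in> \<rat>" "u < v" "\<exists>\<^sub>F h in at 0. q x h < u" "\<exists>\<^sub>F h in at 0. v < q x h"
        unfolding q_def by blast
      then show "x \<in> (\<Union>(u, v) \<in> {(u, v). u \<in> \<rat> \<and> v \<in> \<rat> \<and> u < v}. E u v)"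
        by (auto simp: E_def)
    qed
  qed
qed

section \<open>Fatou's theorem\<close>

lemma contour_integral_unit_circle:
  "contour_integral (circlepath 0 1) F = integral {0..2 * pi} (\<lambda>t. F (cis t) * \<i> * cis t)"
  unfolding circlepath_def by (subst contour_integral_part_circlepath_eq) auto

lemma has_contour_integral_unit_circle_iff:
  "(F has_contour_integral I) (circlepath 0 1) \<longleftrightarrow>
     ((\<lambda>t. F (cis t) * \<i> * cis t) has_integral I) {0..2 * pi}"
  unfolding circlepath_def by (subst has_contour_integral_part_circlepath_iff) auto

lemma norm_cis_diff_le: "cmod (cis x - cis y) \<le> \<bar>x - y\<bar>"
proof -
  have "cmod (cis x - cis y) = cmod (cis y * (cis (x - y) - 1))"
    by (simp add: algebra_simps cis_mult)
  also have "\<dots> = cmod (exp (\<i> * of_real (x - y)) - 1)"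
    by (simp add: norm_mult cis_conv_exp)
  also have "\<dots> = 2 * \<bar>sin ((x - y) / 2)\<bar>" by (rule dist_exp_i_1)
  also have "\<dots> \<le> \<bar>x - y\<bar>" using abs_sin_x_le_abs_x[of "(x - y) / 2"] by simp
  finally show ?thesis .
qed

lemma ii_mult_ii: "\<i> * (A * \<i> * c) = - (A * c)"
  by (simp add: complex_eq_iff)

lemma one_minus_cnj_self: "1 - cnj z * z = of_real (1 - (cmod z)\<^sup>2)"
  by (simp add: complex_norm_square mult.commute del: of_real_power)

lemma one_minus_cnj_mult_nonzero:
  assumes "cmod a < 1" "cmod z \<le> 1" shows "1 - cnj a * z \<noteq> 0"
proof
  assume "1 - cnj a * z = 0"
  then have "1 = cmod (cnj a * z)" by (metis norm_one right_minus_eq)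
  also have "\<dots> \<le> cmod a * 1" using assms by (simp only: norm_mult complex_mod_cnj) (intro mult_left_mono, auto)
  finally show False using assms by simp
qed

lemma Cauchy_integral_unit_circle:
  assumes "continuous_on (cball 0 1) F" "F holomorphic_on ball 0 1" "cmod w < 1"
  shows "((\<lambda>t. F (cis t) * cis t / (cis t - w)) has_integral (2 * of_real pi * F w)) {0..2 * pi}"
proof -
  have "((\<lambda>u. F u / (u - w)) has_contour_integral (2 * of_real pi * \<i> * F w)) (circlepath 0 1)"
    using assms by (intro Cauchy_integral_circlepath) auto
  then have "((\<lambda>t. F (cis t) / (cis t - w) * \<i> * cis t) has_integral (2 * of_real pi * \<i> * F w)) {0..2 * pi}"
    by (simp add: has_contour_integral_unit_circle_iff)
  then have A: "((\<lambda>t. - \<i> * (F (cis t) / (cis t - w) * \<i> * cis t)) has_integral (- \<i> * (2 * of_real pi * \<i> * F w))) {0..2 * pi}"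
    by (rule has_integral_mult_right)
  have B: "- \<i> * (F (cis t) / (cis t - w) * \<i> * cis t) = F (cis t) * cis t / (cis t - w)" for t
    by (simp only: minus_mult_left[symmetric] ii_mult_ii minus_minus) simp
  have C: "- \<i> * (2 * of_real pi * \<i> * F w) = 2 * of_real pi * F w"
    by (simp only: minus_mult_left[symmetric] ii_mult_ii minus_minus)
  show ?thesis using A by (simp only: B C)
qed

text \<open>Cauchy's formula at \<open>z\<close> for (1 - |z|^2) / (1 - cnj z * w): this function
  has the value 1 at \<open>z\<close>, and on the circle its product with the Cauchy kernel is the
  Poisson kernel.\<close>

lemma Poisson_integral_unit_circle:
  assumes "cmod z < 1"
  shows "((\<lambda>t. (1 - (cmod z)\<^sup>2) / (cmod (cis t - z))\<^sup>2) has_integral 2 * pi) {0..2 * pi}"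
proof -
  define F where "F = (\<lambda>w. (1 - (cmod z)\<^sup>2) / (1 - cnj z * w))"
  note nz = one_minus_cnj_mult_nonzero[OF assms]
  have hol: "F holomorphic_on cball 0 1"
    unfolding F_def by (intro holomorphic_intros) (use nz in auto)
  have Fz: "F z = 1"
  proof -
    note one_minus_cnj_self[of z]
    moreover have "1 - (cmod z)\<^sup>2 \<noteq> 0" using assms norm_ge_zero[of z] by (auto simp: power2_eq_1_iff simp del: norm_ge_zero)
    ultimately show ?thesis by (simp add: F_def del: of_real_diff of_real_power)
  qed
  have A: "((\<lambda>t. F (cis t) * cis t / (cis t - z)) has_integral (2 * of_real pi * F z)) {0..2 * pi}"
    using hol assms by (intro Cauchy_integral_unit_circle holomorphic_on_imp_continuous_on) auto
  have B: "F (cis t) * cis t / (cis t - z)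
      = of_real ((1 - (cmod z)\<^sup>2) / (cmod (cis t - z))\<^sup>2)" for t
  proof -
    have cc: "cis t * cnj (cis t) = 1" by (simp add: cis_cnj cis_mult)
    have "(cmod (cis t - z))\<^sup>2 = (cis t - z) * (cnj (cis t) - cnj z)"
      by (simp add: complex_norm_square del: of_real_power)
    also have "\<dots> = (cis t - z) * ((1 - cnj z * cis t) / cis t)"
      using cc by (simp add: field_simps)
    finally have "of_real ((cmod (cis t - z))\<^sup>2) = (cis t - z) * ((1 - cnj z * cis t) / cis t)" by simp
    then show ?thesis by (simp add: F_def del: of_real_power)
  qed
  have "((\<lambda>t. of_real ((1 - (cmod z)\<^sup>2) / (cmod (cis t - z))\<^sup>2)) has_integral (complex_of_real (2 * pi))) {0..2 * pi}"
    using A unfolding B Fz by simp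
  then have "((\<lambda>t. Re (of_real ((1 - (cmod z)\<^sup>2) / (cmod (cis t - z))\<^sup>2))) has_integral Re (complex_of_real (2 * pi))) {0..2 * pi}"
    by (rule has_integral_Re)
  then show ?thesis by simp
qed

text \<open>Passes from smallness in the angle to smallness in the chord. Since \<open>Ln y\<close>
  is close to \<open>y - 1\<close> near 1, the angle is at most twice the chord, which is why
  \<open>e / 2\<close> is used in the parameter.\<close>

lemma small_o_on_unit_circle:
  fixes H :: "complex \<Rightarrow> complex"
  assumes der: "((\<lambda>t. H (cis t)) has_vector_derivative 0) (at t0)" and H0: "H (cis t0) = 0" and e: "0 < e"
  obtains d where "0 < d" "\<And>w. cmod w = 1 \<Longrightarrow> cmod (w - cis t0) < d \<Longrightarrow> cmod (H w) \<le> e * cmod (w - cis t0)"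
proof -
  have "\<exists>d>0. \<forall>y. norm (y - t0) < d \<longrightarrow> norm (H (cis y) - H (cis t0) - (y - t0) *\<^sub>R 0) \<le> e / 2 * norm (y - t0)"
    using der e unfolding has_vector_derivative_def has_derivative_at_alt by (metis half_gt_zero)
  then obtain d1 where d1: "d1 > 0" "\<And>y. \<bar>y - t0\<bar> < d1 \<Longrightarrow> cmod (H (cis y)) \<le> e / 2 * \<bar>y - t0\<bar>"
    by (auto simp: H0)
  have "(Ln has_derivative (\<lambda>h. h * 1)) (at 1)"
    using has_field_derivative_Ln[of 1, unfolded has_field_derivative_def]
    by (rule has_derivative_eq_rhs) (auto simp: fun_eq_iff)
  then have "\<exists>d>0. \<forall>y. norm (y - 1) < d \<longrightarrow> norm (Ln y - Ln 1 - (y - 1) * 1) \<le> 1 * norm (y - 1)"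
    unfolding has_derivative_at_alt by (meson zero_less_one)
  then obtain d2 where d2: "d2 > 0" "\<And>y. cmod (y - 1) < d2 \<Longrightarrow> cmod (Ln y - (y - 1)) \<le> cmod (y - 1)"
    by auto
  show thesis
  proof (rule that[of "min d2 (d1 / 2)"])
    show "0 < min d2 (d1 / 2)" using d1 d2 by simp
    fix w assume w: "cmod w = 1" "cmod (w - cis t0) < min d2 (d1 / 2)"
    define y where "y = w / cis t0"
    have y1: "cmod y = 1" using w by (simp add: y_def norm_divide)
    then have y0: "y \<noteq> 0" by auto
    have yd: "cmod (y - 1) = cmod (w - cis t0)"
    proof -
      have "y - 1 = (w - cis t0) / cis t0" by (simp add: y_def diff_divide_distrib)
      then show ?thesis by (simp add: norm_divide)
    qed
    define s where "s = Im (Ln y)"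
    have "cmod (Ln y) \<le> cmod (Ln y - (y - 1)) + cmod (y - 1)" by (metis diff_add_cancel norm_triangle_ineq)
    also have "\<dots> \<le> 2 * cmod (w - cis t0)" using d2(2)[of y] w yd by simp
    finally have "\<bar>s\<bar> \<le> 2 * cmod (w - cis t0)" unfolding s_def using abs_Im_le_cmod[of "Ln y"] by linarith
    have "Ln y = \<i> * s" using y1 y0 by (simp add: s_def complex_eq_iff)
    then have "y = cis s" using y0 exp_Ln[of y] by (simp add: cis_conv_exp)
    then have "w = cis (t0 + s)" by (simp add: y_def field_simps cis_mult)
    then have "cmod (H w) \<le> e / 2 * \<bar>s\<bar>" using d1(2)[of "t0 + s"] w \<open>\<bar>s\<bar> \<le> _\<close> by simp
    also have "\<dots> \<le> e / 2 * (2 * cmod (w - cis t0))" using \<open>\<bar>s\<bar> \<le> _\<close> e by (intro mult_left_mono) auto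
    finally show "cmod (H w) \<le> e * cmod (w - cis t0)" by simp
  qed
qed

text \<open>The unit circle is an Apollonius circle of a point and its reflection, so the two
  distances have a constant ratio on it.\<close>

lemma norm_unit_diff_reflected:
  assumes "cmod w = 1" "cmod w0 = 1" "0 < r"
  shows "cmod (w - w0 / of_real r) = cmod (w - of_real r * w0) / r"
proof -
  have "w - w0 / of_real r = (of_real r * w - w0) / of_real r" using assms by (simp add: field_simps)
  then have 1: "cmod (w - w0 / of_real r) = cmod (of_real r * w - w0) / r"
    using assms by (simp add: norm_divide)
  have "w * cnj w = 1" "w0 * cnj w0 = 1"
    using assms by (simp_all add: complex_norm_square[symmetric])
  moreover have "w0 * w * cnj (w - of_real r * w0) = w0 * (w * cnj w) - of_real r * w * (w0 * cnj w0)"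
    by (simp add: algebra_simps)
  ultimately have eq: "w0 * w * cnj (w - of_real r * w0) = - (of_real r * w - w0)"
    by simp
  have "cmod (w - of_real r * w0) = cmod (w0 * w * cnj (w - of_real r * w0))"
    using assms by (simp add: norm_mult del: complex_cnj_diff complex_cnj_mult)
  also have "\<dots> = cmod (of_real r * w - w0)"
    by (simp only: eq norm_minus_cancel)
  finally show ?thesis using 1 by simp
qed

text \<open>
  In Cauchy's formula for \<open>H'\<close> at \<open>z = r w0\<close> the kernel is corrected by its counterpart at the
  reflected point \<open>z' = w0 / r\<close>. This gains a factor \<open>(1 - r) / \<bar>w - z\<bar>\<close>, without which the integral
  of \<open>o(\<bar>w - w0\<bar>)\<close> would diverge logarithmically.
\<close>

lemma primitive_radial_estimate:
  fixes H f :: "complex \<Rightarrow> complex"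
  assumes contH: "continuous_on (cball 0 1) H"
    and der: "\<And>z. z \<in> ball 0 1 \<Longrightarrow> (H has_field_derivative f z) (at z)"
    and w0: "cmod w0 = 1" and e: "0 < e" "0 < d" "0 < K"
    and near: "\<And>w. cmod w = 1 \<Longrightarrow> cmod (w - w0) < d \<Longrightarrow> cmod (H w) \<le> e * cmod (w - w0)"
    and bnd: "\<And>w. cmod w = 1 \<Longrightarrow> cmod (H w) \<le> K"
    and r: "0 < r" "r < 1" "1 - r < d / 2"
  shows "cmod (f (of_real r * w0)) \<le> 4 * e + 16 * K * (1 - r\<^sup>2) / d ^ 3"
proof -
  define z z' where "z = of_real r * w0" and "z' = w0 / of_real r"
  \<comment> \<open>\<open>q w = 1 - ((w - z) / (w - z'))^2\<close> has value 1 and derivative 0 at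
    \<open>z\<close>, so \<open>H * q\<close> has the same derivative there as \<open>H\<close>. On
    the circle its modulus is at most a constant times (1 - r^2) / |w - z|.\<close>
  define q where "q = (\<lambda>w. (z - z') * (2 * w - z - z') / (w - z')\<^sup>2)"
  define Q where "Q = (\<lambda>w. H w * q w)"
  have nz: "cmod z = r" using w0 r by (simp add: z_def norm_mult)
  have nz': "cmod z' = 1 / r" "1 < cmod z'" using w0 r by (simp_all add: z'_def norm_divide)
  have nz'0: "w - z' \<noteq> 0" if "cmod w \<le> 1" for w using nz' that by auto
  have q_alt: "q w = 1 - (w - z)\<^sup>2 / (w - z')\<^sup>2" if "cmod w \<le> 1" for w
  proof -
    have "(z - z') * (2 * w - z - z') = (w - z')\<^sup>2 - (w - z)\<^sup>2"
      by (simp add: power2_eq_square algebra_simps)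
    then show ?thesis using nz'0[OF that] by (simp add: q_def diff_divide_distrib)
  qed
  have contQ: "continuous_on (cball 0 1) Q"
    unfolding Q_def q_def by (intro continuous_intros contH) (use nz'0 in auto)
  have holH: "H holomorphic_on ball 0 1"
    using der has_field_derivative_at_within
    unfolding holomorphic_on_def field_differentiable_def by blast
  have holQ: "Q holomorphic_on ball 0 1"
    unfolding Q_def q_def by (intro holomorphic_intros holH) (use nz'0 in auto)
  have zb: "z \<in> ball 0 1" using nz r by simp
  note C = Cauchy_derivative_integral_circlepath[OF contQ holQ zb]
  have "((\<lambda>w. 1 - (w - z)\<^sup>2 / (w - z')\<^sup>2) has_field_derivative 0) (at z)"
    using nz'0[of z] nz r by (auto intro!: derivative_eq_intros)
  then have "(q has_field_derivative 0) (at z)"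
    by (rule has_field_derivative_transform_within_open[of _ _ _ "ball 0 1"]) (use q_alt zb in auto)
  then have "(Q has_field_derivative (f z * q z + 0 * H z)) (at z)"
    unfolding Q_def using der[OF zb] by (rule DERIV_mult[rotated])
  moreover have "q z = 1" using q_alt[of z] nz r by simp
  ultimately have "f z = 1 / (2 * of_real pi * \<i>) * contour_integral (circlepath 0 1) (\<lambda>u. Q u / (u - z)\<^sup>2)"
    using DERIV_unique[OF C(2)] by force
  then have fz: "cmod (f z) = cmod (contour_integral (circlepath 0 1) (\<lambda>u. Q u / (u - z)\<^sup>2)) / (2 * pi)"
    by (simp add: norm_divide norm_mult)
  have pw: "cmod (Q w / (w - z)\<^sup>2) \<le> 4 * e * ((1 - r\<^sup>2) / (cmod (w - z))\<^sup>2) + 16 * K * (1 - r\<^sup>2) / d ^ 3"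
    if w: "cmod w = 1" for w
  proof -
    define x where "x = cmod (w - z)"
    have xr: "1 - r \<le> x" unfolding x_def using norm_triangle_ineq2[of w z] w nz by simp
    then have x0: "0 < x" using r by simp
    have wz': "cmod (w - z') = x / r"
      using norm_unit_diff_reflected[OF w w0 r(1)] by (simp add: z'_def z_def x_def)
    have zz': "cmod (z - z') = (1 - r\<^sup>2) / r"
    proof -
      have "z - z' = w0 * of_real (r - 1 / r)" by (simp add: z_def z'_def field_simps)
      then have "cmod (z - z') = \<bar>r - 1 / r\<bar>" using w0 by (simp only: norm_mult norm_of_real) simp
      also have "r - 1 / r = - ((1 - r\<^sup>2) / r)" using r by (simp add: field_simps power2_eq_square)
      finally show ?thesis using r by (simp add: abs_square_le_1 power_le_one)
    qed
    have "cmod (2 * w - z - z') \<le> cmod (w - z) + cmod (w - z')"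
      using norm_triangle_ineq[of "w - z" "w - z'"] by (simp add: algebra_simps)
    also have "\<dots> = x * (1 + 1 / r)" by (simp add: wz' x_def[symmetric] field_simps)
    also have "\<dots> \<le> x * (2 / r)" using r x0 by (intro mult_left_mono) (auto simp: field_simps)
    finally have s: "cmod (2 * w - z - z') \<le> 2 * x / r" by (simp add: mult.commute)
    have r2: "0 \<le> 1 - r\<^sup>2" using r by (simp add: power_le_one)
    have "cmod (Q w / (w - z)\<^sup>2) = cmod (H w) * ((1 - r\<^sup>2) / r * cmod (2 * w - z - z') / (x / r)\<^sup>2) / x\<^sup>2"
      by (simp add: Q_def q_def norm_mult norm_divide norm_power wz' zz' x_def[symmetric])
    also have "\<dots> \<le> cmod (H w) * ((1 - r\<^sup>2) / r * (2 * x / r) / (x / r)\<^sup>2) / x\<^sup>2"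
      using s r2 r x0 by (intro divide_right_mono mult_left_mono) auto
    also have "\<dots> = 2 * cmod (H w) * (1 - r\<^sup>2) / x ^ 3"
      using r x0 by (simp add: field_simps power2_eq_square power3_eq_cube)
    finally have 1: "cmod (Q w / (w - z)\<^sup>2) \<le> 2 * cmod (H w) * (1 - r\<^sup>2) / x ^ 3" .
    have "w - w0 = (w - z) + (of_real (r - 1) * w0)" by (simp add: z_def algebra_simps)
    then have "cmod (w - w0) \<le> x + cmod (of_real (r - 1) * w0)" using norm_triangle_ineq x_def by metis
    then have ww0: "cmod (w - w0) \<le> x + (1 - r)" using w0 r by (simp only: norm_mult norm_of_real) simp
    \<comment> \<open>Near \<open>w0\<close> the bound \<open>e * cmod (w - w0) <= 2 * e * x\<close>
      leaves a Poisson kernel, whose integral does not depend on \<open>r\<close>. Away from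
      \<open>w0\<close> the distance \<open>x\<close> to \<open>z\<close> is at least
      \<open>d / 2\<close>.\<close>
    show ?thesis
    proof (cases "cmod (w - w0) < d")
      case True
      have "cmod (H w) \<le> e * cmod (w - w0)" by (rule near[OF w True])
      also have "\<dots> \<le> e * (2 * x)" using ww0 xr e by (intro mult_left_mono) auto
      finally have "cmod (H w) \<le> e * (2 * x)" .
      then have "2 * cmod (H w) * (1 - r\<^sup>2) / x ^ 3 \<le> 2 * (e * (2 * x)) * (1 - r\<^sup>2) / x ^ 3"
        using r2 x0 by (intro divide_right_mono mult_right_mono) auto
      also have "\<dots> = 4 * e * ((1 - r\<^sup>2) / x\<^sup>2)"
        using x0 by (simp add: field_simps power2_eq_square power3_eq_cube)
      finally show ?thesis using 1 r2 e unfolding x_def[symmetric] by (simp add: add_increasing2)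
    next
      case False
      then have xd: "d / 2 \<le> x" using ww0 r(3) by simp
      have "2 * cmod (H w) * (1 - r\<^sup>2) / x ^ 3 \<le> 2 * K * (1 - r\<^sup>2) / (d / 2) ^ 3"
        using r2 x0 e bnd[OF w] xd by (intro frac_le mult_right_mono power_mono) auto
      also have "\<dots> = 16 * K * (1 - r\<^sup>2) / d ^ 3"
        by (simp add: power_divide)
      finally have "cmod (Q w / (w - z)\<^sup>2) \<le> 16 * K * (1 - r\<^sup>2) / d ^ 3" using 1 by simp
      moreover have "0 \<le> 4 * e * ((1 - r\<^sup>2) / x\<^sup>2)" using e r2 by simp
      ultimately show ?thesis unfolding x_def[symmetric] by simp
    qed
  qed
  define C' where "C' = 16 * K * (1 - r\<^sup>2) / d ^ 3"
  have P: "((\<lambda>t. 4 * e * ((1 - r\<^sup>2) / (cmod (cis t - z))\<^sup>2) + C') has_integral (4 * e * (2 * pi) + C' * (2 * pi))) {0..2 * pi}"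
  proof (intro has_integral_add has_integral_mult_right)
    show "((\<lambda>t. (1 - r\<^sup>2) / (cmod (cis t - z))\<^sup>2) has_integral 2 * pi) {0..2 * pi}"
      using Poisson_integral_unit_circle[of z] nz r by simp
    show "((\<lambda>t. C') has_integral C' * (2 * pi)) {0..2 * pi}"
      using has_integral_const_real[of C' 0 "2 * pi"] by (simp add: mult.commute)
  qed
  have "cmod (integral {0..2 * pi} (\<lambda>t. Q (cis t) / (cis t - z)\<^sup>2 * \<i> * cis t))
      \<le> integral {0..2 * pi} (\<lambda>t. 4 * e * ((1 - r\<^sup>2) / (cmod (cis t - z))\<^sup>2) + C')"
  proof (rule integral_norm_bound_integral)
    show "(\<lambda>t. Q (cis t) / (cis t - z)\<^sup>2 * \<i> * cis t) integrable_on {0..2 * pi}"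
    proof (rule integrable_continuous_real, intro continuous_intros)
      show "continuous_on {0..2 * pi} (\<lambda>t. Q (cis t))"
        by (rule continuous_on_compose2[OF contQ]) (auto intro!: continuous_intros)
      show "\<forall>t\<in>{0..2 * pi}. (cis t - z)\<^sup>2 \<noteq> 0"
        using nz r by (auto simp: dest!: arg_cong[of _ _ cmod])
    qed
    show "(\<lambda>t. 4 * e * ((1 - r\<^sup>2) / (cmod (cis t - z))\<^sup>2) + C') integrable_on {0..2 * pi}"
      using P by blast
    show "cmod (Q (cis t) / (cis t - z)\<^sup>2 * \<i> * cis t) \<le> 4 * e * ((1 - r\<^sup>2) / (cmod (cis t - z))\<^sup>2) + C'" for t
    proof -
      have "cmod (Q (cis t) / (cis t - z)\<^sup>2 * \<i> * cis t) = cmod (Q (cis t) / (cis t - z)\<^sup>2)"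
        by (simp add: norm_mult norm_divide)
      then show ?thesis using pw[of "cis t"] by (simp add: C'_def)
    qed
  qed
  also have "\<dots> = 2 * pi * (4 * e + C')" using P by (simp add: integral_unique algebra_simps)
  finally have "cmod (contour_integral (circlepath 0 1) (\<lambda>u. Q u / (u - z)\<^sup>2)) \<le> 2 * pi * (4 * e + C')"
    by (simp add: contour_integral_unit_circle)
  then have "cmod (f z) \<le> 4 * e + C'" unfolding fz by (simp add: divide_le_eq mult.commute)
  then show ?thesis by (simp add: C'_def z_def)
qed

text \<open>After subtraction of an affine function with slope \<open>c\<close>, the primitive is
  o(|w - w0|) on the circle at \<open>w0 = cis t0\<close>, and its derivative in the disc is
  \<open>f - c\<close>. Here \<open>c\<close> is \<open>D\<close> divided by the derivative of
  \<open>cis\<close> at \<open>t0\<close>.\<close>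

lemma Fatou_at_differentiable_point:
  assumes cont: "continuous_on (cball 0 1) \<Phi>"
    and der: "\<And>z. z \<in> ball 0 1 \<Longrightarrow> (\<Phi> has_field_derivative f z) (at z)"
    and D: "((\<lambda>t. \<Phi> (cis t)) has_vector_derivative D) (at t0)"
  shows "((\<lambda>r. f (of_real r * cis t0)) \<longlongrightarrow> D / (\<i> * cis t0)) (at_left (1::real))"
proof -
  define w0 where "w0 = cis t0"
  define c where "c = D / (\<i> * w0)"
  define H where "H = (\<lambda>w. \<Phi> w - \<Phi> w0 - c * (w - w0))"
  have contH: "continuous_on (cball 0 1) H"
    unfolding H_def by (intro continuous_intros cont)
  have derH: "(H has_field_derivative (f z - c)) (at z)" if "z \<in> ball 0 1" for z
    unfolding H_def by (auto intro!: derivative_eq_intros der[OF that])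
  have "((\<lambda>t. H (cis t)) has_vector_derivative (D - 0 - c * (\<i> * cis t0 - 0))) (at t0)"
    unfolding H_def
  proof (intro has_vector_derivative_diff has_vector_derivative_mult_right D has_vector_derivative_const)
    show "(cis has_vector_derivative \<i> * cis t0) (at t0)"
      unfolding has_vector_derivative_def by (auto intro!: derivative_eq_intros simp: scaleR_conv_of_real)
  qed
  then have derH0: "((\<lambda>t. H (cis t)) has_vector_derivative 0) (at t0)"
    by (simp add: c_def w0_def)
  have "bounded (H ` cball 0 1)"
    using contH by (intro compact_imp_bounded compact_continuous_image) auto
  then obtain K where K: "0 < K" "\<And>w. cmod w \<le> 1 \<Longrightarrow> cmod (H w) \<le> K"
    by (auto simp: bounded_pos)
  show ?thesis unfolding w0_def[symmetric] c_def[symmetric]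
  proof (rule tendstoI)
    fix e :: real assume e: "e > 0"
    define e' where "e' = e / 8"
    have e': "e' > 0" using e by (simp add: e'_def)
    obtain d where d: "0 < d" "\<And>w. cmod w = 1 \<Longrightarrow> cmod (w - cis t0) < d \<Longrightarrow> cmod (H w) \<le> e' * cmod (w - cis t0)"
      using small_o_on_unit_circle[OF derH0 _ e'] by (auto simp: H_def w0_def)
    have "((\<lambda>r. 16 * K * (1 - r\<^sup>2) / d ^ 3) \<longlongrightarrow> 16 * K * (1 - 1\<^sup>2) / d ^ 3) (at_left (1::real))"
      using d by (intro tendsto_intros) auto
    then have "\<forall>\<^sub>F r in at_left (1::real). 16 * K * (1 - r\<^sup>2) / d ^ 3 < e / 2"
      using e by (intro order_tendstoD) auto
    moreover have "\<forall>\<^sub>F r in at_left (1::real). r \<in> {max 0 (1 - d / 2)<..<1}"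
      using d by (intro eventually_at_left_real) auto
    ultimately show "\<forall>\<^sub>F r in at_left 1. dist (f (of_real r * w0)) c < e"
    proof eventually_elim
      case (elim r)
      have "cmod (f (of_real r * w0) - c) \<le> 4 * e' + 16 * K * (1 - r\<^sup>2) / d ^ 3"
        by (rule primitive_radial_estimate[where f = "\<lambda>z. f z - c", OF contH derH])
          (use elim e' d K in \<open>auto simp: w0_def\<close>)
      also have "\<dots> < e" using elim by (simp add: e'_def)
      finally show ?case by (simp add: dist_norm)
    qed
  qed
qed

text \<open>The bound on \<open>f\<close> makes its primitive Lipschitz on the convex disc, hence
  extendable to the closed disc. Differentiability almost everywhere is then applied to the real and
  imaginary parts of its boundary values.\<close>

theorem Fatou_radial_limit:
  assumes hol: "f holomorphic_on ball 0 1" and bdd: "bounded (f ` ball 0 1)"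
  shows "AE t in lborel. \<exists>l. ((\<lambda>r. f (of_real r * cis t)) \<longlongrightarrow> l) (at_left (1::real))"
proof -
  obtain M where M: "0 < M" "\<And>z. cmod z < 1 \<Longrightarrow> cmod (f z) \<le> M"
    using bdd by (auto simp: bounded_pos)
  obtain \<Phi>0 where \<Phi>0: "\<And>z. z \<in> ball 0 1 \<Longrightarrow> (\<Phi>0 has_field_derivative f z) (at z within ball 0 1)"
    using holomorphic_convex_primitive'[OF convex_ball open_ball hol] by blast
  have "M-lipschitz_on (ball 0 1) \<Phi>0"
  proof (rule lipschitz_onI)
    show "dist (\<Phi>0 x) (\<Phi>0 y) \<le> M * dist x y" if "x \<in> ball 0 1" "y \<in> ball 0 1" for x y
      unfolding dist_norm by (rule field_differentiable_bound[OF convex_ball \<Phi>0]) (use M that in auto)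
  qed (use M in simp)
  from lipschitz_extend_closure[OF this]
  obtain \<Phi> where \<Phi>: "M-lipschitz_on (cball 0 1) \<Phi>" "\<And>z. z \<in> ball 0 1 \<Longrightarrow> \<Phi> z = \<Phi>0 z" by auto
  have cont: "continuous_on (cball 0 1) \<Phi>" by (rule lipschitz_on_continuous_on[OF \<Phi>(1)])
  have der: "(\<Phi> has_field_derivative f z) (at z)" if "z \<in> ball 0 1" for z
  proof (rule has_field_derivative_transform_within_open[of \<Phi>0 _ _ "ball 0 1"])
    show "(\<Phi>0 has_field_derivative f z) (at z)"
      using \<Phi>0[OF that] that by (simp add: at_within_open[OF _ open_ball])
  qed (use that \<Phi>(2) in auto)
  have lip: "dist (\<Phi> (cis x)) (\<Phi> (cis y)) \<le> M * dist x y" for x y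
  proof -
    have "dist (\<Phi> (cis x)) (\<Phi> (cis y)) \<le> M * dist (cis x) (cis y)"
      by (rule lipschitz_onD[OF \<Phi>(1)]) auto
    also have "\<dots> \<le> M * dist x y"
      using M norm_cis_diff_le[of x y] by (intro mult_left_mono) (auto simp: dist_norm)
    finally show ?thesis .
  qed
  have ae: "AE t in lebesgue. (\<lambda>t. F (\<Phi> (cis t))) differentiable (at t)"
    if "\<And>z w. \<bar>F z - F w\<bar> \<le> cmod (z - w)" for F :: "complex \<Rightarrow> real"
  proof -
    have "M-lipschitz_on UNIV (\<lambda>t. F (\<Phi> (cis t)))"
    proof (rule lipschitz_onI)
      show "dist (F (\<Phi> (cis x))) (F (\<Phi> (cis y))) \<le> M * dist x y" for x y
        using that[of "\<Phi> (cis x)" "\<Phi> (cis y)"] lip[of x y] by (simp add: dist_norm)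
    qed (use M in simp)
    then show ?thesis
      using lipschitz_real_differentiable_ae eventually_ae_filter_negligible by blast
  qed
  have 1: "AE t in lebesgue. (\<lambda>t. Re (\<Phi> (cis t))) differentiable (at t)"
    by (rule ae) (metis abs_Re_le_cmod minus_complex.sel(1))
  have 2: "AE t in lebesgue. (\<lambda>t. Im (\<Phi> (cis t))) differentiable (at t)"
    by (rule ae) (metis abs_Im_le_cmod minus_complex.sel(2))
  from 1 2 have "AE t in lebesgue. \<exists>l. ((\<lambda>r. f (of_real r * cis t)) \<longlongrightarrow> l) (at_left (1::real))"
  proof eventually_elim
    case (elim t)
    then obtain a b where "((\<lambda>t. Re (\<Phi> (cis t))) has_field_derivative a) (at t)"
        "((\<lambda>t. Im (\<Phi> (cis t))) has_field_derivative b) (at t)"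
      by (auto simp: real_differentiable_def)
    then have "((\<lambda>t. \<Phi> (cis t)) has_vector_derivative Complex a b) (at t)"
      by (intro has_vector_derivative_complex_iff[THEN iffD2])
        (auto simp: has_real_derivative_iff_has_vector_derivative)
    from Fatou_at_differentiable_point[OF cont der this] show ?case by blast
  qed
  then show ?thesis by (simp add: AE_completion_iff)
qed

section \<open>Blaschke products\<close>

definition blaschke_const :: "complex \<Rightarrow> complex" where
  "blaschke_const a = (if a = 0 then -1 else of_real (cmod a) / a)"

lemma norm_blaschke_const [simp]: "cmod (blaschke_const a) = 1"
  by (simp add: blaschke_const_def norm_divide)

lemma blaschke_factor_eq:
  "blaschke_factor a z = - blaschke_const a * (z - a) / (1 - cnj a * z)"
  by (simp add: blaschke_factor_def blaschke_const_def field_simps)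

lemma norm_one_minus_cnj_mult_ge: "1 - cmod a * cmod z \<le> cmod (1 - cnj a * z)"
  using norm_triangle_ineq2[of 1 "cnj a * z"] by (simp add: norm_mult)

lemma norm_one_minus_cnj_commute: "cmod (1 - cnj a * z) = cmod (1 - cnj z * a)"
proof -
  have "cnj (1 - cnj a * z) = 1 - cnj z * a" by simp
  then show ?thesis by (metis complex_mod_cnj)
qed

lemma one_minus_norm_mult_ge:
  fixes a z :: complex
  assumes "cmod a \<le> 1" "cmod z \<le> 1"
  shows "1 - cmod a \<le> cmod (1 - cnj a * z)" "1 - cmod z \<le> cmod (1 - cnj a * z)"
  using norm_one_minus_cnj_mult_ge[of a z] assms mult_left_le[of "cmod z" "cmod a"] mult_left_le[of "cmod a" "cmod z"]
  by (simp_all add: mult.commute)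

lemma norm_cnj_mult_identity:
  "(cmod (1 - cnj a * z))\<^sup>2 - (cmod (z - a))\<^sup>2 = (1 - (cmod a)\<^sup>2) * (1 - (cmod z)\<^sup>2)"
  unfolding cmod_power2 by (simp add: algebra_simps power2_eq_square)

lemma one_minus_blaschke_factor_sq:
  assumes "cmod a < 1" "cmod z \<le> 1"
  shows "1 - (cmod (blaschke_factor a z))\<^sup>2 =
    (1 - (cmod a)\<^sup>2) * (1 - (cmod z)\<^sup>2) / (cmod (1 - cnj a * z))\<^sup>2"
proof -
  have nz: "cmod (1 - cnj a * z) \<noteq> 0" using one_minus_cnj_mult_nonzero[OF assms] by simp
  have "cmod (blaschke_factor a z) = cmod (z - a) / cmod (1 - cnj a * z)"
    by (simp add: blaschke_factor_eq norm_mult norm_divide)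
  then have "1 - (cmod (blaschke_factor a z))\<^sup>2
      = ((cmod (1 - cnj a * z))\<^sup>2 - (cmod (z - a))\<^sup>2) / (cmod (1 - cnj a * z))\<^sup>2"
    using nz by (simp add: power_divide diff_divide_distrib)
  then show ?thesis by (simp only: norm_cnj_mult_identity)
qed

lemma norm_blaschke_factor_le_1:
  assumes "cmod a < 1" "cmod z \<le> 1" shows "cmod (blaschke_factor a z) \<le> 1"
proof -
  have "0 \<le> 1 - (cmod (blaschke_factor a z))\<^sup>2"
    unfolding one_minus_blaschke_factor_sq[OF assms] using assms by (simp add: power_le_one)
  then show ?thesis by (simp add: power2_nonneg_ge_1_iff abs_square_le_1)
qed

lemma norm_blaschke_factor_circle:
  assumes "cmod a < 1" "cmod z = 1" shows "cmod (blaschke_factor a z) = 1"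
proof -
  have "1 - (cmod (blaschke_factor a z))\<^sup>2 = 0"
    using one_minus_blaschke_factor_sq[of a z] assms by simp
  then show ?thesis using norm_ge_zero[of "blaschke_factor a z"] by (auto simp: power2_eq_1_iff simp del: norm_ge_zero)
qed

lemma blaschke_factor_eq_0_iff:
  assumes "cmod a < 1" "cmod z \<le> 1" shows "blaschke_factor a z = 0 \<longleftrightarrow> z = a"
proof -
  have "blaschke_const a \<noteq> 0" by (metis norm_blaschke_const norm_zero zero_neq_one)
  then show ?thesis using one_minus_cnj_mult_nonzero[OF assms] by (simp add: blaschke_factor_eq)
qed

text \<open>The unimodular constant normalises the factor so that its distance from 1 carries the
  factor \<open>1 - cmod a\<close>. This makes the infinite product converge and its tails tend to
  1.\<close>

lemma blaschke_factor_minus_1: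
  assumes "cmod a < 1" "cmod z < 1"
  shows "cmod (blaschke_factor a z - 1) \<le> 2 * (1 - cmod a) / (1 - cmod z)"
proof -
  have nz: "1 - cnj a * z \<noteq> 0" using one_minus_cnj_mult_nonzero[of a z] assms by simp
  have "blaschke_factor a z - 1 = - of_real (1 - cmod a) * (1 + blaschke_const a * z) / (1 - cnj a * z)"
  proof (cases "a = 0")
    case False
    have "blaschke_const a * a = of_real (cmod a)" "cnj a = of_real (cmod a) * blaschke_const a"
      using False complex_norm_square[of a] by (simp_all add: blaschke_const_def field_simps power2_eq_square)
    then show ?thesis using nz by (simp add: blaschke_factor_eq field_simps)
  next
    case True
    then show ?thesis by (simp add: blaschke_factor_eq blaschke_const_def)
  qed
  then have "cmod (blaschke_factor a z - 1) = (1 - cmod a) * cmod (1 + blaschke_const a * z) / cmod (1 - cnj a * z)"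
    using assms by (simp only: norm_mult norm_divide norm_minus_cancel norm_of_real)
  also have "\<dots> \<le> (1 - cmod a) * 2 / (1 - cmod z)"
  proof (intro frac_le mult_left_mono mult_nonneg_nonneg)
    show "cmod (1 + blaschke_const a * z) \<le> 2"
      using norm_triangle_ineq[of 1 "blaschke_const a * z"] assms by (simp add: norm_mult)
    show "1 - cmod z \<le> cmod (1 - cnj a * z)" using one_minus_norm_mult_ge[of a z] assms by simp
  qed (use assms in auto)
  finally show ?thesis by (simp add: mult.commute)
qed

lemma holomorphic_blaschke_factor:
  assumes "cmod a < 1" shows "blaschke_factor a holomorphic_on cball 0 1"
proof -
  have "(\<lambda>z. - blaschke_const a * (z - a) / (1 - cnj a * z)) holomorphic_on cball 0 1"
    by (intro holomorphic_intros) (use one_minus_cnj_mult_nonzero[OF assms] in auto)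
  then show ?thesis by (simp add: blaschke_factor_eq[abs_def])
qed

lemma norm_prod_minus_1_le:
  fixes w :: "'i \<Rightarrow> complex"
  assumes "finite A" "\<And>i. i \<in> A \<Longrightarrow> cmod (w i) \<le> 1"
  shows "cmod ((\<Prod>i\<in>A. w i) - 1) \<le> (\<Sum>i\<in>A. cmod (w i - 1))"
  using norm_prod_diff[of A w "\<lambda>_. 1"] assms by simp

text \<open>Arbitrary index sets treat finite products, tails and the product with one factor
  deleted alike.\<close>

definition blaschke_on :: "(nat \<Rightarrow> complex) \<Rightarrow> nat set \<Rightarrow> complex \<Rightarrow> complex" where
  "blaschke_on a S z = (\<Prod>j. if j \<in> S then blaschke_factor (a j) z else 1)"

lemma blaschke_eq_blaschke_on: "blaschke a = blaschke_on a UNIV"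
  by (simp add: blaschke_def blaschke_on_def fun_eq_iff)

lemma holomorphic_disc_limit:
  assumes hol: "\<And>n. f n holomorphic_on ball 0 1"
    and le: "\<And>n z. cmod z < 1 \<Longrightarrow> cmod (f n z - g z) \<le> e n / (1 - cmod z)" and e: "e \<longlonglongrightarrow> 0"
  shows "g holomorphic_on ball 0 1"
proof (rule holomorphic_uniform_sequence[OF open_ball hol])
  fix x :: complex assume x: "x \<in> ball 0 1"
  define d where "d = (1 - cmod x) / 2"
  have d: "d > 0" using x by (simp add: d_def)
  have e0: "0 \<le> e n" for n using le[of 0 n] norm_ge_zero[of "f n 0 - g 0"] by (simp del: norm_ge_zero)
  have sub: "cmod z \<le> 1 - d" if "z \<in> cball x d" for z
    using that norm_triangle_ineq2[of z x] by (simp add: d_def dist_norm norm_minus_commute field_simps)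
  show "\<exists>d>0. cball x d \<subseteq> ball 0 1 \<and> uniform_limit (cball x d) f g sequentially"
  proof (intro exI conjI uniform_limitI)
    show "cball x d \<subseteq> ball 0 1" using sub d by fastforce
    fix \<epsilon> :: real assume "0 < \<epsilon>"
    then have "\<forall>\<^sub>F n in sequentially. e n < \<epsilon> * d" using e d by (intro order_tendstoD) auto
    then show "\<forall>\<^sub>F n in sequentially. \<forall>z\<in>cball x d. dist (f n z) (g z) < \<epsilon>"
    proof eventually_elim
      case (elim n)
      show ?case
      proof
        fix z assume z: "z \<in> cball x d"
        have "dist (f n z) (g z) \<le> e n / (1 - cmod z)"
          unfolding dist_norm using sub[OF z] d by (intro le) simp
        also have "\<dots> \<le> e n / d" using sub[OF z] d e0 by (intro divide_left_mono) auto
        also have "\<dots> < \<epsilon>" using elim d by (simp add: pos_divide_less_eq)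
        finally show "dist (f n z) (g z) < \<epsilon>" .
      qed
    qed
  qed (use d in auto)
qed

section \<open>Convergence, holomorphy and derivatives of Blaschke products over index sets\<close>

locale blaschke_sequence =
  fixes a :: "nat \<Rightarrow> complex"
  assumes in_disc: "cmod (a j) < 1"
    and summable_defect: "summable (\<lambda>j. 1 - cmod (a j))"
begin

definition \<beta> :: "nat \<Rightarrow> complex \<Rightarrow> complex" where "\<beta> j = blaschke_factor (a j)"

definition \<mu> :: "nat \<Rightarrow> real" where "\<mu> j = 1 - cmod (a j)"

lemma zeros_kernel: "\<mu> j \<le> cmod (1 - cnj (a j) * a k)" "\<mu> k \<le> cmod (1 - cnj (a j) * a k)"
    "0 < cmod (1 - cnj (a j) * a k)"
  using one_minus_norm_mult_ge[of "a j" "a k"] in_disc[of j] in_disc[of k]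
    one_minus_cnj_mult_nonzero[OF in_disc less_imp_le[OF in_disc], of j k]
  by (auto simp: \<mu>_def)

lemma \<mu>_pos: "0 < \<mu> j" and \<mu>_le_1: "\<mu> j \<le> 1"
  using in_disc by (simp_all add: \<mu>_def)

lemma summable_\<mu>: "summable \<mu>"
  using summable_defect by (simp add: \<mu>_def[abs_def])

lemma norm_\<beta>_le_1: "cmod z \<le> 1 \<Longrightarrow> cmod (\<beta> j z) \<le> 1"
  unfolding \<beta>_def by (rule norm_blaschke_factor_le_1[OF in_disc])

lemma norm_\<beta>_circle: "cmod z = 1 \<Longrightarrow> cmod (\<beta> j z) = 1"
  unfolding \<beta>_def by (rule norm_blaschke_factor_circle[OF in_disc])

lemma \<beta>_eq_0_iff: "cmod z \<le> 1 \<Longrightarrow> \<beta> j z = 0 \<longleftrightarrow> z = a j"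
  unfolding \<beta>_def by (rule blaschke_factor_eq_0_iff[OF in_disc])

lemma blaschke_on_tendsto:
  assumes "cmod z < 1"
  shows "(\<lambda>n. \<Prod>j\<in>S \<inter> {..<n}. \<beta> j z) \<longlonglongrightarrow> blaschke_on a S z"
proof -
  let ?w = "\<lambda>j. if j \<in> S then blaschke_factor (a j) z else 1"
  have "summable (\<lambda>j. cmod (?w j - 1))"
  proof (rule summable_comparison_test')
    show "summable (\<lambda>j. 2 / (1 - cmod z) * (1 - cmod (a j)))"
      by (intro summable_mult summable_defect)
    show "norm (cmod (?w j - 1)) \<le> 2 / (1 - cmod z) * (1 - cmod (a j))" if "j \<ge> 0" for j
      using blaschke_factor_minus_1[OF in_disc[of j] assms] in_disc[of j] assms by simp
  qed
  then have "abs_convergent_prod ?w" by (simp add: abs_convergent_prod_conv_summable)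
  then have "convergent_prod ?w" by (rule abs_convergent_prod_imp_convergent_prod)
  then have "(\<lambda>n. \<Prod>j\<le>n. ?w j) \<longlonglongrightarrow> prodinf ?w" by (rule convergent_prod_LIMSEQ)
  then have "(\<lambda>n. \<Prod>j<Suc n. ?w j) \<longlonglongrightarrow> blaschke_on a S z"
    by (simp add: blaschke_on_def lessThan_Suc_atMost)
  then have "(\<lambda>n. \<Prod>j<n. ?w j) \<longlonglongrightarrow> blaschke_on a S z" by (rule LIMSEQ_imp_Suc)
  moreover have "(\<Prod>j<n. ?w j) = (\<Prod>j\<in>S \<inter> {..<n}. \<beta> j z)" for n
    by (simp add: prod.inter_restrict[symmetric] \<beta>_def Int_commute)
  ultimately show ?thesis by simp
qed

lemma blaschke_on_finite:
  assumes "finite S" "cmod z < 1" shows "blaschke_on a S z = (\<Prod>j\<in>S. \<beta> j z)"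
proof -
  obtain N where N: "S \<subseteq> {..<N}" using assms(1) finite_nat_iff_bounded by blast
  have "(\<lambda>n. \<Prod>j\<in>S \<inter> {..<n}. \<beta> j z) \<longlonglongrightarrow> (\<Prod>j\<in>S. \<beta> j z)"
  proof (rule tendsto_eventually, unfold eventually_sequentially, intro exI allI impI)
    fix n assume "N \<le> n"
    then have "S \<inter> {..<n} = S" using N by auto
    then show "(\<Prod>j\<in>S \<inter> {..<n}. \<beta> j z) = (\<Prod>j\<in>S. \<beta> j z)" by simp
  qed
  then show ?thesis using blaschke_on_tendsto[OF assms(2)] LIMSEQ_unique by blast
qed

lemma blaschke_on_Un:
  assumes "S \<inter> T = {}" "cmod z < 1"
  shows "blaschke_on a (S \<union> T) z = blaschke_on a S z * blaschke_on a T z"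
proof -
  have "(\<lambda>n. (\<Prod>j\<in>S \<inter> {..<n}. \<beta> j z) * (\<Prod>j\<in>T \<inter> {..<n}. \<beta> j z)) \<longlonglongrightarrow> blaschke_on a S z * blaschke_on a T z"
    by (intro tendsto_mult blaschke_on_tendsto assms)
  moreover have "(\<Prod>j\<in>S \<inter> {..<n}. \<beta> j z) * (\<Prod>j\<in>T \<inter> {..<n}. \<beta> j z) = (\<Prod>j\<in>(S \<union> T) \<inter> {..<n}. \<beta> j z)" for n
    using assms by (subst prod.union_disjoint[symmetric]) (auto intro!: prod.cong)
  ultimately show ?thesis using LIMSEQ_unique[OF blaschke_on_tendsto[OF assms(2), of "S \<union> T"]] by simp
qed

lemma norm_blaschke_on_le_1:
  assumes "cmod z < 1" shows "cmod (blaschke_on a S z) \<le> 1"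
proof (rule LIMSEQ_le_const2[OF tendsto_norm[OF blaschke_on_tendsto[OF assms]]])
  show "\<exists>N. \<forall>n\<ge>N. cmod (\<Prod>j\<in>S \<inter> {..<n}. \<beta> j z) \<le> 1"
    unfolding prod_norm[symmetric] using norm_\<beta>_le_1 assms by (auto intro!: prod_le_1)
qed

lemma norm_blaschke_on_antimono:
  assumes "S \<subseteq> T" "cmod z < 1" shows "cmod (blaschke_on a T z) \<le> cmod (blaschke_on a S z)"
proof -
  have "blaschke_on a T z = blaschke_on a S z * blaschke_on a (T - S) z"
    using blaschke_on_Un[of S "T - S" z] assms by (simp add: Un_absorb1)
  then show ?thesis using norm_blaschke_on_le_1[OF assms(2), of "T - S"]
    by (simp add: norm_mult mult_left_le)
qed

lemma blaschke_on_minus_1: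
  assumes "cmod z < 1" "S \<subseteq> {n..}"
  shows "cmod (blaschke_on a S z - 1) \<le> 2 / (1 - cmod z) * (\<Sum>j. \<mu> (j + n))"
proof (rule LIMSEQ_le_const2[OF tendsto_norm[OF tendsto_diff[OF blaschke_on_tendsto[OF assms(1)] tendsto_const]]],
    intro exI allI impI)
  fix N assume "N \<ge> n"
  have "cmod ((\<Prod>j\<in>S \<inter> {..<N}. \<beta> j z) - 1) \<le> (\<Sum>j\<in>S \<inter> {..<N}. cmod (\<beta> j z - 1))"
    using norm_\<beta>_le_1 assms by (intro norm_prod_minus_1_le) auto
  also have "\<dots> \<le> (\<Sum>j\<in>S \<inter> {..<N}. 2 / (1 - cmod z) * \<mu> j)"
    using blaschke_factor_minus_1[OF in_disc assms(1)] by (intro sum_mono) (auto simp: \<beta>_def \<mu>_def)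
  also have "\<dots> \<le> (\<Sum>j\<in>{n..<N}. 2 / (1 - cmod z) * \<mu> j)"
    using assms by (intro sum_mono2) (auto simp: less_imp_le[OF \<mu>_pos])
  also have "\<dots> = 2 / (1 - cmod z) * (\<Sum>j<N-n. \<mu> (j + n))"
    using \<open>N \<ge> n\<close> sum.shift_bounds_nat_ivl[of \<mu> 0 n "N - n"]
    by (simp add: sum_distrib_left[symmetric] sum_divide_distrib[symmetric] atLeast0LessThan)
  also have "\<dots> \<le> 2 / (1 - cmod z) * (\<Sum>j. \<mu> (j + n))"
    using assms by (intro mult_left_mono sum_le_suminf summable_ignore_initial_segment summable_\<mu>)
      (simp_all add: less_imp_le[OF \<mu>_pos])
  finally show "cmod ((\<Prod>j\<in>S \<inter> {..<N}. \<beta> j z) - 1) \<le> 2 / (1 - cmod z) * (\<Sum>j. \<mu> (j + n))" .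
qed

lemma tail_\<mu>_tendsto_0: "(\<lambda>n. \<Sum>j. \<mu> (j + n)) \<longlonglongrightarrow> 0"
  using suminf_exist_split2[OF summable_\<mu>] .

lemma blaschke_on_split:
  assumes "cmod z < 1"
  shows "blaschke_on a S z = (\<Prod>j\<in>S \<inter> {..<n}. \<beta> j z) * blaschke_on a (S \<inter> {n..}) z"
proof -
  have "blaschke_on a (S \<inter> {..<n} \<union> S \<inter> {n..}) z = blaschke_on a (S \<inter> {..<n}) z * blaschke_on a (S \<inter> {n..}) z"
    by (rule blaschke_on_Un[OF _ assms]) auto
  moreover have "S \<inter> {..<n} \<union> S \<inter> {n..} = S" by auto
  ultimately show ?thesis using blaschke_on_finite[of "S \<inter> {..<n}" z] assms by simp
qed

lemma holomorphic_\<beta>: "\<beta> j holomorphic_on cball 0 1"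
  unfolding \<beta>_def by (rule holomorphic_blaschke_factor[OF in_disc])

lemma holomorphic_blaschke_on: "blaschke_on a S holomorphic_on ball 0 1"
proof (rule holomorphic_disc_limit)
  show "(\<lambda>z. \<Prod>j\<in>S \<inter> {..<n}. \<beta> j z) holomorphic_on ball 0 1" for n
    by (intro holomorphic_intros holomorphic_on_subset[OF holomorphic_\<beta>]) auto
  show "(\<lambda>n. 2 * (\<Sum>j. \<mu> (j + n))) \<longlonglongrightarrow> 0"
    using tendsto_mult_left[OF tail_\<mu>_tendsto_0, of 2] by simp
  fix n z assume z: "cmod z < 1"
  have "cmod ((\<Prod>j\<in>S \<inter> {..<n}. \<beta> j z) - blaschke_on a S z)
      = cmod (\<Prod>j\<in>S \<inter> {..<n}. \<beta> j z) * cmod (blaschke_on a (S \<inter> {n..}) z - 1)"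
    by (subst blaschke_on_split[OF z, of _ n]) (simp add: norm_minus_commute norm_mult[symmetric] algebra_simps)
  also have "\<dots> \<le> 1 * (2 / (1 - cmod z) * (\<Sum>j. \<mu> (j + n)))"
    by (intro mult_mono blaschke_on_minus_1)
      (use z norm_\<beta>_le_1 in \<open>auto simp: prod_norm[symmetric] intro!: prod_le_1\<close>)
  finally show "cmod ((\<Prod>j\<in>S \<inter> {..<n}. \<beta> j z) - blaschke_on a S z) \<le> 2 * (\<Sum>j. \<mu> (j + n)) / (1 - cmod z)"
    by simp
qed

lemma blaschke_tail_tendsto_1:
  assumes "cmod z < 1" shows "(\<lambda>n. blaschke_on a {n..} z) \<longlonglongrightarrow> 1"
proof -
  have "(\<lambda>n. 2 / (1 - cmod z) * (\<Sum>j. \<mu> (j + n))) \<longlonglongrightarrow> 2 / (1 - cmod z) * 0"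
    by (intro tendsto_intros tail_\<mu>_tendsto_0)
  then have lim: "(\<lambda>n. 2 / (1 - cmod z) * (\<Sum>j. \<mu> (j + n))) \<longlonglongrightarrow> 0" by simp
  have "(\<lambda>n. blaschke_on a {n..} z - 1) \<longlonglongrightarrow> 0"
    by (rule Lim_null_comparison[OF _ lim]) (use blaschke_on_minus_1[OF assms] in auto)
  then show ?thesis by (simp add: LIM_zero_iff)
qed

lemma blaschke_eq_factor_mult:
  assumes "cmod z < 1" shows "blaschke a z = \<beta> j z * blaschke_on a (- {j}) z"
  using blaschke_on_Un[of "{j}" "- {j}" z] blaschke_on_finite[of "{j}" z] assms
  by (simp add: blaschke_eq_blaschke_on)

lemma blaschke_zero [simp]: "blaschke a (a j) = 0"
  using blaschke_eq_factor_mult[OF in_disc[of j], of j] \<beta>_eq_0_iff[of "a j" j] in_disc[of j] by simp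

lemma DERIV_blaschke:
  "(blaschke a has_field_derivative
      - blaschke_const (a j) * blaschke_on a (- {j}) (a j) / of_real (1 - (cmod (a j))\<^sup>2)) (at (a j))"
proof -
  let ?g = "\<lambda>z. - blaschke_const (a j) * blaschke_on a (- {j}) z / (1 - cnj (a j) * z)"
  have aj: "a j \<in> ball 0 1" using in_disc[of j] by simp
  have "?g holomorphic_on ball 0 1"
    by (intro holomorphic_intros holomorphic_blaschke_on) (use one_minus_cnj_mult_nonzero[OF in_disc] in auto)
  then obtain g' where "(?g has_field_derivative g') (at (a j))"
    using holomorphic_derivI[OF _ open_ball aj] by blast
  then have "((\<lambda>z. (z - a j) * ?g z) has_field_derivative ((1 - 0) * ?g (a j) + g' * (a j - a j))) (at (a j))"
    by (intro derivative_intros)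
  moreover have "(z - a j) * ?g z = blaschke a z" if "z \<in> ball 0 1" for z
    using blaschke_eq_factor_mult[of z j] that by (simp add: \<beta>_def blaschke_factor_eq mult.commute mult.left_commute)
  ultimately have "(blaschke a has_field_derivative ((1 - 0) * ?g (a j) + g' * (a j - a j))) (at (a j))"
    using has_field_derivative_transform_within_open[OF _ open_ball aj] by blast
  moreover note one_minus_cnj_self[of "a j"]
  ultimately show ?thesis by simp
qed

text \<open>Turns the interpolation condition on the derivative into uniform separation of the
  zeros.\<close>

lemma norm_deriv_blaschke:
  "cmod (deriv (blaschke a) (a j)) * (1 - (cmod (a j))\<^sup>2) = cmod (blaschke_on a (- {j}) (a j))"
proof -
  have "1 - (cmod (a j))\<^sup>2 > 0" using in_disc[of j] by (simp add: abs_square_less_1)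
  then show ?thesis
  proof -
    have "cmod (deriv (blaschke a) (a j)) = cmod (blaschke_on a (- {j}) (a j)) / \<bar>1 - (cmod (a j))\<^sup>2\<bar>"
      unfolding DERIV_imp_deriv[OF DERIV_blaschke] norm_mult norm_divide norm_minus_cancel norm_of_real by simp
    with \<open>1 - (cmod (a j))\<^sup>2 > 0\<close> show ?thesis by (simp del: zero_less_diff diff_gt_0_iff_gt)
  qed
qed

end

section \<open>Carleson embedding for interpolating sequences\<close>

text \<open>With the indices sorted by decreasing \<open>h\<close>, the left side is a lower Riemann
  sum for the integral of exp (- s) over [0, sum x A]; ties only make the exponentials smaller. The
  induction removes an index with least \<open>h\<close>, whose exponent involves all of
  \<open>A\<close>.\<close>

lemma sum_exp_partial_sums_le_1:
  fixes x h :: "'i \<Rightarrow> real"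
  assumes "finite A" "\<And>i. i \<in> A \<Longrightarrow> 0 \<le> x i"
  shows "(\<Sum>k\<in>A. x k * exp (- (\<Sum>j | j \<in> A \<and> h k \<le> h j. x j))) \<le> 1 - exp (- sum x A)"
  using assms
proof (induction "card A" arbitrary: A)
  case 0
  then show ?case by simp
next
  case (Suc n)
  then have ne: "A \<noteq> {}" by auto
  obtain m where m: "m \<in> A" "\<And>i. i \<in> A \<Longrightarrow> h m \<le> h i"
    using ex_min_if_finite[of "h ` A"] ne Suc.prems(1) by (metis arg_min_if_finite(1) arg_min_least)
  define A' where "A' = A - {m}"
  have A': "A = insert m A'" "m \<notin> A'" "finite A'" "card A' = n"
    using m(1) Suc by (auto simp: A'_def)
  have IH: "(\<Sum>k\<in>A'. x k * exp (- (\<Sum>j | j \<in> A' \<and> h k \<le> h j. x j))) \<le> 1 - exp (- sum x A')"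
    by (rule Suc.hyps(1)) (use A' Suc.prems in auto)
  have "{j \<in> A. h m \<le> h j} = A" using m by auto
  then have "(\<Sum>k\<in>A. x k * exp (- (\<Sum>j | j \<in> A \<and> h k \<le> h j. x j)))
      = x m * exp (- sum x A) + (\<Sum>k\<in>A'. x k * exp (- (\<Sum>j | j \<in> A \<and> h k \<le> h j. x j)))"
    using A' by simp
  also have "\<dots> \<le> x m * exp (- sum x A) + (\<Sum>k\<in>A'. x k * exp (- (\<Sum>j | j \<in> A' \<and> h k \<le> h j. x j)))"
  proof (intro add_left_mono sum_mono mult_left_mono)
    fix k assume "k \<in> A'"
    have "(\<Sum>j | j \<in> A' \<and> h k \<le> h j. x j) \<le> (\<Sum>j | j \<in> A \<and> h k \<le> h j. x j)"
      using Suc.prems A' by (intro sum_mono2) auto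
    then show "exp (- (\<Sum>j | j \<in> A \<and> h k \<le> h j. x j)) \<le> exp (- (\<Sum>j | j \<in> A' \<and> h k \<le> h j. x j))" by simp
    show "0 \<le> x k" using \<open>k \<in> A'\<close> A' Suc.prems by auto
  qed
  also have "\<dots> \<le> x m * exp (- sum x A) + (1 - exp (- sum x A'))" using IH by simp
  also have "\<dots> \<le> 1 - exp (- sum x A)"
  proof -
    have s: "- sum x A' = - sum x A + x m" using A' by simp
    have "exp (- sum x A) * (x m + 1) \<le> exp (- sum x A) * exp (x m)"
      using exp_ge_add_one_self[of "x m"] by (intro mult_left_mono) (auto simp: add.commute)
    also have "\<dots> = exp (- sum x A')" unfolding s exp_add by simp
    finally show ?thesis by (simp add: algebra_simps)
  qed
  finally show ?case .
qed

lemma Re_Herglotz_kernel: "w \<noteq> 1 \<Longrightarrow> Re ((1 + w) / (1 - w)) = (1 - (cmod w)\<^sup>2) / (cmod (1 - w))\<^sup>2"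
  by (simp add: Re_divide cmod_power2) (simp add: power2_eq_square algebra_simps)

locale interpolating_sequence = blaschke_sequence +
  fixes \<delta> :: real
  assumes \<delta>_pos: "0 < \<delta>" and uniformly_separated: "\<delta> \<le> cmod (blaschke_on a (- {j}) (a j))"
begin

lemma \<delta>_le_1: "\<delta> \<le> 1"
  using uniformly_separated[of 0] norm_blaschke_on_le_1[OF in_disc[of 0], of "- {0}"] by simp

lemma separation_prod:
  assumes "finite A" "k \<notin> A" shows "\<delta> \<le> (\<Prod>i\<in>A. cmod (\<beta> i (a k)))"
proof -
  have "\<delta> \<le> cmod (blaschke_on a (- {k}) (a k))" by (rule uniformly_separated)
  also have "\<dots> \<le> cmod (blaschke_on a A (a k))"
    using assms by (intro norm_blaschke_on_antimono in_disc) auto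
  finally show ?thesis using assms in_disc by (simp add: blaschke_on_finite prod_norm)
qed

lemma zeros_distance:
  assumes "j \<noteq> k" shows "\<delta> * cmod (1 - cnj (a j) * a k) \<le> cmod (a k - a j)"
proof -
  have "cmod (\<beta> j (a k)) = cmod (a k - a j) / cmod (1 - cnj (a j) * a k)"
    by (simp add: \<beta>_def blaschke_factor_eq norm_mult norm_divide)
  then show ?thesis using separation_prod[of "{j}" k] assms zeros_kernel(3)[of j k] by (simp add: le_divide_eq)
qed

lemma separation: "i \<noteq> k \<Longrightarrow> \<delta> \<le> cmod (\<beta> i (a k))"
  using separation_prod[of "{i}" k] by simp

lemma a_inj: "a i = a k \<longleftrightarrow> i = k"
proof
  assume "a i = a k"
  then have "\<beta> i (a k) = 0" using \<beta>_eq_0_iff[of "a k" i] in_disc[of k] by simp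
  then show "i = k" using separation[of i k] \<delta>_pos by (cases "i = k") simp_all
qed simp

text \<open>One minus the squared pseudohyperbolic distance of \<open>a i\<close> and
  \<open>a k\<close>.\<close>

definition \<E> :: "nat \<Rightarrow> nat \<Rightarrow> real" where
  "\<E> i k = (1 - (cmod (a i))\<^sup>2) * (1 - (cmod (a k))\<^sup>2) / (cmod (1 - cnj (a i) * a k))\<^sup>2"

definition \<Lambda> :: real where "\<Lambda> = 1 - 2 * ln \<delta>"

lemma one_minus_sq_bounds: "\<mu> j \<le> 1 - (cmod (a j))\<^sup>2" "1 - (cmod (a j))\<^sup>2 \<le> 2 * \<mu> j" "0 < 1 - (cmod (a j))\<^sup>2"
proof -
  have "1 - (cmod (a j))\<^sup>2 = \<mu> j * (1 + cmod (a j))" by (simp add: \<mu>_def power2_eq_square algebra_simps)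
  moreover have "\<mu> j * 1 \<le> \<mu> j * (1 + cmod (a j))" "\<mu> j * (1 + cmod (a j)) \<le> \<mu> j * 2"
    using \<mu>_pos[of j] in_disc[of j] by (intro mult_left_mono; simp)+
  ultimately show "\<mu> j \<le> 1 - (cmod (a j))\<^sup>2" "1 - (cmod (a j))\<^sup>2 \<le> 2 * \<mu> j" "0 < 1 - (cmod (a j))\<^sup>2"
    using \<mu>_pos[of j] by linarith+
qed

lemma \<E>_eq: "\<E> i k = 1 - (cmod (\<beta> i (a k)))\<^sup>2"
  using in_disc[of k] by (simp add: \<E>_def \<beta>_def one_minus_blaschke_factor_sq[OF in_disc])

lemma \<E>_nonneg: "0 \<le> \<E> i k"
  unfolding \<E>_def using one_minus_sq_bounds(3)[of i] one_minus_sq_bounds(3)[of k] by simp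

text \<open>By 1 - y^2 <= - 2 ln y, the sum over the other zeros is at most the logarithm of a
  product that separation bounds from below. The diagonal term accounts for the summand 1 in
  \<open>\<Lambda>\<close>.\<close>

lemma sum_\<E>_le:
  assumes "finite A" shows "(\<Sum>i\<in>A. \<E> i k) \<le> \<Lambda>"
proof -
  have pos: "0 < cmod (\<beta> i (a k))" if "i \<in> A - {k}" for i
    using separation[of i k] \<delta>_pos that by auto
  have "(\<Sum>i\<in>A - {k}. \<E> i k) \<le> (\<Sum>i\<in>A - {k}. - 2 * ln (cmod (\<beta> i (a k))))"
  proof (rule sum_mono)
    fix i assume i: "i \<in> A - {k}"
    have "ln ((cmod (\<beta> i (a k)))\<^sup>2) \<le> (cmod (\<beta> i (a k)))\<^sup>2 - 1"
      using pos[OF i] by (intro ln_le_minus_one) simp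
    then show "\<E> i k \<le> - 2 * ln (cmod (\<beta> i (a k)))"
      using pos[OF i] by (simp add: \<E>_eq ln_realpow)
  qed
  also have "\<dots> = - 2 * ln (\<Prod>i\<in>A - {k}. cmod (\<beta> i (a k)))"
    using pos assms by (subst ln_prod) (auto simp: sum_distrib_left)
  also have "\<dots> \<le> - 2 * ln \<delta>"
    using separation_prod[of "A - {k}" k] assms \<delta>_pos by simp
  finally have "(\<Sum>i\<in>A - {k}. \<E> i k) \<le> - 2 * ln \<delta>" .
  moreover have "(\<Sum>i\<in>A. \<E> i k) \<le> \<E> k k + (\<Sum>i\<in>A - {k}. \<E> i k)"
    using assms \<E>_nonneg[of k k] by (cases "k \<in> A") (simp_all add: sum.remove)
  moreover have "\<E> k k \<le> 1" by (simp add: \<E>_eq)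
  ultimately show ?thesis by (simp add: \<Lambda>_def)
qed

text \<open>
  The bound comes from Cauchy's formula at each \<open>a k\<close> with P. Jones' damping factor
  \<open>exp (L k (a k) - L k z)\<close>: it equals \<open>1\<close> at \<open>a k\<close>, while on the circle it makes the kernels sum to at
  most a constant.
\<close>

lemma Carleson_embedding:
  assumes cont: "continuous_on (cball 0 1) F" and hol: "F holomorphic_on ball 0 1" and A: "finite A"
  shows "(\<Sum>k\<in>A. \<mu> k * cmod (F (a k))) \<le> exp (2 * \<Lambda>) / (2 * pi) * integral {0..2 * pi} (\<lambda>t. cmod (F (cis t)))"
proof -
  define s where "s = (\<lambda>j. 1 - (cmod (a j))\<^sup>2)"
  have s: "0 < s j" "\<mu> j \<le> s j" for j using one_minus_sq_bounds[of j] by (auto simp: s_def)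
  \<comment> \<open>Only zeros at least as close to the circle as \<open>a k\<close> are kept: for
    them 1 - |a j|^2 |a k|^2 <= 2 * s k, which bounds \<open>Re (L k (a k))\<close>. The modulus
    also serves as the ordering \<open>h\<close> in the lemma on sums of exponentials.\<close>
  define Ak where "Ak = (\<lambda>k. {j \<in> A. cmod (a k) \<le> cmod (a j)})"
  \<comment> \<open>A combination of Herglotz kernels. Its real part is the sum of the
    \<open>x z j\<close> on the circle, which produces the damping, and at most
    \<open>2 * \<Lambda>\<close> at \<open>a k\<close>, which bounds the price of normalising the
    damping factor there.\<close>
  define L where "L = (\<lambda>k z. \<Sum>j\<in>Ak k. of_real (s j) * ((1 + cnj (a j) * z) / (1 - cnj (a j) * z)))"
  define x where "x = (\<lambda>z j. (s j / cmod (1 - cnj (a j) * z))\<^sup>2)"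
  have nz: "cnj (a j) * z \<noteq> 1" if "cmod z \<le> 1" for j z
    using one_minus_cnj_mult_nonzero[OF in_disc that, of j] by auto
  have ReL: "Re (L k z) = (\<Sum>j\<in>Ak k. s j * ((1 - (cmod (a j) * cmod z)\<^sup>2) / (cmod (1 - cnj (a j) * z))\<^sup>2))"
    if "cmod z \<le> 1" for k z
  proof -
    have "Re (L k z) = (\<Sum>j\<in>Ak k. Re (of_real (s j) * ((1 + cnj (a j) * z) / (1 - cnj (a j) * z))))"
      by (simp add: L_def)
    also have "\<dots> = (\<Sum>j\<in>Ak k. s j * ((1 - (cmod (a j) * cmod z)\<^sup>2) / (cmod (1 - cnj (a j) * z))\<^sup>2))"
    proof (rule sum.cong[OF refl])
      fix j
      have "Re (of_real (s j) * ((1 + cnj (a j) * z) / (1 - cnj (a j) * z)))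
          = s j * Re ((1 + cnj (a j) * z) / (1 - cnj (a j) * z))" by (simp del: times_divide_eq_right)
      then show "Re (of_real (s j) * ((1 + cnj (a j) * z) / (1 - cnj (a j) * z)))
          = s j * ((1 - (cmod (a j) * cmod z)\<^sup>2) / (cmod (1 - cnj (a j) * z))\<^sup>2)"
        by (simp only: Re_Herglotz_kernel[OF nz[OF that]] norm_mult complex_mod_cnj)
    qed
    finally show ?thesis .
  qed
  have ReL_circle: "Re (L k z) = (\<Sum>j\<in>Ak k. x z j)" if "cmod z = 1" for k z
  proof -
    have "Re (L k z) = (\<Sum>j\<in>Ak k. s j * ((1 - (cmod (a j) * cmod z)\<^sup>2) / (cmod (1 - cnj (a j) * z))\<^sup>2))"
      using that by (intro ReL) simp
    also have "\<dots> = (\<Sum>j\<in>Ak k. x z j)"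
      using that by (intro sum.cong) (auto simp: x_def s_def power2_eq_square)
    finally show ?thesis .
  qed
  have ReL_zero: "Re (L k (a k)) \<le> 2 * \<Lambda>" for k
  proof -
    have "Re (L k (a k)) \<le> (\<Sum>j\<in>Ak k. 2 * \<E> j k)"
      unfolding ReL[OF less_imp_le[OF in_disc]]
    proof (rule sum_mono)
      fix j assume "j \<in> Ak k"
      then have "cmod (a k) * cmod (a k) \<le> cmod (a j) * cmod (a k)" by (intro mult_right_mono) (auto simp: Ak_def)
      then have "((cmod (a k))\<^sup>2)\<^sup>2 \<le> (cmod (a j) * cmod (a k))\<^sup>2"
        by (intro power_mono) (auto simp: power2_eq_square)
      then have "1 - (cmod (a j) * cmod (a k))\<^sup>2 \<le> s k * (1 + (cmod (a k))\<^sup>2)"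
        by (simp add: s_def power2_eq_square algebra_simps)
      also have "\<dots> \<le> s k * 2"
        using s(1)[of k] in_disc[of k] by (intro mult_left_mono) (auto simp: abs_square_le_1 power_le_one)
      finally have "s j * ((1 - (cmod (a j) * cmod (a k))\<^sup>2) / (cmod (1 - cnj (a j) * a k))\<^sup>2)
          \<le> s j * (s k * 2 / (cmod (1 - cnj (a j) * a k))\<^sup>2)"
        using s(1)[of j] by (intro mult_left_mono divide_right_mono) auto
      also have "\<dots> = 2 * \<E> j k" by (simp add: \<E>_def s_def)
      finally show "s j * ((1 - (cmod (a j) * cmod (a k))\<^sup>2) / (cmod (1 - cnj (a j) * a k))\<^sup>2) \<le> 2 * \<E> j k" .
    qed
    also have "\<dots> \<le> 2 * \<Lambda>"
      using sum_\<E>_le[of "Ak k" k] A by (simp add: sum_distrib_left[symmetric] Ak_def)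
    finally show ?thesis .
  qed
  have contF: "continuous_on {0..2 * pi} (\<lambda>t. F (cis t))"
    by (rule continuous_on_compose2[OF cont]) (auto intro!: continuous_intros)
  define w where "w = (\<lambda>k t. x (cis t) k * exp (- (\<Sum>j\<in>Ak k. x (cis t) j)))"
  have nzc: "1 - cnj (a j) * cis t \<noteq> 0" for j t
    using one_minus_cnj_mult_nonzero[OF in_disc, of "cis t" j] by simp
  have contw: "continuous_on {0..2 * pi} (w k)" for k
    unfolding w_def x_def using nzc by (intro continuous_intros) auto
  have "(\<Sum>k\<in>A. \<mu> k * cmod (F (a k)))
      \<le> (\<Sum>k\<in>A. exp (2 * \<Lambda>) / (2 * pi) * integral {0..2 * pi} (\<lambda>t. cmod (F (cis t)) * w k t))"
  proof (rule sum_mono)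
    fix k
    \<comment> \<open>The kernel \<open>s k / (1 - cnj (a k) * z)\<close> is 1 at
      \<open>a k\<close>, so \<open>G\<close> and \<open>F\<close> agree there. On the circle this
      kernel and the Cauchy kernel together have modulus
      \<open>s k / cmod (1 - cnj (a k) * z)^2\<close>, and \<open>\<mu> k <= s k\<close> supplies
      the missing factor of \<open>x z k\<close>.\<close>
    define G where "G = (\<lambda>z. F z * of_real (s k) / (1 - cnj (a k) * z) * exp (L k (a k) - L k z))"
    have Lc: "continuous_on (cball 0 1) (L k)" and Lh: "L k holomorphic_on ball 0 1"
      unfolding L_def by (intro continuous_intros holomorphic_intros; use nz in auto)+
    have "G (a k) = F (a k)"
    proof -
      have "1 - cnj (a k) * a k = of_real (s k)"
        by (simp only: s_def one_minus_cnj_self)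
      then show ?thesis using s(1)[of k] by (simp add: G_def)
    qed
    moreover have "((\<lambda>t. G (cis t) * cis t / (cis t - a k)) has_integral (2 * of_real pi * G (a k))) {0..2 * pi}"
    proof (rule Cauchy_integral_unit_circle)
      show "continuous_on (cball 0 1) G"
        unfolding G_def by (intro continuous_intros cont Lc) (use nz[of _ k] in auto)
      show "G holomorphic_on ball 0 1"
        unfolding G_def by (intro holomorphic_intros hol Lh) (use nz[of _ k] in auto)
    qed (rule in_disc)
    ultimately have int: "((\<lambda>t. G (cis t) * cis t / (cis t - a k)) has_integral (2 * of_real pi * F (a k))) {0..2 * pi}" by simp
    have bd: "\<mu> k * cmod (G (cis t) * cis t / (cis t - a k)) \<le> exp (2 * \<Lambda>) * (cmod (F (cis t)) * w k t)" for t
    proof -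
      have e: "cmod (cis t - a k) = cmod (1 - cnj (a k) * cis t)"
        using norm_cnj_mult_identity[of "a k" "cis t"] by simp
      have "cmod (exp (L k (a k) - L k (cis t))) = exp (Re (L k (a k)) - Re (L k (cis t)))" by simp
      also have "\<dots> \<le> exp (2 * \<Lambda>) * exp (- (\<Sum>j\<in>Ak k. x (cis t) j))"
        using ReL_zero[of k] by (simp add: ReL_circle exp_add[symmetric])
      finally have e2: "cmod (exp (L k (a k) - L k (cis t))) \<le> exp (2 * \<Lambda>) * exp (- (\<Sum>j\<in>Ak k. x (cis t) j))" .
      have "\<mu> k * cmod (G (cis t) * cis t / (cis t - a k))
          = cmod (F (cis t)) * (\<mu> k * s k / (cmod (1 - cnj (a k) * cis t))\<^sup>2) * cmod (exp (L k (a k) - L k (cis t)))"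
        using s(1)[of k] by (simp add: G_def norm_mult norm_divide e power2_eq_square)
      also have "\<dots> \<le> cmod (F (cis t)) * x (cis t) k * (exp (2 * \<Lambda>) * exp (- (\<Sum>j\<in>Ak k. x (cis t) j)))"
      proof (intro mult_mono mult_left_mono e2)
        show "\<mu> k * s k / (cmod (1 - cnj (a k) * cis t))\<^sup>2 \<le> x (cis t) k"
          unfolding x_def power_divide power2_eq_square[of "s k"] using s[of k]
          by (intro divide_right_mono mult_right_mono) auto
      qed (use less_imp_le[OF s(1)[of k]] less_imp_le[OF \<mu>_pos[of k]] in \<open>simp_all add: x_def\<close>)
      finally show ?thesis by (simp add: w_def mult_ac)
    qed
    have "\<mu> k * (2 * pi * cmod (F (a k))) = cmod (integral {0..2 * pi} (\<lambda>t. of_real (\<mu> k) * (G (cis t) * cis t / (cis t - a k))))"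
      using has_integral_mult_right[OF int, of "of_real (\<mu> k)"] \<mu>_pos[of k]
      by (simp add: integral_unique norm_mult)
    also have "\<dots> \<le> integral {0..2 * pi} (\<lambda>t. exp (2 * \<Lambda>) * (cmod (F (cis t)) * w k t))"
    proof (rule integral_norm_bound_integral)
      show "(\<lambda>t. of_real (\<mu> k) * (G (cis t) * cis t / (cis t - a k))) integrable_on {0..2 * pi}"
        using has_integral_mult_right[OF int] by blast
      show "(\<lambda>t. exp (2 * \<Lambda>) * (cmod (F (cis t)) * w k t)) integrable_on {0..2 * pi}"
        by (intro integrable_continuous_real continuous_intros contF contw)
      show "cmod (of_real (\<mu> k) * (G (cis t) * cis t / (cis t - a k))) \<le> exp (2 * \<Lambda>) * (cmod (F (cis t)) * w k t)" for t
        using bd[of t] by (simp only: norm_mult[of "of_real (\<mu> k)"] norm_of_real abs_of_pos[OF \<mu>_pos])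
    qed
    also have "\<dots> = exp (2 * \<Lambda>) * integral {0..2 * pi} (\<lambda>t. cmod (F (cis t)) * w k t)"
      by simp
    finally have "\<mu> k * (2 * pi * cmod (F (a k))) / (2 * pi)
        \<le> exp (2 * \<Lambda>) * integral {0..2 * pi} (\<lambda>t. cmod (F (cis t)) * w k t) / (2 * pi)"
      by (rule divide_right_mono) simp
    then show "\<mu> k * cmod (F (a k)) \<le> exp (2 * \<Lambda>) / (2 * pi) * integral {0..2 * pi} (\<lambda>t. cmod (F (cis t)) * w k t)"
      by simp
  qed
  also have "\<dots> = exp (2 * \<Lambda>) / (2 * pi) * integral {0..2 * pi} (\<lambda>t. \<Sum>k\<in>A. cmod (F (cis t)) * w k t)"
    by (subst integral_sum[OF A])
      (auto simp: sum_distrib_left intro!: integrable_continuous_real continuous_intros contF contw)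
  also have "\<dots> \<le> exp (2 * \<Lambda>) / (2 * pi) * integral {0..2 * pi} (\<lambda>t. cmod (F (cis t)))"
  proof (intro mult_left_mono integral_le)
    show "(\<lambda>t. \<Sum>k\<in>A. cmod (F (cis t)) * w k t) integrable_on {0..2 * pi}"
      by (intro integrable_continuous_real continuous_intros contF contw)
    show "(\<lambda>t. cmod (F (cis t))) integrable_on {0..2 * pi}"
      by (intro integrable_continuous_real continuous_intros contF)
    fix t
    have "(\<Sum>k\<in>A. w k t) \<le> 1 - exp (- sum (x (cis t)) A)"
      unfolding w_def Ak_def by (rule sum_exp_partial_sums_le_1[OF A]) (simp add: x_def)
    then have "(\<Sum>k\<in>A. w k t) \<le> 1" using exp_gt_zero[of "- sum (x (cis t)) A"] by linarith
    then show "(\<Sum>k\<in>A. cmod (F (cis t)) * w k t) \<le> cmod (F (cis t))"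
      by (simp add: sum_distrib_left[symmetric] mult_left_le)
  qed auto
  finally show ?thesis .
qed

section \<open>Mean square estimates for finite sums of Szego kernels\<close>

definition cauchy_sum :: "(nat \<Rightarrow> complex) \<Rightarrow> nat set \<Rightarrow> complex \<Rightarrow> complex" where
  "cauchy_sum v A z = (\<Sum>j\<in>A. cnj (v j) / (1 - cnj (a j) * z))"

lemma continuous_cauchy_sum: "finite A \<Longrightarrow> continuous_on (cball 0 1) (cauchy_sum v A)"
  and holomorphic_cauchy_sum: "finite A \<Longrightarrow> cauchy_sum v A holomorphic_on ball 0 1"
  unfolding cauchy_sum_def[abs_def]
  by (intro continuous_intros holomorphic_intros; use one_minus_cnj_mult_nonzero[OF in_disc] in auto)+

text \<open>The reproducing property: on the circle the conjugate of the j-th kernel is the Cauchy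
  kernel at \<open>a j\<close>, so each summand of the conjugated factor evaluates the other factor
  at \<open>a j\<close>.\<close>

lemma cauchy_sum_L2:
  assumes A: "finite A"
  shows "((\<lambda>t. complex_of_real ((cmod (cauchy_sum v A (cis t)))\<^sup>2)) has_integral
    2 * of_real pi * (\<Sum>j\<in>A. v j * cauchy_sum v A (a j))) {0..2 * pi}"
proof -
  let ?R = "cauchy_sum v A"
  have "((\<lambda>t. \<Sum>j\<in>A. v j * (?R (cis t) * cis t / (cis t - a j))) has_integral
      (\<Sum>j\<in>A. v j * (2 * of_real pi * ?R (a j)))) {0..2 * pi}"
    by (intro has_integral_sum A has_integral_mult_right Cauchy_integral_unit_circle
        continuous_cauchy_sum holomorphic_cauchy_sum in_disc)
  moreover have "(\<Sum>j\<in>A. v j * (?R (cis t) * cis t / (cis t - a j))) = complex_of_real ((cmod (?R (cis t)))\<^sup>2)" for t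
  proof -
    have "v j / cnj (1 - cnj (a j) * cis t) = v j * cis t / (cis t - a j)" for j
    proof -
      have c: "cis t * cnj (cis t) = 1" by (simp add: cis_cnj cis_mult)
      have "cis t * cnj (1 - cnj (a j) * cis t) = cis t - a j"
        using c by (simp add: algebra_simps)
      then show ?thesis by (metis cis_neq_zero mult.commute nonzero_mult_divide_mult_cancel_left)
    qed
    then have "cnj (?R (cis t)) = (\<Sum>j\<in>A. v j * cis t / (cis t - a j))"
      by (simp add: cauchy_sum_def)
    then show ?thesis
      by (simp add: complex_norm_square sum_distrib_left mult_ac del: of_real_power)
  qed
  ultimately show ?thesis by (simp add: sum_distrib_left mult_ac)
qed

text \<open>The embedding is used twice. Let J be the mean of |R|^2 on the circle. The reproducing
  property, Cauchy-Schwarz and the embedding on \<open>A\<close> give J^2 <= C^2 * (sum of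
  \<open>\<mu> j\<close> over \<open>A\<close>) * exp (2 * \<Lambda>) * J. Cancelling J and using
  the embedding on \<open>B\<close> doubles the exponent.\<close>

lemma cauchy_sum_Carleson:
  assumes A: "finite A" and B: "finite B" and v: "\<And>j. j \<in> A \<Longrightarrow> cmod (v j) \<le> C * \<mu> j" and C: "0 \<le> C"
  shows "(\<Sum>k\<in>B. \<mu> k * (cmod (cauchy_sum v A (a k)))\<^sup>2) \<le> C\<^sup>2 * exp (4 * \<Lambda>) * (\<Sum>j\<in>A. \<mu> j)"
proof -
  let ?R = "cauchy_sum v A"
  define J where "J = integral {0..2 * pi} (\<lambda>t. (cmod (?R (cis t)))\<^sup>2) / (2 * pi)"
  define \<tau> where "\<tau> = (\<Sum>j\<in>A. \<mu> j)"
  have \<tau>0: "0 \<le> \<tau>" unfolding \<tau>_def by (intro sum_nonneg less_imp_le \<mu>_pos)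
  have emb: "(\<Sum>k\<in>B. \<mu> k * (cmod (?R (a k)))\<^sup>2) \<le> exp (2 * \<Lambda>) * J" if "finite B" for B
  proof -
    have "(\<Sum>k\<in>B. \<mu> k * cmod ((?R (a k))\<^sup>2)) \<le> exp (2 * \<Lambda>) / (2 * pi) * integral {0..2 * pi} (\<lambda>t. cmod ((?R (cis t))\<^sup>2))"
      by (rule Carleson_embedding)
        (intro continuous_intros holomorphic_intros continuous_cauchy_sum holomorphic_cauchy_sum A that)+
    then show ?thesis by (simp add: J_def norm_power)
  qed
  have "((\<lambda>t. Re (complex_of_real ((cmod (?R (cis t)))\<^sup>2))) has_integral
      Re (2 * of_real pi * (\<Sum>j\<in>A. v j * ?R (a j)))) {0..2 * pi}"
    by (rule has_integral_Re[OF cauchy_sum_L2[OF A]])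
  then have "integral {0..2 * pi} (\<lambda>t. (cmod (?R (cis t)))\<^sup>2) = 2 * pi * Re (\<Sum>j\<in>A. v j * ?R (a j))"
    by (simp add: integral_unique del: of_real_power)
  then have J: "J = Re (\<Sum>j\<in>A. v j * ?R (a j))"
    unfolding J_def by simp
  have "J \<le> cmod (\<Sum>j\<in>A. v j * ?R (a j))" unfolding J by (rule complex_Re_le_cmod)
  also have "\<dots> \<le> (\<Sum>j\<in>A. cmod (v j) * cmod (?R (a j)))"
    by (rule order_trans[OF norm_sum]) (simp add: norm_mult)
  also have "\<dots> \<le> (\<Sum>j\<in>A. C * (sqrt (\<mu> j) * (sqrt (\<mu> j) * cmod (?R (a j)))))"
    using v \<mu>_pos by (intro sum_mono) (simp add: mult.assoc[symmetric] mult_right_mono less_imp_le)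
  also have "\<dots> = C * (\<Sum>j\<in>A. sqrt (\<mu> j) * (sqrt (\<mu> j) * cmod (?R (a j))))"
    by (simp add: sum_distrib_left)
  finally have J1: "J \<le> C * (\<Sum>j\<in>A. sqrt (\<mu> j) * (sqrt (\<mu> j) * cmod (?R (a j))))" .
  have J0: "0 \<le> J" unfolding J_def
    by (intro divide_nonneg_nonneg integral_nonneg) (auto intro!: integrable_continuous_real continuous_intros
        continuous_on_compose2[OF continuous_cauchy_sum[OF A]])
  have "J\<^sup>2 \<le> (C * (\<Sum>j\<in>A. sqrt (\<mu> j) * (sqrt (\<mu> j) * cmod (?R (a j)))))\<^sup>2"
    using J1 J0 by (intro power_mono)
  also have "\<dots> \<le> C\<^sup>2 * ((\<Sum>j\<in>A. (sqrt (\<mu> j))\<^sup>2) * (\<Sum>j\<in>A. (sqrt (\<mu> j) * cmod (?R (a j)))\<^sup>2))"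
    unfolding power_mult_distrib[of C] by (intro mult_left_mono Cauchy_Schwarz_ineq_sum) auto
  also have "\<dots> = C\<^sup>2 * (\<tau> * (\<Sum>j\<in>A. \<mu> j * (cmod (?R (a j)))\<^sup>2))"
    using \<mu>_pos by (simp add: \<tau>_def power_mult_distrib less_imp_le)
  also have "\<dots> \<le> C\<^sup>2 * (\<tau> * (exp (2 * \<Lambda>) * J))"
    using emb[OF A] \<tau>0 by (intro mult_left_mono) auto
  finally have J2: "J * J \<le> (C\<^sup>2 * \<tau> * exp (2 * \<Lambda>)) * J" by (simp add: power2_eq_square mult_ac)
  have "J \<le> C\<^sup>2 * \<tau> * exp (2 * \<Lambda>)"
  proof (cases "J = 0")
    case True
    then show ?thesis using \<tau>0 by simp
  next
    case False
    then show ?thesis using J2 J0 by (intro mult_right_le_imp_le[OF J2]) simp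
  qed
  then have "exp (2 * \<Lambda>) * J \<le> exp (2 * \<Lambda>) * (C\<^sup>2 * \<tau> * exp (2 * \<Lambda>))" by (intro mult_left_mono) auto
  also have "\<dots> = C\<^sup>2 * (exp (2 * \<Lambda>) * exp (2 * \<Lambda>)) * \<tau>" by simp
  also have "exp (2 * \<Lambda>) * exp (2 * \<Lambda>) = exp (4 * \<Lambda>)" by (simp add: exp_add[symmetric])
  finally show ?thesis using emb[OF B] by (simp add: \<tau>_def)
qed

end

section \<open>A maximum principle for sums of Cauchy kernels\<close>

text \<open>The residues of P w / (w - z) add up to zero, because the decay of \<open>P\<close>
  makes the integrals over large circles vanish. The residue at \<open>z\<close> is
  \<open>P z\<close>; each of the others is estimated on its own small circle. The small discs may
  overlap, as long as none contains the centre of another.\<close>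

lemma Cauchy_bound_finite_poles:
  fixes b :: "nat \<Rightarrow> complex" and r p :: "nat \<Rightarrow> real"
  assumes K: "finite K" and inj: "inj_on b K"
    and hol: "P holomorphic_on - (b ` K)"
    and decay: "\<And>w. R0 \<le> cmod w \<Longrightarrow> cmod (P w) \<le> c / cmod w"
    and r: "\<And>k. k \<in> K \<Longrightarrow> 0 < r k" "\<And>k. k \<in> K \<Longrightarrow> cball (b k) (r k) \<subseteq> ball 0 1"
    and disj: "\<And>j k. j \<in> K \<Longrightarrow> k \<in> K \<Longrightarrow> j \<noteq> k \<Longrightarrow> b j \<notin> cball (b k) (r k)"
    and p: "\<And>k w. k \<in> K \<Longrightarrow> cmod (w - b k) = r k \<Longrightarrow> cmod (P w) \<le> p k"
    and z: "1 < cmod z"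
  shows "cmod (P z) \<le> (\<Sum>k\<in>K. r k * p k) / (cmod z - 1)"
proof -
  define f where "f = (\<lambda>w. P w / (w - z))"
  have b1: "cmod (b k) < 1" if "k \<in> K" for k
    using r[OF that] by (auto simp: subset_iff dest!: spec[of _ "b k"])
  have znb: "z \<notin> b ` K" using b1 z by fastforce
  define pts where "pts = insert z (b ` K)"
  have fin: "finite pts" using K by (simp add: pts_def)
  have holf: "f holomorphic_on UNIV - pts"
    unfolding f_def pts_def by (intro holomorphic_intros holomorphic_on_subset[OF hol]) auto
  define s where "s = (\<Sum>q\<in>pts. residue f q)"
  have int: "cmod s * (2 * pi) \<le> \<bar>c\<bar> / R * (1 / (R - cmod z)) * (2 * pi * R)"
    if R: "R > cmod z" "R \<ge> R0" for R
  proof -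
    have R1: "R > 1" using R z by simp
    have in_ball: "q \<in> ball 0 R" if "q \<in> pts" for q
      using that b1 R R1 by (fastforce simp: pts_def)
    have path: "path_image (circlepath 0 R) \<subseteq> UNIV - pts"
    proof
      fix x assume "x \<in> path_image (circlepath 0 R)"
      then have "cmod x = R" using R1 by simp
      then show "x \<in> UNIV - pts" using in_ball[of x] by auto
    qed
    have eq: "contour_integral (circlepath 0 R) f
        = 2 * pi * \<i> * (\<Sum>q\<in>pts. winding_number (circlepath 0 R) q * residue f q)"
      by (rule Residue_theorem[of UNIV]) (use fin holf path in auto)
    have "(\<Sum>q\<in>pts. winding_number (circlepath 0 R) q * residue f q) = s"
      unfolding s_def by (intro sum.cong refl) (use in_ball in \<open>auto simp: winding_number_circlepath\<close>)
    with eq have "contour_integral (circlepath 0 R) f = 2 * pi * \<i> * s" by simp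
    moreover have "f contour_integrable_on circlepath 0 R"
    proof (rule contour_integrable_holomorphic_simple[of f "UNIV - pts"])
      show "path_image (circlepath 0 R) \<subseteq> UNIV - pts" by (rule path)
    qed (use fin holf in \<open>auto intro: open_Diff finite_imp_closed\<close>)
    ultimately have "(f has_contour_integral (2 * pi * \<i> * s)) (circlepath 0 R)"
      using has_contour_integral_integral by metis
    then have "cmod (2 * pi * \<i> * s) \<le> (\<bar>c\<bar> / R * (1 / (R - cmod z))) * (2 * pi * R)"
    proof (rule has_contour_integral_bound_circlepath)
      fix w assume "cmod (w - 0) = R"
      then have w: "cmod w = R" by simp
      have "R - cmod z \<le> cmod (w - z)" using norm_triangle_ineq2[of w z] w by simp
      moreover have "cmod (P w) \<le> \<bar>c\<bar> / R"
        using decay[of w] w R R1 by (intro order_trans[OF decay] ) (auto intro: divide_right_mono)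
      ultimately show "cmod (f w) \<le> \<bar>c\<bar> / R * (1 / (R - cmod z))"
        unfolding f_def norm_divide divide_inverse[of "cmod (P w)"] using R R1
        by (intro mult_mono) (auto simp: divide_inverse intro!: le_imp_inverse_le)
    qed (use R R1 in auto)
    then show ?thesis by (simp add: norm_mult mult_ac)
  qed
  have "s = 0"
  proof -
    have "((\<lambda>R. \<bar>c\<bar> / R * (1 / (R - cmod z)) * (2 * pi * R)) \<longlongrightarrow> 0) at_top"
      by real_asymp
    moreover have "\<forall>\<^sub>F R in at_top. cmod s * (2 * pi) \<le> \<bar>c\<bar> / R * (1 / (R - cmod z)) * (2 * pi * R)"
      using eventually_gt_at_top[of "cmod z"] eventually_ge_at_top[of R0] by eventually_elim (rule int)
    ultimately have "cmod s * (2 * pi) \<le> 0"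
      by (intro tendsto_lowerbound) auto
    moreover have "0 < cmod s * (2 * pi)" if "s \<noteq> 0" using that by simp
    ultimately show ?thesis by fastforce
  qed
  moreover have "s = residue f z + (\<Sum>k\<in>K. residue f (b k))"
    unfolding s_def pts_def using K znb by (simp add: sum.reindex[OF inj])
  moreover have "residue f z = P z"
    unfolding f_def
    by (rule residue_simple[OF _ _ hol]) (use K znb in \<open>auto intro: finite_imp_closed\<close>)
  ultimately have Pz: "P z = - (\<Sum>k\<in>K. residue f (b k))" by (simp add: eq_neg_iff_add_eq_0)
  have res: "cmod (residue f (b k)) \<le> r k * p k / (cmod z - 1)" if k: "k \<in> K" for k
  proof -
    define S where "S = - (pts - {b k})"
    have "(f has_contour_integral 2 * pi * \<i> * residue f (b k)) (circlepath (b k) (r k))"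
    proof (rule base_residue[of S])
      show "open S" unfolding S_def using fin by (intro open_Compl finite_imp_closed) auto
      show "f holomorphic_on S - {b k}"
        by (rule holomorphic_on_subset[OF holf]) (auto simp: S_def)
      show "cball (b k) (r k) \<subseteq> S"
      proof
        fix y assume y: "y \<in> cball (b k) (r k)"
        then have "cmod y < 1" using r(2)[OF k] by auto
        then show "y \<in> S" using disj[OF _ k] y z by (auto simp: S_def pts_def)
      qed
    qed (use k r in \<open>auto simp: S_def\<close>)
    then have "cmod (2 * pi * \<i> * residue f (b k)) \<le> (p k / (cmod z - 1)) * (2 * pi * r k)"
    proof (rule has_contour_integral_bound_circlepath)
      fix w assume w: "cmod (w - b k) = r k"
      then have "w \<in> cball (b k) (r k)" by (simp add: dist_norm norm_minus_commute)
      then have "cmod w < 1" using r(2)[OF k] by auto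
      then have "cmod z - 1 \<le> cmod (w - z)" using norm_triangle_ineq2[of z w] by (simp add: norm_minus_commute)
      then show "cmod (f w) \<le> p k / (cmod z - 1)"
        unfolding f_def norm_divide using p[OF k w] z order_trans[OF norm_ge_zero p[OF k w]]
        by (intro frac_le) auto
    next
      have "cmod (b k + of_real (r k) - b k) = r k" using r(1)[OF k] by simp
      then have "0 \<le> p k" using p[OF k, of "b k + of_real (r k)"] norm_ge_zero order_trans by blast
      then show "0 \<le> p k / (cmod z - 1)" using z by simp
    qed (use r k in auto)
    then have "(2 * pi) * cmod (residue f (b k)) \<le> (2 * pi) * (r k * p k / (cmod z - 1))"
      by (simp add: norm_mult mult_ac)
    then show ?thesis by (rule mult_left_le_imp_le) simp
  qed
  have "cmod (P z) \<le> (\<Sum>k\<in>K. cmod (residue f (b k)))"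
    unfolding Pz norm_minus_cancel by (rule norm_sum)
  also have "\<dots> \<le> (\<Sum>k\<in>K. r k * p k / (cmod z - 1))" by (rule sum_mono) (rule res)
  finally show ?thesis by (simp add: sum_divide_distrib)
qed

text \<open>
  For the theorem, \<open>u j = h (a j) / B' (a j)\<close>.
\<close>

locale bounded_cauchy_data = interpolating_sequence +
  fixes u :: "nat \<Rightarrow> complex" and C M :: real
  assumes C_pos: "0 < C" and norm_u_le: "cmod (u j) \<le> C * \<mu> j"
    and bounded_at_zeros: "cmod (\<Sum>j. u j / (1 - a j * cnj (a k))) \<le> M"
begin

definition \<psi> :: "nat \<Rightarrow> complex \<Rightarrow> complex" where "\<psi> n z = (\<Sum>j<n. u j / (z - a j))"

text \<open>
  On \<open>\<bar>z\<bar> > 1\<close>, \<open>\<Psi> z\<close> is the conjugate of the function \<open>conj_fun\<close> below at the reflected point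
  \<open>1 / cnj z\<close>.
\<close>

definition \<Psi> :: "complex \<Rightarrow> complex" where "\<Psi> z = (\<Sum>j. u j / (z - a j))"

definition \<gamma> :: "nat \<Rightarrow> complex set" where "\<gamma> k = {w. cmod (w - a k) = \<delta> / 2 * \<mu> k}"

abbreviation psum :: "nat \<Rightarrow> nat \<Rightarrow> complex" where "psum n k \<equiv> \<Sum>j<n. u j / (1 - a j * cnj (a k))"

abbreviation fsum :: "nat \<Rightarrow> complex" where "fsum k \<equiv> \<Sum>j. u j / (1 - a j * cnj (a k))"

definition err :: "nat \<Rightarrow> nat \<Rightarrow> real" where
  "err n k = cmod (fsum k - psum n k)"

definition C0 :: real where "C0 = M + 12 * C / \<delta> * \<Lambda>"

lemma \<Lambda>_ge_1: "1 \<le> \<Lambda>"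
  using \<delta>_pos \<delta>_le_1 by (simp add: \<Lambda>_def)

lemma M_nonneg: "0 \<le> M"
  using bounded_at_zeros[of 0] norm_ge_zero order_trans by blast

lemma C0_pos: "0 < C0"
proof -
  have "0 < 12 * C / \<delta> * \<Lambda>" using \<Lambda>_ge_1 C_pos \<delta>_pos by (intro mult_pos_pos divide_pos_pos) auto
  then show ?thesis unfolding C0_def using M_nonneg by linarith
qed

text \<open>For \<open>j\<close> different from \<open>k\<close>, separation keeps
  \<open>a j\<close> at distance at least \<open>\<delta> * cmod (1 - cnj (a j) * a k)\<close> from
  \<open>a k\<close>, and the radius of the circle uses up at most half of it. The constant 1/4 is
  dictated by \<open>j = k\<close>, where 1 - |a k|^2 can be nearly
  \<open>2 * \<mu> k\<close>.\<close>

lemma \<gamma>_dist: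
  assumes "w \<in> \<gamma> k" shows "\<delta> / 4 * cmod (1 - cnj (a j) * a k) \<le> cmod (w - a j)"
proof (cases "j = k")
  case True
  have "cmod (1 - cnj (a k) * a k) = 1 - (cmod (a k))\<^sup>2"
    using one_minus_sq_bounds(3)[of k] by (simp only: one_minus_cnj_self norm_of_real)
  then have "\<delta> / 4 * cmod (1 - cnj (a k) * a k) \<le> \<delta> / 4 * (2 * \<mu> k)"
    using one_minus_sq_bounds(2)[of k] \<delta>_pos by (intro mult_left_mono) auto
  then show ?thesis using assms True by (simp add: \<gamma>_def)
next
  case False
  note 1 = zeros_distance[OF False]
  note zeros_kernel(2)[of k j]
  then have "\<delta> / 2 * \<mu> k \<le> \<delta> / 2 * cmod (1 - cnj (a j) * a k)"
    using \<delta>_pos by (intro mult_left_mono) auto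
  moreover have "cmod (a k - a j) \<le> cmod (w - a j) + cmod (w - a k)"
    using norm_triangle_ineq4[of "w - a j" "w - a k"] by simp
  moreover have "0 \<le> \<delta> / 4 * cmod (1 - cnj (a j) * a k)" using \<delta>_pos by simp
  ultimately show ?thesis using 1 assms by (simp add: \<gamma>_def)
qed

lemma \<gamma>_ne:
  assumes "w \<in> \<gamma> k" shows "w \<noteq> a j"
proof -
  note zeros_kernel(3)[of j k]
  then have "0 < \<delta> / 4 * cmod (1 - cnj (a j) * a k)" using \<delta>_pos by simp
  then show ?thesis using \<gamma>_dist[OF assms, of j] by auto
qed

text \<open>For \<open>a k\<close> nonzero, \<open>cnj (a k) * psum n k\<close> is the value of
  \<open>\<psi> n\<close> at the reflection 1 / cnj (a k). Passing from there to \<open>w\<close>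
  changes the j-th term by at most a multiple of \<open>\<E> j k\<close>. The 12 in
  \<open>C0\<close> is 3 from the numerator \<open>1 - cnj (a k) * w\<close> times 4 from the
  distance to the zeros.\<close>

lemma \<psi>_on_\<gamma>:
  assumes w: "w \<in> \<gamma> k" shows "cmod (\<psi> n w) \<le> C0 + err n k"
proof -
  have nz: "1 - a j * cnj (a k) \<noteq> 0" for j
    using zeros_kernel(3)[of k j] by (auto simp: mult.commute)
  have "cmod (1 - cnj (a k) * w) \<le> (1 - (cmod (a k))\<^sup>2) + cmod (a k) * cmod (w - a k)"
  proof -
    have "1 - cnj (a k) * w = of_real (1 - (cmod (a k))\<^sup>2) - cnj (a k) * (w - a k)"
      by (simp add: complex_norm_square algebra_simps del: of_real_power)
    then have "cmod (1 - cnj (a k) * w) \<le> cmod (of_real (1 - (cmod (a k))\<^sup>2)) + cmod (cnj (a k) * (w - a k))"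
      by (simp only: norm_triangle_ineq4)
    then show ?thesis
      using one_minus_sq_bounds(3)[of k] by (simp only: norm_of_real norm_mult complex_mod_cnj)
  qed
  also have "\<dots> \<le> 2 * \<mu> k + 1 * (1 * \<mu> k)"
  proof (intro add_mono mult_mono one_minus_sq_bounds(2) less_imp_le[OF in_disc])
    have "\<delta> / 2 * \<mu> k \<le> 1 * \<mu> k" using \<delta>_le_1 \<mu>_pos[of k] by (intro mult_right_mono) auto
    then show "cmod (w - a k) \<le> 1 * \<mu> k" using w by (simp add: \<gamma>_def)
  qed auto
  finally have num: "cmod (1 - cnj (a k) * w) \<le> 3 * \<mu> k" by simp
  have "\<psi> n w - cnj (a k) * psum n k = (\<Sum>j<n. u j * ((1 - cnj (a k) * w) / ((w - a j) * (1 - a j * cnj (a k)))))"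
    unfolding \<psi>_def sum_distrib_left sum_subtractf[symmetric]
    using \<gamma>_ne[OF w] nz by (intro sum.cong refl) (simp add: field_simps)
  then have "cmod (\<psi> n w - cnj (a k) * psum n k) \<le> (\<Sum>j<n. cmod (u j * ((1 - cnj (a k) * w) / ((w - a j) * (1 - a j * cnj (a k))))))"
    by (simp only: norm_sum)
  also have "\<dots> \<le> (\<Sum>j<n. 12 * C / \<delta> * \<E> j k)"
  proof (rule sum_mono)
    fix j
    let ?d = "cmod (1 - cnj (a j) * a k)"
    have d: "0 < ?d" "cmod (1 - a j * cnj (a k)) = ?d"
      using nz[of j] norm_one_minus_cnj_commute[of "a j" "a k"]
      by (simp_all add: mult.commute)
    have "cmod (u j * ((1 - cnj (a k) * w) / ((w - a j) * (1 - a j * cnj (a k)))))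
        = cmod (u j) * (cmod (1 - cnj (a k) * w) / (cmod (w - a j) * ?d))"
      by (simp add: norm_mult norm_divide d(2))
    also have "\<dots> \<le> (C * \<mu> j) * (3 * \<mu> k / ((\<delta> / 4 * ?d) * ?d))"
      using norm_u_le num \<gamma>_dist[OF w, of j] d \<delta>_pos C_pos \<mu>_pos[of j] \<mu>_pos[of k]
      by (intro mult_mono frac_le mult_right_mono) auto
    also have "\<dots> = 12 * C / \<delta> * (\<mu> j * \<mu> k / ?d\<^sup>2)"
      using d \<delta>_pos by (simp add: field_simps power2_eq_square)
    also have "\<dots> \<le> 12 * C / \<delta> * \<E> j k"
      unfolding \<E>_def using one_minus_sq_bounds(1,3)[of j] one_minus_sq_bounds(1,3)[of k] \<mu>_pos[of j] \<mu>_pos[of k] C_pos \<delta>_pos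
      by (intro mult_left_mono divide_right_mono mult_mono) auto
    finally show "cmod (u j * ((1 - cnj (a k) * w) / ((w - a j) * (1 - a j * cnj (a k))))) \<le> 12 * C / \<delta> * \<E> j k" .
  qed
  also have "\<dots> \<le> 12 * C / \<delta> * \<Lambda>"
    unfolding sum_distrib_left[symmetric] using sum_\<E>_le[of "{..<n}" k] C_pos \<delta>_pos by (intro mult_left_mono) auto
  finally have 1: "cmod (\<psi> n w - cnj (a k) * psum n k) \<le> 12 * C / \<delta> * \<Lambda>" .
  have "cmod (psum n k) \<le> M + err n k"
    using norm_triangle_ineq4[of "fsum k" "fsum k - psum n k"]
      bounded_at_zeros[of k] by (simp add: err_def)
  then have "cmod (cnj (a k) * psum n k) \<le> 1 * (M + err n k)"
    unfolding norm_mult using in_disc[of k] by (intro mult_mono) auto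
  then show ?thesis
    using 1 norm_triangle_ineq[of "\<psi> n w - cnj (a k) * psum n k" "cnj (a k) * psum n k"] by (simp add: C0_def)
qed

lemma summable_at_zero: "summable (\<lambda>j. u j / (1 - a j * cnj (a k)))"
proof (rule summable_comparison_test')
  show "summable (\<lambda>j. C / \<mu> k * \<mu> j)" by (intro summable_mult summable_\<mu>)
  fix j :: nat
  have "\<mu> k \<le> cmod (1 - a j * cnj (a k))" using zeros_kernel(1)[of k j] by (simp add: mult.commute)
  then have "cmod (u j / (1 - a j * cnj (a k))) \<le> C * \<mu> j / \<mu> k"
    unfolding norm_divide using norm_u_le[of j] \<mu>_pos[of k] order_trans[OF norm_ge_zero norm_u_le[of j]]
    by (intro frac_le) auto
  then show "norm (u j / (1 - a j * cnj (a k))) \<le> C / \<mu> k * \<mu> j" by simp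
qed

text \<open>The bound depends on \<open>n\<close> but not on \<open>k\<close>; it keeps a product of
  finitely many partial sums bounded on all circles \<open>\<gamma> k\<close>
  simultaneously.\<close>

lemma err_bounded: "\<exists>K\<ge>0. \<forall>k. err n k \<le> K"
proof (intro exI conjI allI)
  let ?K = "M + (\<Sum>j<n. C)"
  show "0 \<le> ?K" using M_nonneg C_pos by (intro add_nonneg_nonneg sum_nonneg) auto
  fix k
  have "cmod (psum n k) \<le> (\<Sum>j<n. C)"
  proof (rule order_trans[OF norm_sum], rule sum_mono)
    fix j
    have "\<mu> j \<le> cmod (1 - a j * cnj (a k))" using zeros_kernel(2)[of j k] by (simp add: mult.commute)
    then have "cmod (u j / (1 - a j * cnj (a k))) \<le> C * \<mu> j / \<mu> j"
      unfolding norm_divide using norm_u_le[of j] \<mu>_pos[of j] order_trans[OF norm_ge_zero norm_u_le[of j]]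
      by (intro frac_le) auto
    then show "cmod (u j / (1 - a j * cnj (a k))) \<le> C" using \<mu>_pos[of j] by simp
  qed
  then show "err n k \<le> ?K"
    unfolding err_def using bounded_at_zeros[of k] by (intro order_trans[OF norm_triangle_ineq4] add_mono)
qed

lemma err_nonneg: "0 \<le> err n k" by (simp add: err_def)

text \<open>The difference of two partial sums at \<open>a k\<close> is the conjugate of a sum of
  Szego kernels over \<open>{n..<N}\<close>, so the Carleson estimate bounds it by a tail of the sum
  of the \<open>\<mu> j\<close>; then \<open>N\<close> tends to infinity.\<close>

lemma err_L2:
  assumes "finite K"
  shows "(\<Sum>k\<in>K. \<mu> k * (err n k)\<^sup>2) \<le> C\<^sup>2 * exp (4 * \<Lambda>) * (\<Sum>j. \<mu> (j + n))"
proof (rule LIMSEQ_le_const2)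
  show "(\<lambda>N. \<Sum>k\<in>K. \<mu> k * (cmod ((psum N k - psum n k)))\<^sup>2) \<longlonglongrightarrow> (\<Sum>k\<in>K. \<mu> k * (err n k)\<^sup>2)"
    unfolding err_def by (intro tendsto_intros summable_LIMSEQ summable_at_zero)
  show "\<exists>N0. \<forall>N\<ge>N0. (\<Sum>k\<in>K. \<mu> k * (cmod ((psum N k - psum n k)))\<^sup>2) \<le> C\<^sup>2 * exp (4 * \<Lambda>) * (\<Sum>j. \<mu> (j + n))"
  proof (intro exI allI impI)
    fix N assume N: "N \<ge> n"
    have "cmod ((psum N k - psum n k)) = cmod (cauchy_sum u {n..<N} (a k))" for k
    proof -
      have "psum N k - psum n k = (\<Sum>j\<in>{n..<N}. u j / (1 - a j * cnj (a k)))"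
        using N by (simp add: sum_diff_nat_ivl lessThan_atLeast0)
      also have "\<dots> = cnj (cauchy_sum u {n..<N} (a k))" by (simp add: cauchy_sum_def)
      finally show ?thesis by simp
    qed
    then have "(\<Sum>k\<in>K. \<mu> k * (cmod ((psum N k - psum n k)))\<^sup>2) \<le> C\<^sup>2 * exp (4 * \<Lambda>) * (\<Sum>j\<in>{n..<N}. \<mu> j)"
      using cauchy_sum_Carleson[OF _ assms, of "{n..<N}" u C] norm_u_le C_pos by simp
    also have "(\<Sum>j\<in>{n..<N}. \<mu> j) = (\<Sum>j<N - n. \<mu> (j + n))"
      using N sum.shift_bounds_nat_ivl[of \<mu> 0 n "N - n"] by (simp add: atLeast0LessThan)
    also have "C\<^sup>2 * exp (4 * \<Lambda>) * \<dots> \<le> C\<^sup>2 * exp (4 * \<Lambda>) * (\<Sum>j. \<mu> (j + n))"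
      by (intro mult_left_mono sum_le_suminf summable_ignore_initial_segment summable_\<mu>)
        (auto simp: less_imp_le[OF \<mu>_pos])
    finally show "(\<Sum>k\<in>K. \<mu> k * (cmod ((psum N k - psum n k)))\<^sup>2) \<le> C\<^sup>2 * exp (4 * \<Lambda>) * (\<Sum>j. \<mu> (j + n))" .
  qed
qed

lemma summable_\<mu>_mult_bounded:
  assumes "\<And>k. 0 \<le> p k" "\<And>k. p k \<le> K" shows "summable (\<lambda>k. \<mu> k * p k)"
proof (rule summable_comparison_test')
  show "summable (\<lambda>k. \<mu> k * K)" by (intro summable_mult2 summable_\<mu>)
  show "norm (\<mu> k * p k) \<le> \<mu> k * K" for k
    using assms[of k] \<mu>_pos[of k] by (simp add: abs_mult)
qed

lemma summable_err: "summable (\<lambda>k. \<mu> k * err n k)"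
  using err_bounded[of n] summable_\<mu>_mult_bounded err_nonneg by metis

text \<open>Cauchy-Schwarz for the weights \<open>\<mu> k\<close>, whose total mass is
  finite.\<close>

lemma err_L1_tendsto_0: "(\<lambda>n. \<Sum>k. \<mu> k * err n k) \<longlonglongrightarrow> 0"
proof -
  let ?b = "\<lambda>n. sqrt (suminf \<mu>) * sqrt (C\<^sup>2 * exp (4 * \<Lambda>) * (\<Sum>j. \<mu> (j + n)))"
  have "?b \<longlonglongrightarrow> sqrt (suminf \<mu>) * sqrt (C\<^sup>2 * exp (4 * \<Lambda>) * 0)"
    by (intro tendsto_intros tail_\<mu>_tendsto_0)
  then have lim: "?b \<longlonglongrightarrow> 0" by simp
  have lo: "\<forall>\<^sub>F n in sequentially. 0 \<le> (\<Sum>k. \<mu> k * err n k)"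
    using \<mu>_pos by (intro always_eventually allI suminf_nonneg summable_err mult_nonneg_nonneg err_nonneg less_imp_le)
  have hi: "\<forall>\<^sub>F n in sequentially. (\<Sum>k. \<mu> k * err n k) \<le> ?b n"
  proof (intro always_eventually allI)
    fix n
    show "(\<Sum>k. \<mu> k * err n k) \<le> ?b n"
    proof (rule suminf_le_const[OF summable_err])
      fix N
      let ?s = "\<lambda>k. sqrt (\<mu> k)"
      have "(\<Sum>k<N. \<mu> k * err n k) = (\<Sum>k<N. ?s k * (?s k * err n k))"
        using \<mu>_pos by (simp add: mult.assoc[symmetric] less_imp_le)
      then have "(\<Sum>k<N. \<mu> k * err n k)\<^sup>2 \<le> (\<Sum>k<N. (?s k)\<^sup>2) * (\<Sum>k<N. (?s k * err n k)\<^sup>2)"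
        using Cauchy_Schwarz_ineq_sum[of ?s "\<lambda>k. ?s k * err n k" "{..<N}"] by simp
      also have "\<dots> = (\<Sum>k<N. \<mu> k) * (\<Sum>k<N. \<mu> k * (err n k)\<^sup>2)"
        using \<mu>_pos by (simp add: power_mult_distrib less_imp_le)
      also have "\<dots> \<le> suminf \<mu> * (C\<^sup>2 * exp (4 * \<Lambda>) * (\<Sum>j. \<mu> (j + n)))"
        using \<mu>_pos by (intro mult_mono sum_le_suminf summable_\<mu> err_L2 suminf_nonneg sum_nonneg mult_nonneg_nonneg)
          (auto simp: less_imp_le)
      finally show "(\<Sum>k<N. \<mu> k * err n k) \<le> ?b n"
        unfolding real_sqrt_mult[symmetric] by (rule real_le_rsqrt)
    qed
  qed
  show ?thesis by (rule tendsto_sandwich[OF lo hi tendsto_const lim])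
qed

lemma summable_\<Psi>:
  assumes "1 < cmod z" shows "summable (\<lambda>j. u j / (z - a j))"
proof (rule summable_comparison_test')
  show "summable (\<lambda>j. C / (cmod z - 1) * \<mu> j)" by (intro summable_mult summable_\<mu>)
  fix j :: nat
  have "cmod z - 1 \<le> cmod (z - a j)" using norm_triangle_ineq2[of z "a j"] in_disc[of j] by simp
  then have "cmod (u j / (z - a j)) \<le> C * \<mu> j / (cmod z - 1)"
    unfolding norm_divide using norm_u_le[of j] assms order_trans[OF norm_ge_zero norm_u_le[of j]]
    by (intro frac_le) auto
  then show "norm (u j / (z - a j)) \<le> C / (cmod z - 1) * \<mu> j" by simp
qed

lemma \<psi>_tendsto: "1 < cmod z \<Longrightarrow> (\<lambda>n. \<psi> n z) \<longlonglongrightarrow> \<Psi> z"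
  unfolding \<psi>_def \<Psi>_def by (intro summable_LIMSEQ summable_\<Psi>)

lemma \<psi>_decay:
  assumes "2 \<le> cmod w" shows "cmod (\<psi> n w) \<le> (\<Sum>j<n. 2 * cmod (u j)) / cmod w"
proof -
  have "cmod (u j / (w - a j)) \<le> 2 * cmod (u j) / cmod w" for j
  proof -
    have "cmod w / 2 \<le> cmod (w - a j)"
      using norm_triangle_ineq2[of w "a j"] in_disc[of j] assms by simp
    then have "cmod (u j / (w - a j)) \<le> cmod (u j) / (cmod w / 2)"
      unfolding norm_divide using assms by (intro frac_le) auto
    then show ?thesis by (simp add: mult.commute)
  qed
  then have "cmod (\<psi> n w) \<le> (\<Sum>j<n. 2 * cmod (u j) / cmod w)"
    unfolding \<psi>_def by (intro order_trans[OF norm_sum] sum_mono)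
  then show ?thesis by (simp add: sum_divide_distrib)
qed

text \<open>
  Multiplying \<open>P\<close> by a long partial sum \<open>\<psi> n\<close> costs a factor \<open>C0\<close> on the circles \<open>\<gamma> k\<close>, up to an
  error that is small in the mean; this turns Cauchy's formula into a maximum principle for \<open>\<Psi>\<close>.
\<close>

lemma \<Psi>_power_bound:
  assumes hol: "P holomorphic_on - (a ` {..<n0})"
    and decay: "\<And>w. R0 \<le> cmod w \<Longrightarrow> cmod (P w) \<le> c / cmod w"
    and p: "\<And>k w. w \<in> \<gamma> k \<Longrightarrow> cmod (P w) \<le> p k" "\<And>k. p k \<le> K" "\<And>k. 0 \<le> p k"
    and z: "1 < cmod z"
  shows "cmod (\<Psi> z) ^ m * cmod (P z) \<le> C0 ^ m * (\<Sum>k. \<mu> k * p k) / (cmod z - 1)"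
  using hol decay p
proof (induction m arbitrary: P n0 R0 c p K)
  case (0 P n0 R0 c p K)
  note p0 = 0(5)
  have summ: "summable (\<lambda>k. \<mu> k * p k)" by (rule summable_\<mu>_mult_bounded[OF p0 0(4)])
  have "\<delta> / 2 * \<mu> k < \<mu> k" for k using \<mu>_pos[of k] \<delta>_le_1 by (simp add: mult_less_cancel_right1)
  then have sub: "cball (a k) (\<delta> / 2 * \<mu> k) \<subseteq> ball 0 1" for k
  proof -
    have "cmod w < 1" if "cmod (a k - w) \<le> \<delta> / 2 * \<mu> k" for w
      using that \<open>\<And>k. \<delta> / 2 * \<mu> k < \<mu> k\<close>[of k] norm_triangle_ineq2[of w "a k"]
      by (simp add: \<mu>_def norm_minus_commute)
    then show ?thesis by (auto simp: dist_norm)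
  qed
  have sep: "a j \<notin> cball (a k) (\<delta> / 2 * \<mu> k)" if "j \<noteq> k" for j k
  proof -
    note zeros_distance[OF that]
    moreover note zeros_kernel(2)[of k j]
    then have "\<delta> * \<mu> k \<le> \<delta> * cmod (1 - cnj (a j) * a k)" using \<delta>_pos by (intro mult_left_mono) auto
    moreover have "0 < \<delta> * \<mu> k" using \<delta>_pos \<mu>_pos by simp
    ultimately show ?thesis by (simp add: dist_norm)
  qed
  have "cmod (P z) \<le> (\<Sum>k<n0. \<delta> / 2 * \<mu> k * p k) / (cmod z - 1)"
  proof (rule Cauchy_bound_finite_poles[OF _ _ 0(1) 0(2) _ _ _ _ z])
    show "inj_on a {..<n0}" by (auto simp: inj_on_def a_inj)
    show "cmod (P w) \<le> p k" if "cmod (w - a k) = \<delta> / 2 * \<mu> k" for k w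
      using 0(3)[of w k] that by (simp add: \<gamma>_def)
  qed (use \<delta>_pos \<mu>_pos sub sep in auto)
  also have "\<dots> \<le> (\<Sum>k. \<mu> k * p k) / (cmod z - 1)"
  proof (rule divide_right_mono)
    have "(\<Sum>k<n0. \<delta> / 2 * \<mu> k * p k) \<le> (\<Sum>k<n0. 1 * \<mu> k * p k)"
      using \<delta>_le_1 \<mu>_pos p0 by (intro sum_mono mult_right_mono) (auto simp: less_imp_le)
    also have "\<dots> \<le> (\<Sum>k. \<mu> k * p k)"
      using \<mu>_pos p0 summ by (simp add: sum_le_suminf less_imp_le)
    finally show "(\<Sum>k<n0. \<delta> / 2 * \<mu> k * p k) \<le> (\<Sum>k. \<mu> k * p k)" .
  qed (use z in simp)
  finally show ?case by simp
next
  case (Suc m P n0 R0 c p K)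
  note p0 = Suc.prems(5)
  have K0: "0 \<le> K" using p0[of 0] Suc.prems(4)[of 0] by simp
  have summ: "summable (\<lambda>k. \<mu> k * p k)" by (rule summable_\<mu>_mult_bounded[OF p0 Suc.prems(4)])
  \<comment> \<open>The induction hypothesis is applied to \<open>P * \<psi> n\<close>. The
    condition \<open>n0 <= n\<close> puts the poles of \<open>P\<close> among the first
    \<open>n\<close> zeros as well.\<close>
  have step: "cmod (\<Psi> z) ^ m * cmod (P z * \<psi> n z)
      \<le> C0 ^ m * (C0 * (\<Sum>k. \<mu> k * p k) + K * (\<Sum>k. \<mu> k * err n k)) / (cmod z - 1)" if n: "n0 \<le> n" for n
  proof -
    obtain E where E: "0 \<le> E" "\<And>k. err n k \<le> E" using err_bounded by blast
    let ?p = "\<lambda>k. C0 * p k + K * err n k"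
    have "cmod (\<Psi> z) ^ m * cmod (P z * \<psi> n z) \<le> C0 ^ m * (\<Sum>k. \<mu> k * ?p k) / (cmod z - 1)"
    proof (rule Suc.IH[of "\<lambda>w. P w * \<psi> n w" n "max R0 2" "\<bar>c\<bar> * (\<Sum>j<n. 2 * cmod (u j))" ?p "C0 * K + K * E"])
      show "(\<lambda>w. P w * \<psi> n w) holomorphic_on - (a ` {..<n})"
        unfolding \<psi>_def using n by (intro holomorphic_intros holomorphic_on_subset[OF Suc.prems(1)]) auto
      fix w assume w: "max R0 2 \<le> cmod w"
      have "cmod (P w) \<le> \<bar>c\<bar> / cmod w"
        using w by (intro order_trans[OF Suc.prems(2)] divide_right_mono) auto
      then have "cmod (P w * \<psi> n w) \<le> \<bar>c\<bar> / cmod w * ((\<Sum>j<n. 2 * cmod (u j)) / cmod w)"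
        unfolding norm_mult using w \<psi>_decay[of w n] by (intro mult_mono) auto
      also have "\<dots> = \<bar>c\<bar> * (\<Sum>j<n. 2 * cmod (u j)) / cmod w * (1 / cmod w)" by simp
      also have "\<dots> \<le> \<bar>c\<bar> * (\<Sum>j<n. 2 * cmod (u j)) / cmod w * 1"
        using w by (intro mult_left_mono divide_nonneg_nonneg mult_nonneg_nonneg sum_nonneg) (auto simp: divide_le_eq)
      finally show "cmod (P w * \<psi> n w) \<le> \<bar>c\<bar> * (\<Sum>j<n. 2 * cmod (u j)) / cmod w" by simp
    next
      fix k w assume w: "w \<in> \<gamma> k"
      have "cmod (P w * \<psi> n w) \<le> p k * (C0 + err n k)"
        unfolding norm_mult using Suc.prems(3)[OF w] \<psi>_on_\<gamma>[OF w] p0 by (intro mult_mono) auto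
      \<comment> \<open>The coefficient of \<open>err n k\<close> is replaced by the uniform bound
        \<open>K\<close>, so that the error enters only through the weighted sum of the
        \<open>err n k\<close>, while \<open>p k\<close> itself must stay in the other term to keep
        the factor at exactly \<open>C0\<close>.\<close>
      also have "\<dots> \<le> C0 * p k + K * err n k"
        using Suc.prems(4)[of k] err_nonneg[of n k] by (simp add: algebra_simps mult_right_mono)
      finally show "cmod (P w * \<psi> n w) \<le> ?p k" .
    next
      show "0 \<le> ?p k" for k using p0[of k] C0_pos K0 err_nonneg[of n k] by simp
      fix k show "?p k \<le> C0 * K + K * E"
        using Suc.prems(4)[of k] E C0_pos K0 by (intro add_mono mult_left_mono) auto
    qed
    also have "(\<Sum>k. \<mu> k * ?p k) = (\<Sum>k. C0 * (\<mu> k * p k) + K * (\<mu> k * err n k))"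
      by (simp add: algebra_simps)
    also have "\<dots> = C0 * (\<Sum>k. \<mu> k * p k) + K * (\<Sum>k. \<mu> k * err n k)"
      using summ summable_err[of n] by (subst suminf_add[symmetric]) (auto intro: summable_mult simp: suminf_mult)
    finally show ?thesis .
  qed
  \<comment> \<open>Letting \<open>n\<close> tend to infinity with \<open>P\<close> fixed turns
    \<open>\<psi> n z\<close> into \<open>\<Psi> z\<close> and removes the error term.\<close>
  have "(\<lambda>n. cmod (\<Psi> z) ^ m * cmod (P z * \<psi> n z)) \<longlonglongrightarrow> cmod (\<Psi> z) ^ m * cmod (P z * \<Psi> z)"
    by (intro tendsto_intros \<psi>_tendsto z)
  moreover have "(\<lambda>n. C0 ^ m * (C0 * (\<Sum>k. \<mu> k * p k) + K * (\<Sum>k. \<mu> k * err n k)) / (cmod z - 1))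
      \<longlonglongrightarrow> C0 ^ m * (C0 * (\<Sum>k. \<mu> k * p k) + K * 0) / (cmod z - 1)"
    using z by (intro tendsto_intros err_L1_tendsto_0) auto
  ultimately have "cmod (\<Psi> z) ^ m * cmod (P z * \<Psi> z) \<le> C0 ^ m * (C0 * (\<Sum>k. \<mu> k * p k) + K * 0) / (cmod z - 1)"
    by (rule LIMSEQ_le) (use step in blast)
  then show ?case by (simp add: norm_mult mult_ac)
qed

text \<open>If \<open>\<Psi> z\<close> exceeded \<open>C0\<close> in modulus, its powers would
  outgrow a bound in which \<open>m\<close> appears only as the exponent of \<open>C0\<close>. The
  starting function \<open>1 / (w - a 0)\<close> decays at infinity, as Cauchy's formula requires,
  is bounded on all circles and does not vanish at \<open>z\<close>.\<close>

lemma norm_\<Psi>_le: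
  assumes z: "1 < cmod z" shows "cmod (\<Psi> z) \<le> C0"
proof (rule ccontr)
  assume "\<not> ?thesis"
  then have gt: "1 < cmod (\<Psi> z) / C0" using C0_pos by simp
  define P where "P = (\<lambda>w. 1 / (w - a 0))"
  define K where "K = 4 / (\<delta> * \<mu> 0)"
  define D where "D = (\<Sum>k. \<mu> k * K) / (cmod z - 1)"
  have Pz: "0 < cmod (P z)" using z in_disc[of 0] by (auto simp: P_def norm_divide)
  have "cmod (\<Psi> z) ^ m * cmod (P z) \<le> C0 ^ m * (\<Sum>k. \<mu> k * K) / (cmod z - 1)" for m
  proof (rule \<Psi>_power_bound[of _ 1 2 2])
    show "P holomorphic_on - a ` {..<1}" unfolding P_def by (intro holomorphic_intros) auto
    show "cmod (P w) \<le> 2 / cmod w" if "2 \<le> cmod w" for w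
    proof -
      have "cmod w / 2 \<le> cmod (w - a 0)" using norm_triangle_ineq2[of w "a 0"] in_disc[of 0] that by simp
      then have "1 / cmod (w - a 0) \<le> 1 / (cmod w / 2)" using that by (intro frac_le) auto
      then show ?thesis by (simp add: P_def norm_divide)
    qed
    show "cmod (P w) \<le> K" if "w \<in> \<gamma> k" for k w
    proof -
      note zeros_kernel(1)[of 0 k]
      then have "\<delta> / 4 * \<mu> 0 \<le> \<delta> / 4 * cmod (1 - cnj (a 0) * a k)" using \<delta>_pos by (intro mult_left_mono) auto
      also have "\<dots> \<le> cmod (w - a 0)" by (rule \<gamma>_dist[OF that])
      finally have "1 / cmod (w - a 0) \<le> 1 / (\<delta> / 4 * \<mu> 0)" using \<delta>_pos \<mu>_pos[of 0] by (intro frac_le) auto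
      then show ?thesis by (simp add: P_def K_def norm_divide)
    qed
  qed (use z \<delta>_pos \<mu>_pos[of 0] in \<open>auto simp: K_def\<close>)
  then have "cmod (\<Psi> z) ^ m * cmod (P z) \<le> C0 ^ m * D" for m by (simp add: D_def)
  then have "(cmod (\<Psi> z) / C0) ^ m \<le> D / cmod (P z)" for m
    unfolding power_divide using Pz zero_less_power[OF C0_pos, of m]
    by (simp only: pos_divide_le_eq pos_le_divide_eq times_divide_eq_left mult.commute[of D])
  moreover obtain m where "D / cmod (P z) < (cmod (\<Psi> z) / C0) ^ m"
    using real_arch_pow[OF gt] by blast
  ultimately show False by (meson not_less)
qed

end

section \<open>The candidate pair\<close>

text \<open>For independent events that fail to occur with probabilities \<open>y i\<close>, the
  left side is the probability that exactly one occurs and the right side the probability that at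
  least one does.\<close>

lemma sum_single_event_le:
  fixes y :: "'i \<Rightarrow> real"
  assumes "finite A" "\<And>i. i \<in> A \<Longrightarrow> 0 \<le> y i \<and> y i \<le> 1"
  shows "(\<Sum>j\<in>A. (1 - y j) * (\<Prod>i\<in>A - {j}. y i)) \<le> 1 - (\<Prod>i\<in>A. y i)"
  using assms
proof (induction A rule: finite_induct)
  case (insert x A)
  let ?p = "\<Prod>i\<in>A. y i"
  have p: "0 \<le> ?p" "?p \<le> 1" using insert by (auto intro!: prod_nonneg prod_le_1)
  have yx: "0 \<le> y x" "y x \<le> 1" using insert.prems by auto
  have "(\<Sum>j\<in>A. (1 - y j) * (\<Prod>i\<in>insert x A - {j}. y i)) = (\<Sum>j\<in>A. y x * ((1 - y j) * (\<Prod>i\<in>A - {j}. y i)))"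
  proof (rule sum.cong[OF refl])
    fix j assume j: "j \<in> A"
    then have "insert x A - {j} = insert x (A - {j})" using insert by auto
    then show "(1 - y j) * (\<Prod>i\<in>insert x A - {j}. y i) = y x * ((1 - y j) * (\<Prod>i\<in>A - {j}. y i))"
      using insert by simp
  qed
  also have "\<dots> = y x * (\<Sum>j\<in>A. (1 - y j) * (\<Prod>i\<in>A - {j}. y i))" by (simp add: sum_distrib_left)
  also have "\<dots> \<le> y x * (1 - ?p)" using insert yx by (intro mult_left_mono) auto
  finally have "(\<Sum>j\<in>insert x A. (1 - y j) * (\<Prod>i\<in>insert x A - {j}. y i)) \<le> (1 - y x) * ?p + y x * (1 - ?p)"
    using insert by simp
  also have "\<dots> = 1 - y x * ?p - (1 - y x) * (1 - ?p)" by (simp add: algebra_simps)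
  also have "\<dots> \<le> 1 - y x * ?p" using p yx by simp
  finally show ?case using insert by simp
qed simp

context blaschke_sequence
begin

lemma holomorphic_suminf_disc:
  assumes hol: "\<And>j. t j holomorphic_on ball 0 1"
    and bnd: "\<And>j z. cmod z < 1 \<Longrightarrow> cmod (t j z) \<le> D * \<mu> j / (1 - cmod z)"
  shows "(\<lambda>z. \<Sum>j. t j z) holomorphic_on ball 0 1"
    and "\<And>z. cmod z < 1 \<Longrightarrow> summable (\<lambda>j. t j z)"
proof -
  have summ: "summable (\<lambda>j. D / (1 - cmod z) * \<mu> j)" for z :: complex
    by (intro summable_mult summable_\<mu>)
  show t: "summable (\<lambda>j. t j z)" if "cmod z < 1" for z
    by (rule summable_comparison_test'[OF summ[of z]]) (use bnd[OF that] in simp)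
  show "(\<lambda>z. \<Sum>j. t j z) holomorphic_on ball 0 1"
  proof (rule holomorphic_disc_limit)
    show "(\<lambda>z. \<Sum>j<n. t j z) holomorphic_on ball 0 1" for n by (intro holomorphic_intros hol)
    show "(\<lambda>n. D * (\<Sum>j. \<mu> (j + n))) \<longlonglongrightarrow> 0"
      using tendsto_mult_left[OF tail_\<mu>_tendsto_0, of D] by simp
    fix n z assume z: "cmod z < 1"
    have "cmod ((\<Sum>j<n. t j z) - (\<Sum>j. t j z)) = cmod (\<Sum>j. t (j + n) z)"
      using suminf_minus_initial_segment[OF t[OF z], of n] by (simp add: norm_minus_commute)
    also have "\<dots> \<le> (\<Sum>j. D / (1 - cmod z) * \<mu> (j + n))"
      by (rule norm_suminf_le) (use bnd[OF z] summable_ignore_initial_segment[OF summ[of z], of n] in auto)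
    also have "\<dots> = D * (\<Sum>j. \<mu> (j + n)) / (1 - cmod z)"
      by (subst suminf_mult) (auto intro: summable_ignore_initial_segment summable_\<mu>)
    finally show "cmod ((\<Sum>j<n. t j z) - (\<Sum>j. t j z)) \<le> D * (\<Sum>j. \<mu> (j + n)) / (1 - cmod z)" .
  qed
qed

lemma blaschke_on_at_zero: "k \<in> S \<Longrightarrow> blaschke_on a S (a k) = 0"
  using blaschke_on_Un[of "{k}" "S - {k}" "a k"] blaschke_on_finite[of "{k}" "a k"] in_disc[of k]
    \<beta>_eq_0_iff[of "a k" k] by (simp add: insert_absorb)

text \<open>
  If the events \<open>E j\<close> are independent with probabilities \<open>1 - \<bar>\<beta> j z\<bar>\<close>, then the sum of the numbers
  \<open>omission j z\<close> is at most twice the probability that exactly one of them occurs.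
\<close>

definition omission :: "nat \<Rightarrow> complex \<Rightarrow> real" where
  "omission j z = (1 - (cmod (\<beta> j z))\<^sup>2) * cmod (blaschke_on a (- {j}) z)"

text \<open>Enlarging the index set of a Blaschke product decreases its modulus. Hence passing to
  finite products raises the left side, returning to the full product raises the right side, and the
  finite inequality is enough. The factor 2 comes from 1 - y^2 <= 2 * (1 - y).\<close>

lemma sum_omission_le:
  assumes z: "cmod z < 1" and A: "finite A"
  shows "(\<Sum>j\<in>A. omission j z) \<le> 2 * (1 - cmod (blaschke a z))"
proof -
  let ?y = "\<lambda>j. cmod (\<beta> j z)"
  have y: "0 \<le> ?y j \<and> ?y j \<le> 1" for j using norm_\<beta>_le_1[of z j] z by simp
  have "(\<Sum>j\<in>A. omission j z) \<le> (\<Sum>j\<in>A. 2 * ((1 - ?y j) * (\<Prod>i\<in>A - {j}. ?y i)))"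
  proof (rule sum_mono)
    fix j assume "j \<in> A"
    have "1 - (?y j)\<^sup>2 = (1 - ?y j) * (1 + ?y j)" by (simp add: power2_eq_square algebra_simps)
    also have "\<dots> \<le> (1 - ?y j) * 2" using y[of j] by (intro mult_left_mono) auto
    finally have 1: "1 - (?y j)\<^sup>2 \<le> 2 * (1 - ?y j)" by simp
    have "cmod (blaschke_on a (- {j}) z) \<le> cmod (blaschke_on a (A - {j}) z)"
      by (rule norm_blaschke_on_antimono[OF _ z]) auto
    also have "\<dots> = (\<Prod>i\<in>A - {j}. ?y i)" using A z by (simp add: blaschke_on_finite prod_norm)
    finally have "omission j z \<le> (2 * (1 - ?y j)) * (\<Prod>i\<in>A - {j}. ?y i)"
      unfolding omission_def using 1 y[of j] by (intro mult_mono) auto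
    then show "omission j z \<le> 2 * ((1 - ?y j) * (\<Prod>i\<in>A - {j}. ?y i))" by (simp only: mult.assoc)
  qed
  also have "\<dots> = 2 * (\<Sum>j\<in>A. (1 - ?y j) * (\<Prod>i\<in>A - {j}. ?y i))" by (simp add: sum_distrib_left)
  also have "\<dots> \<le> 2 * (1 - (\<Prod>i\<in>A. ?y i))"
    by (intro mult_left_mono sum_single_event_le A y) auto
  also have "(\<Prod>i\<in>A. ?y i) = cmod (blaschke_on a A z)" using A z by (simp add: blaschke_on_finite prod_norm)
  also have "2 * (1 - cmod (blaschke_on a A z)) \<le> 2 * (1 - cmod (blaschke a z))"
    using norm_blaschke_on_antimono[OF subset_UNIV z, of A] by (simp add: blaschke_eq_blaschke_on)
  finally show ?thesis .
qed

end

context bounded_cauchy_data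
begin

text \<open>\<open>blaschke a z * u j / (z - a j)\<close> with the factor \<open>z - a j\<close>
  cancelled, so that it makes sense at \<open>a j\<close> too.\<close>

definition model_term :: "nat \<Rightarrow> complex \<Rightarrow> complex" where
  "model_term j z = - u j * blaschke_const (a j) * blaschke_on a (- {j}) z / (1 - cnj (a j) * z)"

definition model_fun :: "complex \<Rightarrow> complex" where "model_fun z = (\<Sum>j. model_term j z)"

definition conj_fun :: "complex \<Rightarrow> complex" where
  "conj_fun z = (\<Sum>j. z * (cnj (u j) / (1 - cnj (a j) * z)))"

lemma norm_kernel_term_le:
  assumes "cmod z < 1" shows "cmod (u j) / cmod (1 - cnj (a j) * z) \<le> C * \<mu> j / (1 - cmod z)"
  using norm_u_le[of j] order_trans[OF norm_ge_zero norm_u_le[of j]] assms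
    one_minus_norm_mult_ge(2)[of "a j" z] in_disc[of j]
  by (intro frac_le) auto

lemma norm_model_term_le:
  assumes "cmod z < 1" shows "cmod (model_term j z) \<le> C * \<mu> j / (1 - cmod z)"
proof -
  have "cmod (model_term j z) = cmod (blaschke_on a (- {j}) z) * (cmod (u j) / cmod (1 - cnj (a j) * z))"
    by (simp add: model_term_def norm_mult norm_divide)
  also have "\<dots> \<le> 1 * (C * \<mu> j / (1 - cmod z))"
    using norm_blaschke_on_le_1[OF assms] norm_kernel_term_le[OF assms, of j] by (intro mult_mono) auto
  finally show ?thesis by simp
qed

lemma norm_conj_term_le:
  assumes "cmod z < 1" shows "cmod (z * (cnj (u j) / (1 - cnj (a j) * z))) \<le> C * \<mu> j / (1 - cmod z)"
proof -
  have "cmod (z * (cnj (u j) / (1 - cnj (a j) * z))) = cmod z * (cmod (u j) / cmod (1 - cnj (a j) * z))"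
    by (simp add: norm_mult norm_divide)
  also have "\<dots> \<le> 1 * (C * \<mu> j / (1 - cmod z))"
    using assms norm_kernel_term_le[OF assms, of j] by (intro mult_mono) auto
  finally show ?thesis by simp
qed

lemma holomorphic_terms:
  "model_term j holomorphic_on ball 0 1" "(\<lambda>z. z * (cnj (u j) / (1 - cnj (a j) * z))) holomorphic_on ball 0 1"
  unfolding model_term_def[abs_def]
  by (intro holomorphic_intros holomorphic_blaschke_on; use one_minus_cnj_mult_nonzero[OF in_disc] in auto)+

lemma holomorphic_model_fun: "model_fun holomorphic_on ball 0 1"
  and summable_model_term: "cmod z < 1 \<Longrightarrow> summable (\<lambda>j. model_term j z)"
  unfolding model_fun_def[abs_def]
  using holomorphic_suminf_disc[OF holomorphic_terms(1) norm_model_term_le] by auto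

lemma holomorphic_conj_fun: "conj_fun holomorphic_on ball 0 1"
  and summable_conj_term: "cmod z < 1 \<Longrightarrow> summable (\<lambda>j. z * (cnj (u j) / (1 - cnj (a j) * z)))"
  unfolding conj_fun_def[abs_def]
  using holomorphic_suminf_disc[OF holomorphic_terms(2) norm_conj_term_le] by auto

lemma norm_conj_fun_le:
  assumes "cmod z < 1" shows "cmod (conj_fun z) \<le> C0"
proof (cases "z = 0")
  case True
  then show ?thesis using C0_pos by (simp add: conj_fun_def)
next
  case False
  define w where "w = 1 / cnj z"
  have w: "1 < cmod w" using assms False by (simp add: w_def norm_divide)
  have "cnj (z * (cnj (u j) / (1 - cnj (a j) * z))) = u j / (w - a j)" for j
    using False by (simp add: w_def field_simps)
  then have "cnj (conj_fun z) = \<Psi> w"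
    unfolding conj_fun_def \<Psi>_def using sums_unique[OF sums_cnj[THEN iffD2, OF summable_sums[OF summable_conj_term[OF assms]]]] by simp
  then have "cmod (cnj (conj_fun z)) \<le> C0" using norm_\<Psi>_le[OF w] by (simp only:)
  then show ?thesis by simp
qed

lemma model_fun_at_zero: "model_fun (a k) = u k * deriv (blaschke a) (a k)"
proof -
  have "model_term j (a k) = 0" if "j \<noteq> k" for j
    using blaschke_on_at_zero[of k "- {j}"] that by (simp add: model_term_def)
  then have "model_fun (a k) = model_term k (a k)"
    unfolding model_fun_def by (subst suminf_finite[of "{k}"]) auto
  also have "\<dots> = u k * deriv (blaschke a) (a k)"
    unfolding model_term_def DERIV_imp_deriv[OF DERIV_blaschke] one_minus_cnj_self by simp
  finally show ?thesis .
qed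

text \<open>On the circle \<open>z - a j\<close> is \<open>z\<close> times the conjugate of
  \<open>1 - cnj (a j) * z\<close>, and the two series would agree term by term. Inside, the
  difference of the j-th terms carries the factor (1 - |z|^2) / |1 - cnj (a j) * z|^2; with the
  bound on \<open>u j\<close> it is at most \<open>C * omission j z\<close>.\<close>

lemma model_fun_minus_conj:
  assumes z: "cmod z < 1"
  shows "cmod (model_fun z - blaschke a z * cnj (conj_fun z)) \<le> 2 * C * (1 - cmod (blaschke a z))"
proof -
  define t where "t = (\<lambda>j. model_term j z - blaschke a z * cnj (z * (cnj (u j) / (1 - cnj (a j) * z))))"
  have sumc: "(\<lambda>j. cnj (z * (cnj (u j) / (1 - cnj (a j) * z)))) sums cnj (conj_fun z)"
    unfolding conj_fun_def by (rule sums_cnj[THEN iffD2, OF summable_sums[OF summable_conj_term[OF z]]])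
  have sums: "t sums (model_fun z - blaschke a z * cnj (conj_fun z))"
    unfolding t_def model_fun_def
    by (intro sums_diff sums_mult sumc summable_sums summable_model_term z)
  have nt: "cmod (t j) \<le> C * omission j z" for j
  proof -
    have nz: "1 - cnj (a j) * z \<noteq> 0" using one_minus_cnj_mult_nonzero[OF in_disc less_imp_le[OF z]] .
    have nz': "1 - a j * cnj z \<noteq> 0" 
    proof -
      have "1 - a j * cnj z = cnj (1 - cnj (a j) * z)" by simp
      then show ?thesis using nz by (simp only: complex_cnj_zero_iff) simp
    qed
    have sq: "(1 - cnj (a j) * z) * (1 - a j * cnj z) = of_real ((cmod (1 - cnj (a j) * z))\<^sup>2)"
      by (simp add: complex_norm_square del: of_real_power)
    have z2: "z * cnj z = of_real ((cmod z)\<^sup>2)" by (simp add: complex_norm_square del: of_real_power)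
    have gen: "- b / D + b * x / D * (y / E) = - b * (E - x * y) / (D * E)" if "D \<noteq> 0" "E \<noteq> 0" for b D E x y :: complex
      using that by (simp add: field_simps)
    let ?b = "u j * blaschke_const (a j) * blaschke_on a (- {j}) z"
    have "t j = - ?b / (1 - cnj (a j) * z) + ?b * (z - a j) / (1 - cnj (a j) * z) * (cnj z / (1 - a j * cnj z))"
      unfolding t_def model_term_def blaschke_eq_factor_mult[OF z, of j] \<beta>_def blaschke_factor_eq by simp
    also have "\<dots> = - ?b * ((1 - a j * cnj z) - (z - a j) * cnj z) / ((1 - cnj (a j) * z) * (1 - a j * cnj z))"
      by (rule gen[OF nz nz'])
    also have "(1 - a j * cnj z) - (z - a j) * cnj z = 1 - z * cnj z" by (simp add: algebra_simps)
    finally have "t j = - ?b * of_real (1 - (cmod z)\<^sup>2) / of_real ((cmod (1 - cnj (a j) * z))\<^sup>2)"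
      unfolding sq z2 by simp
    then have "cmod (t j) = cmod (u j) * cmod (blaschke_on a (- {j}) z) * \<bar>1 - (cmod z)\<^sup>2\<bar> / \<bar>(cmod (1 - cnj (a j) * z))\<^sup>2\<bar>"
      by (simp only: norm_mult norm_divide norm_minus_cancel norm_of_real norm_blaschke_const mult_1_right)
    also have "\<bar>1 - (cmod z)\<^sup>2\<bar> = 1 - (cmod z)\<^sup>2" using z by (simp add: power_le_one)
    also have "cmod (u j) * cmod (blaschke_on a (- {j}) z) * (1 - (cmod z)\<^sup>2) / \<bar>(cmod (1 - cnj (a j) * z))\<^sup>2\<bar>
        \<le> (C * (1 - (cmod (a j))\<^sup>2)) * cmod (blaschke_on a (- {j}) z) * (1 - (cmod z)\<^sup>2) / \<bar>(cmod (1 - cnj (a j) * z))\<^sup>2\<bar>"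
    proof (intro divide_right_mono mult_right_mono)
      show "cmod (u j) \<le> C * (1 - (cmod (a j))\<^sup>2)"
        by (rule order_trans[OF norm_u_le]) (use one_minus_sq_bounds(1)[of j] C_pos in auto)
    qed (use z in \<open>auto simp: power_le_one\<close>)
    also have "\<dots> = C * omission j z"
      by (simp add: omission_def \<beta>_def one_minus_blaschke_factor_sq[OF in_disc less_imp_le[OF z]])
    finally show ?thesis .
  qed
  have part: "(\<Sum>j<n. C * omission j z) \<le> 2 * C * (1 - cmod (blaschke a z))" for n
    using mult_left_mono[OF sum_omission_le[OF z, of "{..<n}"], of C] C_pos
    by (simp add: sum_distrib_left mult_ac)
  show ?thesis
  proof (rule LIMSEQ_le_const2[OF tendsto_norm[OF sums[unfolded sums_def]]], intro exI allI impI)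
    fix n :: nat
    have "cmod (sum t {..<n}) \<le> (\<Sum>j<n. C * omission j z)"
      by (rule order_trans[OF norm_sum]) (intro sum_mono nt)
    also note part
    finally show "cmod (sum t {..<n}) \<le> 2 * C * (1 - cmod (blaschke a z))" .
  qed
qed

lemma norm_model_fun_le:
  assumes z: "cmod z < 1" shows "cmod (model_fun z) \<le> 2 * C + C0"
proof -
  have "cmod (model_fun z) \<le> cmod (model_fun z - blaschke a z * cnj (conj_fun z)) + cmod (blaschke a z * cnj (conj_fun z))"
    using norm_triangle_ineq[of "model_fun z - blaschke a z * cnj (conj_fun z)" "blaschke a z * cnj (conj_fun z)"] by simp
  also have "\<dots> \<le> 2 * C * (1 - cmod (blaschke a z)) + 1 * C0"
    unfolding norm_mult complex_mod_cnj
    using model_fun_minus_conj[OF z] norm_conj_fun_le[OF z] norm_blaschke_on_le_1[OF z, of UNIV]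
    by (intro add_mono mult_mono) (auto simp: blaschke_eq_blaschke_on)
  also have "2 * C * (1 - cmod (blaschke a z)) \<le> 2 * C * 1" using C_pos by (intro mult_left_mono) auto
  finally show ?thesis by simp
qed

end

section \<open>Division and radial limits\<close>

text \<open>Schwarz's lemma: the bound \<open>K\<close> survives the division. The maximum principle
  is used on circles of radius \<open>r < 1\<close>, where the Blaschke factor is at least
  \<open>sqrt (m r)\<close> in modulus, and this tends to 1 with \<open>r\<close>.\<close>

lemma divide_blaschke_factor:
  assumes hol: "d holomorphic_on ball 0 1" and bnd: "\<And>z. cmod z < 1 \<Longrightarrow> cmod (d z) \<le> K"
    and b: "cmod b < 1" and zero: "d b = 0"
  obtains q where "q holomorphic_on ball 0 1" "\<And>z. cmod z < 1 \<Longrightarrow> cmod (q z) \<le> K"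
    "\<And>z. cmod z < 1 \<Longrightarrow> d z = blaschke_factor b z * q z"
proof -
  define e where "e = (\<lambda>z. if z = b then deriv d b else (d z - d b) / (z - b))"
  have hole: "e holomorphic_on ball 0 1"
    unfolding e_def by (rule pole_lemma[OF hol]) (use b in auto)
  have e: "d z = (z - b) * e z" for z by (simp add: e_def zero)
  define q where "q = (\<lambda>z. - e z * (1 - cnj b * z) / blaschke_const b)"
  have c0: "blaschke_const b \<noteq> 0" by (metis norm_blaschke_const norm_zero zero_neq_one)
  have holq: "q holomorphic_on ball 0 1"
    unfolding q_def using c0 by (intro holomorphic_intros hole) auto
  have dq: "d z = blaschke_factor b z * q z" if "cmod z < 1" for z
    using one_minus_cnj_mult_nonzero[OF b, of z] c0 that by (simp add: e q_def blaschke_factor_eq)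
  have K0: "0 \<le> K" using bnd[of 0] norm_ge_zero[of "d 0"] by (simp del: norm_ge_zero)
  define m where "m = (\<lambda>r::real. 1 - (1 - r\<^sup>2) / (1 - cmod b)\<^sup>2)"
  have m_lim: "(m \<longlongrightarrow> 1 - (1 - 1\<^sup>2) / (1 - cmod b)\<^sup>2) (at_left 1)"
    unfolding m_def by (intro tendsto_intros) (use b in auto)
  have "cmod (q z) \<le> K" if z: "cmod z < 1" for z
  proof -
    have lim: "((\<lambda>r. K / sqrt (m r)) \<longlongrightarrow> K / sqrt 1) (at_left 1)"
      using m_lim by (intro tendsto_intros) auto
    have "\<forall>\<^sub>F r in at_left 1. 0 < m r" using m_lim by (intro order_tendstoD) auto
    moreover have "\<forall>\<^sub>F r in at_left (1::real). r \<in> {cmod z<..<1}" using z by (rule eventually_at_left_real)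
    ultimately have "\<forall>\<^sub>F r in at_left 1. cmod (q z) \<le> K / sqrt (m r)"
    proof eventually_elim
      case (elim r)
      have r0: "0 < r" using elim norm_ge_zero[of z] by (simp del: norm_ge_zero)
      show ?case
      proof (rule maximum_modulus_frontier[of q "cball 0 r"])
        show "q holomorphic_on interior (cball 0 r)"
          by (rule holomorphic_on_subset[OF holq]) (use elim in auto)
        show "continuous_on (closure (cball 0 r)) q"
          by (rule continuous_on_subset[OF holomorphic_on_imp_continuous_on[OF holq]]) (use elim in auto)
        show "z \<in> cball 0 r" using elim by simp
        fix w :: complex assume "w \<in> frontier (cball 0 r)"
        then have w: "cmod w = r" using r0 by (simp add: frontier_cball)
        then have w1: "cmod w < 1" using elim by simp
        have "1 - cmod b \<le> cmod (1 - cnj b * w)" using one_minus_norm_mult_ge(1)[of b w] b w1 by simp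
        then have "(1 - cmod b)\<^sup>2 \<le> (cmod (1 - cnj b * w))\<^sup>2" using b by (intro power_mono) auto
        then have "(1 - (cmod b)\<^sup>2) * (1 - r\<^sup>2) / (cmod (1 - cnj b * w))\<^sup>2 \<le> 1 * (1 - r\<^sup>2) / (1 - cmod b)\<^sup>2"
          using b elim r0 by (intro frac_le mult_right_mono) (auto simp: power_le_one)
        then have "m r \<le> (cmod (blaschke_factor b w))\<^sup>2"
          using one_minus_blaschke_factor_sq[OF b less_imp_le[OF w1]] by (simp add: m_def w)
        then have s: "sqrt (m r) \<le> cmod (blaschke_factor b w)"
          by (simp add: real_le_lsqrt)
        have "cmod (q w) * sqrt (m r) \<le> cmod (q w) * cmod (blaschke_factor b w)"
          using s by (intro mult_left_mono) auto
        also have "\<dots> = cmod (d w)" using dq[OF w1] by (simp add: norm_mult)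
        also have "\<dots> \<le> K" by (rule bnd[OF w1])
        finally show "cmod (q w) \<le> K / sqrt (m r)" using elim by (simp add: pos_le_divide_eq)
      qed auto
    qed
    from tendsto_lowerbound[OF lim this] show ?thesis by simp
  qed
  from holq this dq show thesis by (rule that)
qed

context blaschke_sequence
begin

lemma divide_partial_blaschke:
  assumes inj: "inj a" and hol: "d holomorphic_on ball 0 1" and bnd: "\<And>z. cmod z < 1 \<Longrightarrow> cmod (d z) \<le> K"
    and zero: "\<And>j. j < n \<Longrightarrow> d (a j) = 0"
  shows "\<exists>q. q holomorphic_on ball 0 1 \<and> (\<forall>z. cmod z < 1 \<longrightarrow> cmod (q z) \<le> K) \<and>
    (\<forall>z. cmod z < 1 \<longrightarrow> d z = (\<Prod>j<n. \<beta> j z) * q z)"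
  using zero
proof (induction n)
  case 0
  then show ?case using hol bnd by (intro exI[of _ d]) auto
next
  case (Suc n)
  then obtain q where q: "q holomorphic_on ball 0 1" "\<And>z. cmod z < 1 \<Longrightarrow> cmod (q z) \<le> K"
    "\<And>z. cmod z < 1 \<Longrightarrow> d z = (\<Prod>j<n. \<beta> j z) * q z" by auto
  have "(\<Prod>j<n. \<beta> j (a n)) \<noteq> 0"
    using \<beta>_eq_0_iff[of "a n"] in_disc[of n] inj by (auto simp: inj_eq)
  then have "q (a n) = 0" using q(3)[OF in_disc[of n]] Suc.prems[of n] by simp
  from divide_blaschke_factor[OF q(1) q(2) in_disc[of n] this]
  obtain q' where "q' holomorphic_on ball 0 1" "\<And>z. cmod z < 1 \<Longrightarrow> cmod (q' z) \<le> K"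
    "\<And>z. cmod z < 1 \<Longrightarrow> q z = \<beta> n z * q' z" unfolding \<beta>_def by metis
  then show ?case using q(3) by (intro exI[of _ q']) (auto simp: mult_ac)
qed

text \<open>The quotients by the partial products obey one common bound, so Montel's theorem gives a
  limit along a subsequence, and this limit is the quotient by the whole product.\<close>

lemma divide_blaschke:
  assumes inj: "inj a" and hol: "d holomorphic_on ball 0 1" and bnd: "\<And>z. cmod z < 1 \<Longrightarrow> cmod (d z) \<le> K"
    and zero: "\<And>j. d (a j) = 0"
  obtains q where "q holomorphic_on ball 0 1" "\<And>z. cmod z < 1 \<Longrightarrow> cmod (q z) \<le> K"
    "\<And>z. cmod z < 1 \<Longrightarrow> d z = blaschke a z * q z"
proof -
  have "\<forall>n. \<exists>q. q holomorphic_on ball 0 1 \<and> (\<forall>z. cmod z < 1 \<longrightarrow> cmod (q z) \<le> K) \<and>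
    (\<forall>z. cmod z < 1 \<longrightarrow> d z = (\<Prod>j<n. \<beta> j z) * q z)"
    using divide_partial_blaschke[OF inj hol bnd zero] by blast
  then obtain Q where Q: "\<And>n. Q n holomorphic_on ball 0 1" "\<And>n z. cmod z < 1 \<Longrightarrow> cmod (Q n z) \<le> K"
    "\<And>n z. cmod z < 1 \<Longrightarrow> d z = (\<Prod>j<n. \<beta> j z) * Q n z" by metis
  obtain q r where q: "q holomorphic_on ball 0 1" "strict_mono r"
      "\<And>z. z \<in> ball 0 1 \<Longrightarrow> (\<lambda>n. Q (r n) z) \<longlonglongrightarrow> q z"
  proof (rule Montel[of "ball 0 1" "range Q" Q])
    show "\<exists>B. \<forall>h\<in>range Q. \<forall>z\<in>K'. cmod (h z) \<le> B" if "K' \<subseteq> ball 0 1" for K'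
      using that Q(2) by (intro exI[of _ K]) (auto simp: subset_iff)
  qed (use Q(1) in auto)
  show thesis
  proof (rule that[OF q(1)])
    fix z :: complex assume z: "cmod z < 1"
    then have lim: "(\<lambda>n. Q (r n) z) \<longlonglongrightarrow> q z" using q(3) by simp
    show "cmod (q z) \<le> K"
      by (rule LIMSEQ_le_const2[OF tendsto_norm[OF lim]]) (use Q(2)[OF z] in auto)
    have "(\<lambda>n. \<Prod>j<n. \<beta> j z) \<longlonglongrightarrow> blaschke a z"
      using blaschke_on_tendsto[OF z, of UNIV] by (simp add: blaschke_eq_blaschke_on)
    then have "(\<lambda>n. \<Prod>j<r n. \<beta> j z) \<longlonglongrightarrow> blaschke a z"
      by (rule LIMSEQ_subseq_LIMSEQ[OF _ q(2), unfolded comp_def])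
    then have "(\<lambda>n. (\<Prod>j<r n. \<beta> j z) * Q (r n) z) \<longlonglongrightarrow> blaschke a z * q z"
      using lim by (rule tendsto_mult)
    then show "d z = blaschke a z * q z"
      using Q(3)[OF z, symmetric] by (simp add: LIMSEQ_const_iff)
  qed
qed

end

section \<open>Boundary values along a sequence of radii, and Cauchy's formula for them\<close>

text \<open>Without normalisation and on the closed interval, to match the gauge integrals over
  \<open>{0..2 * pi}\<close> that come from contour integration.\<close>

definition arc_measure :: "real measure" where "arc_measure = restrict_space lborel {0..2 * pi}"

definition rad :: "nat \<Rightarrow> real" where "rad n = 1 - inverse (real (n + 2))"

abbreviation rpt :: "nat \<Rightarrow> real \<Rightarrow> complex" where "rpt n t \<equiv> of_real (rad n) * cis t"

text \<open>A limit along a fixed sequence of radii is measurable in \<open>t\<close> and open to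
  dominated convergence. For bounded holomorphic functions Fatou's theorem identifies it almost
  everywhere with \<open>boundary_fun\<close>.\<close>

definition radial_lim :: "(complex \<Rightarrow> complex) \<Rightarrow> real \<Rightarrow> complex" where
  "radial_lim F t = lim (\<lambda>n. F (rpt n t))"

lemma rad_bounds: "0 < rad n" "rad n < 1"
  by (simp_all add: rad_def field_simps)

lemma rad_tendsto: "rad \<longlonglongrightarrow> 1"
proof -
  have "(\<lambda>n. 1 - inverse (real (n + 2))) \<longlonglongrightarrow> 1" by real_asymp
  then show ?thesis by (simp add: rad_def[abs_def])
qed

lemma filterlim_rad: "filterlim rad (at_left 1) sequentially"
  unfolding filterlim_at using rad_tendsto rad_bounds by (auto simp: less_imp_neq)

lemma norm_rpt: "cmod (rpt n t) < 1"
  using rad_bounds[of n] by (simp add: norm_mult)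

interpretation arc: finite_measure arc_measure
  unfolding arc_measure_def by (rule finite_measureI) (simp add: emeasure_restrict_space)

lemma arc_measurable: "f \<in> borel_measurable borel \<Longrightarrow> f \<in> borel_measurable arc_measure"
  unfolding arc_measure_def by (intro measurable_restrict_space1) simp

lemma integrable_arc:
  assumes "f \<in> borel_measurable borel" "AE t in lborel. norm (f t) \<le> B"
  shows "integrable arc_measure (f :: real \<Rightarrow> 'a::{banach, second_countable_topology})"
proof (rule arc.integrable_const_bound)
  show "AE t in arc_measure. norm (f t) \<le> B"
    unfolding arc_measure_def using assms(2) by (subst AE_restrict_space_iff) auto
  show "f \<in> borel_measurable arc_measure"
    by (rule arc_measurable[OF assms(1)])
qed

lemma integral_arc_has_integral:
  fixes f :: "real \<Rightarrow> complex"
  assumes "continuous_on {0..2 * pi} f" "(f has_integral I) {0..2 * pi}"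
  shows "(\<integral>t. f t \<partial>arc_measure) = I"
proof -
  have "(\<integral>t. f t \<partial>arc_measure) = (LINT t:{0..2 * pi}|lborel. f t)"
    unfolding arc_measure_def set_lebesgue_integral_def by (rule integral_restrict_space) auto
  also have "\<dots> = integral {0..2 * pi} f"
    by (rule set_borel_integral_eq_integral(2)) (rule borel_integrable_atLeastAtMost'[OF assms(1)])
  finally show ?thesis using assms(2) by (simp add: integral_unique)
qed

locale bounded_holomorphic =
  fixes F :: "complex \<Rightarrow> complex" and K :: real
  assumes hol: "F holomorphic_on ball 0 1" and bnd: "cmod z < 1 \<Longrightarrow> cmod (F z) \<le> K"
begin

lemma radial_tendsto: "AE t in lborel. ((\<lambda>r. F (of_real r * cis t)) \<longlongrightarrow> radial_lim F t) (at_left 1)"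
proof -
  have "bounded (F ` ball 0 1)" by (intro boundedI[of _ K]) (use bnd in auto)
  from Fatou_radial_limit[OF hol this] show ?thesis
  proof eventually_elim
    case (elim t)
    then obtain l where l: "((\<lambda>r. F (of_real r * cis t)) \<longlongrightarrow> l) (at_left (1::real))" by auto
    have "(\<lambda>n. F (rpt n t)) \<longlonglongrightarrow> l"
      by (rule filterlim_compose[OF l filterlim_rad])
    then have "radial_lim F t = l" unfolding radial_lim_def by (rule limI)
    then show ?case using l by simp
  qed
qed

lemma radial_seq_tendsto: "AE t in lborel. (\<lambda>n. F (rpt n t)) \<longlonglongrightarrow> radial_lim F t"
  using radial_tendsto by eventually_elim (rule filterlim_compose[OF _ filterlim_rad])

lemma boundary_fun_eq: "AE t in lborel. boundary_fun F (cis t) = radial_lim F t"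
  using radial_tendsto
proof eventually_elim
  case (elim t)
  then show ?case unfolding boundary_fun_def by (intro tendsto_Lim) auto
qed

lemma radius_measurable [measurable]: "(\<lambda>t. F (rpt n t)) \<in> borel_measurable borel"
proof (rule borel_measurable_continuous_onI, rule continuous_on_compose2[OF holomorphic_on_imp_continuous_on[OF hol]])
  show "continuous_on UNIV (\<lambda>t. complex_of_real (rad n) * cis t)" by (intro continuous_intros)
  show "range (\<lambda>t. complex_of_real (rad n) * cis t) \<subseteq> ball 0 1" using norm_rpt by auto
qed

lemma radial_lim_measurable [measurable]: "radial_lim F \<in> borel_measurable borel"
  unfolding radial_lim_def[abs_def] by (rule borel_measurable_lim_metric) (rule radius_measurable)

lemma radial_lim_bound: "AE t in lborel. cmod (radial_lim F t) \<le> K"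
  using radial_seq_tendsto
proof eventually_elim
  case (elim t)
  show ?case by (rule LIMSEQ_le_const2[OF tendsto_norm[OF elim]]) (use bnd[OF norm_rpt] in auto)
qed

lemma K_nonneg: "0 \<le> K" using bnd[of 0] norm_ge_zero[of "F 0"] by (simp del: norm_ge_zero)

lemma integral_radial_tendsto:
  fixes G :: "real \<Rightarrow> complex"
  assumes G: "continuous_on UNIV G" and Gb: "\<And>t. cmod (G t) \<le> L"
  shows "(\<lambda>n. \<integral>t. F (rpt n t) * G t \<partial>arc_measure) \<longlonglongrightarrow> (\<integral>t. radial_lim F t * G t \<partial>arc_measure)"
proof (rule integral_dominated_convergence[of _ _ _ "\<lambda>_. K * L"])
  have Gm [measurable]: "G \<in> borel_measurable borel" using G by (rule borel_measurable_continuous_onI)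
  show "(\<lambda>t. radial_lim F t * G t) \<in> borel_measurable arc_measure"
    by (rule arc_measurable) simp
  show "(\<lambda>t. F (rpt n t) * G t) \<in> borel_measurable arc_measure" for n
    by (rule arc_measurable) simp
  show "AE t in arc_measure. (\<lambda>n. F (rpt n t) * G t) \<longlonglongrightarrow> radial_lim F t * G t"
    unfolding arc_measure_def using radial_seq_tendsto
    by (subst AE_restrict_space_iff) (auto elim!: eventually_mono intro!: tendsto_mult_right)
  show "AE t in arc_measure. norm (F (rpt n t) * G t) \<le> K * L" for n
    unfolding norm_mult using bnd[OF norm_rpt] Gb K_nonneg by (intro always_eventually allI mult_mono) auto
qed (auto intro: arc.integrable_const)

text \<open>Cauchy's formula for the dilations \<open>F (rad n * z)\<close>, which are continuous on
  the closed disc, followed by dominated convergence.\<close>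

lemma Cauchy_integral_radial_lim:
  assumes w: "cmod w < 1"
  shows "(\<integral>t. radial_lim F t * (cis t / (cis t - w)) \<partial>arc_measure) = 2 * of_real pi * F w"
proof -
  have nz: "cis t - w \<noteq> 0" for t using w by auto
  have ge: "1 - cmod w \<le> cmod (cis t - w)" for t using norm_triangle_ineq2[of "cis t" w] by simp
  have cont: "continuous_on UNIV (\<lambda>t. cis t / (cis t - w))" using nz by (intro continuous_intros) auto
  have A: "(\<lambda>n. \<integral>t. F (rpt n t) * (cis t / (cis t - w)) \<partial>arc_measure)
      \<longlonglongrightarrow> (\<integral>t. radial_lim F t * (cis t / (cis t - w)) \<partial>arc_measure)"
  proof (rule integral_radial_tendsto[OF cont])
    show "cmod (cis t / (cis t - w)) \<le> 1 / (1 - cmod w)" for t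
      unfolding norm_divide using ge[of t] w by (intro frac_le) auto
  qed
  have B: "(\<integral>t. F (rpt n t) * (cis t / (cis t - w)) \<partial>arc_measure)
      = 2 * of_real pi * F (of_real (rad n) * w)" for n
  proof (rule integral_arc_has_integral)
    have sub: "of_real (rad n) * z \<in> ball 0 1" if "cmod z \<le> 1" for z :: complex
    proof -
      have "cmod (of_real (rad n) * z) = rad n * cmod z" using rad_bounds[of n] by (simp add: norm_mult)
      also have "\<dots> \<le> rad n * 1" using rad_bounds[of n] that by (intro mult_left_mono) auto
      also have "\<dots> < 1" using rad_bounds[of n] by simp
      finally show ?thesis by simp
    qed
    have c: "continuous_on (cball 0 1) (\<lambda>z. F (of_real (rad n) * z))"
      by (rule continuous_on_compose2[OF holomorphic_on_imp_continuous_on[OF hol]])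
        (use sub in \<open>auto intro!: continuous_intros\<close>)
    have h: "(\<lambda>z. F (of_real (rad n) * z)) holomorphic_on ball 0 1"
      by (rule holomorphic_on_compose_gen[OF _ hol, unfolded o_def])
        (use sub in \<open>auto intro!: holomorphic_intros\<close>)
    show "((\<lambda>t. F (rpt n t) * (cis t / (cis t - w))) has_integral 2 * of_real pi * F (of_real (rad n) * w)) {0..2 * pi}"
      using Cauchy_integral_unit_circle[OF c h w] by simp
    have "continuous_on {0..2 * pi} (\<lambda>t. F (rpt n t))"
      by (rule continuous_on_compose2[OF c]) (auto intro!: continuous_intros)
    then show "continuous_on {0..2 * pi} (\<lambda>t. F (rpt n t) * (cis t / (cis t - w)))"
      by (intro continuous_intros continuous_on_subset[OF cont]) auto
  qed
  have C: "(\<lambda>n. 2 * of_real pi * F (of_real (rad n) * w)) \<longlonglongrightarrow> 2 * of_real pi * F w"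
  proof (intro tendsto_intros)
    have "isCont F w"
      using holomorphic_on_imp_continuous_on[OF hol] w by (simp add: continuous_on_eq_continuous_at)
    moreover have "(\<lambda>n. of_real (rad n) * w) \<longlonglongrightarrow> of_real 1 * w"
      by (intro tendsto_intros rad_tendsto)
    then have "(\<lambda>n. of_real (rad n) * w) \<longlonglongrightarrow> w" by simp
    ultimately show "(\<lambda>n. F (of_real (rad n) * w)) \<longlonglongrightarrow> F w"
      by (rule isCont_tendsto_compose)
  qed
  show ?thesis by (rule LIMSEQ_unique[OF A[unfolded B] C])
qed

end

section \<open>Boundary values of Blaschke products\<close>

lemma cis_measurable_circle:
  "cis \<in> measurable (uniform_measure lborel {0..<2 * pi}) (restrict_space borel (sphere 0 1))"
proof (rule measurable_restrict_space2)
  have "cis \<in> borel_measurable borel" by (intro borel_measurable_continuous_onI continuous_intros)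
  then show "cis \<in> borel_measurable (uniform_measure lborel {0..<2 * pi})" by simp
qed auto

lemma AE_circle_measureD:
  assumes "AE \<zeta> in circle_measure. P \<zeta>" shows "AE t in arc_measure. P (cis t)"
proof -
  have "AE t in uniform_measure lborel {0..<2 * pi}. P (cis t)"
    using AE_distrD[OF cis_measurable_circle] assms unfolding circle_measure_def by blast
  then have "AE t in lborel. t \<in> {0..<2 * pi} \<longrightarrow> P (cis t)"
    by (subst (asm) AE_uniform_measure) auto
  moreover have "AE t in lborel. t \<noteq> 2 * pi"
    by (rule AE_lborel_singleton)
  ultimately have "AE t in lborel. t \<in> {0..2 * pi} \<longrightarrow> P (cis t)"
    by eventually_elim auto
  then show ?thesis unfolding arc_measure_def by (subst AE_restrict_space_iff) auto
qed

lemma Arg2pi_cis: "0 \<le> t \<Longrightarrow> t < 2 * pi \<Longrightarrow> Arg2pi (cis t) = t"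
  by (rule Arg2pi_unique[of 1]) (auto simp: cis_conv_exp)

text \<open>The set where \<open>P\<close> fails need not be measurable, so an exceptional null set
  on the circle is obtained as the preimage of a null set of angles under a measurable inverse of
  \<open>cis\<close>. The function \<open>T\<close> is such an inverse: \<open>Arg2pi\<close> is
  continuous on the circle off 1, and at 1 the indicator yields the correct value 0.\<close>

lemma AE_circle_measureI:
  assumes "AE t in arc_measure. P (cis t)" shows "AE \<zeta> in circle_measure. P \<zeta>"
proof -
  have "AE t in lborel. t \<in> {0..2 * pi} \<longrightarrow> P (cis t)"
    using assms unfolding arc_measure_def by (subst (asm) AE_restrict_space_iff) auto
  then obtain N where N: "N \<in> null_sets lborel" "{t. \<not> (t \<in> {0..2 * pi} \<longrightarrow> P (cis t))} \<subseteq> N"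
    unfolding eventually_ae_filter by auto
  define S where "S = sphere 0 1 - {1 :: complex}"
  define T where "T = (\<lambda>\<zeta>. indicator S \<zeta> *\<^sub>R Arg2pi \<zeta>)"
  have nn: "\<zeta> \<notin> \<real>\<^sub>\<ge>\<^sub>0" if "\<zeta> \<in> S" for \<zeta>
  proof
    assume "\<zeta> \<in> \<real>\<^sub>\<ge>\<^sub>0"
    then obtain r where "\<zeta> = of_real r" "0 \<le> r" by (auto simp: nonneg_Reals_def)
    then show False using that by (auto simp: S_def)
  qed
  have Tm: "T \<in> borel_measurable borel"
    unfolding T_def
  proof (rule borel_measurable_continuous_on_indicator)
    show "continuous_on S Arg2pi"
      using nn continuous_at_Arg2pi by (intro continuous_at_imp_continuous_on) auto
  qed (auto simp: S_def)
  have Arg1: "Arg2pi 1 = 0" using Arg2pi_cis[of 0] by simp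
  have T_eq: "T \<zeta> = Arg2pi \<zeta>" if "cmod \<zeta> = 1" for \<zeta>
    using that Arg1 by (cases "\<zeta> = 1") (auto simp: T_def S_def)
  have Nm [measurable]: "N \<in> sets borel" using N by auto
  have "AE \<zeta> in circle_measure. T \<zeta> \<notin> N"
    unfolding circle_measure_def
  proof (subst AE_distr_iff[OF cis_measurable_circle])
    show "{\<zeta> \<in> space (restrict_space borel (sphere 0 1)). T \<zeta> \<notin> N} \<in> sets (restrict_space borel (sphere 0 1))"
    proof -
      have [measurable]: "T \<in> borel_measurable (restrict_space borel (sphere 0 1))"
        by (rule measurable_restrict_space1[OF Tm])
      show ?thesis by measurable
    qed
    show "AE t in uniform_measure lborel {0..<2 * pi}. T (cis t) \<notin> N"
    proof (rule AE_uniform_measureI)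
      show "AE t in lborel. t \<in> {0..<2 * pi} \<longrightarrow> T (cis t) \<notin> N"
        using AE_not_in[OF N(1)] by eventually_elim (auto simp: T_eq Arg2pi_cis)
    qed simp
  qed
  moreover have "AE \<zeta> in circle_measure. cmod \<zeta> = 1"
    by (rule AE_I2) (auto simp: circle_measure_def space_restrict_space)
  ultimately show ?thesis
  proof eventually_elim
    case (elim \<zeta>)
    have \<zeta>: "\<zeta> = cis (Arg2pi \<zeta>)" using Arg2pi_eq[of \<zeta>] elim by (simp add: cis_conv_exp)
    have "0 \<le> Arg2pi \<zeta>" "Arg2pi \<zeta> < 2 * pi" using Arg2pi[of \<zeta>] by auto
    then have "P (cis (Arg2pi \<zeta>))" using N(2) elim by (auto simp: T_eq)
    then show ?case using \<zeta> by simp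
  qed
qed

lemma AE_arcI: "AE t in lborel. P t \<Longrightarrow> AE t in arc_measure. P t"
  unfolding arc_measure_def by (subst AE_restrict_space_iff) (auto elim: eventually_mono)

section \<open>Tails of the product on the circle, and unimodularity of the boundary
  function\<close>

context blaschke_sequence
begin

lemma bounded_holomorphic_blaschke_on: "bounded_holomorphic (blaschke_on a S) 1"
  by unfold_locales (auto intro: holomorphic_blaschke_on norm_blaschke_on_le_1)

sublocale T: bounded_holomorphic "blaschke_on a {n..}" 1 for n
  by (rule bounded_holomorphic_blaschke_on)

sublocale B: bounded_holomorphic "blaschke a" 1
  unfolding blaschke_eq_blaschke_on by (rule bounded_holomorphic_blaschke_on)

lemma \<beta>_radial_tendsto: "(\<lambda>m. \<beta> j (rpt m t)) \<longlonglongrightarrow> \<beta> j (cis t)"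
proof (rule continuous_on_tendsto_compose[OF holomorphic_on_imp_continuous_on[OF holomorphic_\<beta>[of j]]])
  have "(\<lambda>m. of_real (rad m) * cis t) \<longlonglongrightarrow> of_real 1 * cis t" by (intro tendsto_intros rad_tendsto)
  then show "(\<lambda>m. of_real (rad m) * cis t) \<longlonglongrightarrow> cis t" by simp
qed (use less_imp_le[OF norm_rpt] in auto)

abbreviation tail_lim :: "nat \<Rightarrow> real \<Rightarrow> complex" where "tail_lim n \<equiv> radial_lim (blaschke_on a {n..})"

abbreviation tail_dist :: "nat \<Rightarrow> real" where
  "tail_dist n \<equiv> \<integral>t. cmod (tail_lim n t - 1) \<partial>arc_measure"

lemma radial_lim_blaschke_split:
  "AE t in lborel. radial_lim (blaschke a) t = (\<Prod>j<n. \<beta> j (cis t)) * tail_lim n t"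
proof -
  from B.radial_seq_tendsto T.radial_seq_tendsto[of n] show ?thesis
  proof eventually_elim
    case (elim t)
    have "blaschke a (rpt m t)
        = (\<Prod>j<n. \<beta> j (rpt m t)) * blaschke_on a {n..} (rpt m t)" for m
      using blaschke_on_split[OF norm_rpt[of m t], of UNIV n] by (simp add: blaschke_eq_blaschke_on)
    then have "(\<lambda>m. blaschke a (rpt m t)) \<longlonglongrightarrow> (\<Prod>j<n. \<beta> j (cis t)) * tail_lim n t"
      using elim(2) by (simp only:) (intro tendsto_mult tendsto_prod \<beta>_radial_tendsto)
    then show ?case using elim(1) LIMSEQ_unique by blast
  qed
qed

lemma tail_lim_integrable:
  "integrable arc_measure (tail_lim n)" "integrable arc_measure (\<lambda>t. (cmod (tail_lim n t - 1))\<^sup>2)"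
  "integrable arc_measure (\<lambda>t. cmod (tail_lim n t - 1))"
proof -
  note [measurable] = T.radial_lim_measurable[of n]
  show "integrable arc_measure (tail_lim n)"
    by (rule integrable_arc[OF T.radial_lim_measurable[of n] T.radial_lim_bound[of n]])
  have le: "AE t in lborel. cmod (tail_lim n t - 1) \<le> 2"
    using T.radial_lim_bound[of n]
  proof eventually_elim
    case (elim t)
    then show ?case using norm_triangle_ineq4[of "tail_lim n t" 1] by simp
  qed
  show "integrable arc_measure (\<lambda>t. cmod (tail_lim n t - 1))"
    by (rule integrable_arc[of _ 2]) (use le in auto)
  have "AE t in lborel. norm ((cmod (tail_lim n t - 1))\<^sup>2) \<le> 2\<^sup>2"
    using le
  proof eventually_elim
    case (elim t)
    show ?case using power_mono[OF elim norm_ge_zero, of 2] by simp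
  qed
  then show "integrable arc_measure (\<lambda>t. (cmod (tail_lim n t - 1))\<^sup>2)"
    by (intro integrable_arc[of _ "2\<^sup>2"]) auto
qed

lemma measure_arc: "measure arc_measure (space arc_measure) = 2 * pi"
  by (simp add: arc_measure_def measure_restrict_space space_restrict_space)

text \<open>For |w| <= 1 one has |w - 1|^2 <= 2 - 2 * Re w, and the integral of the tail is given by
  its value at 0.\<close>

lemma tail_lim_L2:
  "(\<integral>t. (cmod (tail_lim n t - 1))\<^sup>2 \<partial>arc_measure) \<le> 4 * pi * (1 - Re (blaschke_on a {n..} 0))"
proof -
  have I: "(\<integral>t. tail_lim n t \<partial>arc_measure) = 2 * of_real pi * blaschke_on a {n..} 0"
    using T.Cauchy_integral_radial_lim[of 0 n] by simp
  have "(\<integral>t. (cmod (tail_lim n t - 1))\<^sup>2 \<partial>arc_measure) \<le> (\<integral>t. 2 - 2 * Re (tail_lim n t) \<partial>arc_measure)"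
  proof (rule integral_mono_AE[OF tail_lim_integrable(2)])
    show "integrable arc_measure (\<lambda>t. 2 - 2 * Re (tail_lim n t))"
      using tail_lim_integrable(1)[of n] by (intro Bochner_Integration.integrable_diff arc.integrable_const integrable_mult_right integrable_Re)
    have "AE t in lborel. (cmod (tail_lim n t - 1))\<^sup>2 \<le> 2 - 2 * Re (tail_lim n t)"
      using T.radial_lim_bound[of n]
    proof eventually_elim
      case (elim t)
      then have "(cmod (tail_lim n t))\<^sup>2 \<le> 1" by (simp add: power_le_one)
      then show ?case unfolding cmod_power2 by (simp add: power2_eq_square algebra_simps)
    qed
    then show "AE t in arc_measure. (cmod (tail_lim n t - 1))\<^sup>2 \<le> 2 - 2 * Re (tail_lim n t)" by (rule AE_arcI)
  qed
  also have "\<dots> = 2 * (2 * pi) - 2 * Re (\<integral>t. tail_lim n t \<partial>arc_measure)"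
    using tail_lim_integrable(1)[of n] measure_arc by (subst Bochner_Integration.integral_diff) auto
  also have "\<dots> = 4 * pi * (1 - Re (blaschke_on a {n..} 0))"
    unfolding I by (simp add: algebra_simps)
  finally show ?thesis .
qed

lemma tail_lim_L2_bound_tendsto: "(\<lambda>n. 4 * pi * (1 - Re (blaschke_on a {n..} 0))) \<longlonglongrightarrow> 0"
proof -
  have "(\<lambda>n. 4 * pi * (1 - Re (blaschke_on a {n..} 0))) \<longlonglongrightarrow> 4 * pi * (1 - Re 1)"
    by (intro tendsto_intros blaschke_tail_tendsto_1) simp
  then show ?thesis by simp
qed

lemma tail_lim_L1_tendsto: "tail_dist \<longlonglongrightarrow> 0"
proof (rule LIMSEQ_I)
  fix e :: real assume e: "0 < e"
  \<comment> \<open>Chosen so that the first term of x <= \<eta> / 2 + x^2 / (2 * \<eta>) integrates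
    to \<open>e / 2\<close> over an interval of length 2 * pi.\<close>
  define \<eta> where "\<eta> = e / (2 * pi)"
  have \<eta>: "\<eta> > 0" using e by (simp add: \<eta>_def)
  have le: "tail_dist n \<le> e / 2 + 4 * pi * (1 - Re (blaschke_on a {n..} 0)) / (2 * \<eta>)" for n
  proof -
    have "tail_dist n \<le> (\<integral>t. \<eta> / 2 + (cmod (tail_lim n t - 1))\<^sup>2 / (2 * \<eta>) \<partial>arc_measure)"
    proof (rule integral_mono[OF tail_lim_integrable(3)])
      show "integrable arc_measure (\<lambda>t. \<eta> / 2 + (cmod (tail_lim n t - 1))\<^sup>2 / (2 * \<eta>))"
        by (intro Bochner_Integration.integrable_add arc.integrable_const integrable_divide tail_lim_integrable)
      fix t
      have "0 \<le> (cmod (tail_lim n t - 1) - \<eta>)\<^sup>2" by simp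
      then show "cmod (tail_lim n t - 1) \<le> \<eta> / 2 + (cmod (tail_lim n t - 1))\<^sup>2 / (2 * \<eta>)"
        using \<eta> by (simp add: field_simps power2_eq_square)
    qed
    also have "\<dots> = \<eta> / 2 * (2 * pi) + (\<integral>t. (cmod (tail_lim n t - 1))\<^sup>2 \<partial>arc_measure) / (2 * \<eta>)"
      using tail_lim_integrable(2)[of n] measure_arc
      by (subst Bochner_Integration.integral_add) auto
    also have "\<dots> \<le> e / 2 + 4 * pi * (1 - Re (blaschke_on a {n..} 0)) / (2 * \<eta>)"
      using tail_lim_L2[of n] \<eta> by (intro add_mono divide_right_mono) (auto simp: \<eta>_def)
    finally show ?thesis .
  qed
  have "(\<lambda>n. 4 * pi * (1 - Re (blaschke_on a {n..} 0)) / (2 * \<eta>)) \<longlonglongrightarrow> 0 / (2 * \<eta>)"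
    using \<eta> by (intro tendsto_divide tail_lim_L2_bound_tendsto tendsto_const) auto
  then have "\<forall>\<^sub>F n in sequentially. 4 * pi * (1 - Re (blaschke_on a {n..} 0)) / (2 * \<eta>) < e / 2"
    using e by (intro order_tendstoD) auto
  then obtain N where N: "\<And>n. n \<ge> N \<Longrightarrow> 4 * pi * (1 - Re (blaschke_on a {n..} 0)) / (2 * \<eta>) < e / 2"
    unfolding eventually_sequentially by auto
  show "\<exists>N. \<forall>n\<ge>N. norm (tail_dist n - 0) < e"
  proof (intro exI allI impI)
    fix n assume "n \<ge> N"
    have "0 \<le> tail_dist n" by simp
    then show "norm (tail_dist n - 0) < e"
      using le[of n] N[OF \<open>n \<ge> N\<close>] by simp
  qed
qed

text \<open>Finitely many factors are unimodular on the circle, so the modulus of the boundary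
  function equals that of each tail, and the tails tend to 1 in mean square.\<close>

lemma norm_radial_lim_blaschke: "AE t in arc_measure. cmod (radial_lim (blaschke a) t) = 1"
proof -
  let ?X = "\<lambda>t. (1 - cmod (radial_lim (blaschke a) t))\<^sup>2"
  note [measurable] = B.radial_lim_measurable
  have "AE t in lborel. norm (?X t) \<le> 1"
    using B.radial_lim_bound
    by eventually_elim (auto simp: abs_square_le_1)
  then have int: "integrable arc_measure ?X" by (intro integrable_arc) auto
  have "(\<integral>t. ?X t \<partial>arc_measure) \<le> 4 * pi * (1 - Re (blaschke_on a {n..} 0))" for n
  proof (rule order_trans[OF integral_mono_AE[OF int tail_lim_integrable(2)] tail_lim_L2])
    have "AE t in lborel. ?X t \<le> (cmod (tail_lim n t - 1))\<^sup>2"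
      using radial_lim_blaschke_split[of n]
    proof eventually_elim
      case (elim t)
      have "cmod (radial_lim (blaschke a) t) = cmod (tail_lim n t)"
        unfolding elim norm_mult prod_norm[symmetric] by (simp add: norm_\<beta>_circle)
      then have "\<bar>1 - cmod (radial_lim (blaschke a) t)\<bar> \<le> cmod (tail_lim n t - 1)"
        using norm_triangle_ineq3[of 1 "tail_lim n t"] by (simp add: norm_minus_commute)
      then show ?case by (metis abs_ge_zero power2_abs power_mono)
    qed
    then show "AE t in arc_measure. ?X t \<le> (cmod (tail_lim n t - 1))\<^sup>2" by (rule AE_arcI)
  qed
  then have "(\<integral>t. ?X t \<partial>arc_measure) \<le> 0"
    by (intro LIMSEQ_le_const[OF tail_lim_L2_bound_tendsto]) auto
  moreover have "0 \<le> (\<integral>t. ?X t \<partial>arc_measure)" by simp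
  ultimately have "(\<integral>t. ?X t \<partial>arc_measure) = 0" by simp
  then have "AE t in arc_measure. ?X t = 0"
    using integral_nonneg_eq_0_iff_AE[OF int] by simp
  then show ?thesis by eventually_elim simp
qed

end

section \<open>The two implications\<close>

lemma Hinf_iff: "f \<in> Hinf \<longleftrightarrow> (\<exists>K. bounded_holomorphic f K)"
proof
  assume f: "f \<in> Hinf"
  then obtain K where "\<forall>z\<in>ball 0 1. cmod (f z) \<le> K" by (auto simp: Hinf_def bounded_iff)
  with f show "\<exists>K. bounded_holomorphic f K"
    by (intro exI[of _ K]) (auto simp: Hinf_def bounded_holomorphic_def)
next
  assume "\<exists>K. bounded_holomorphic f K"
  then obtain K where "bounded_holomorphic f K" ..
  then show "f \<in> Hinf" by (auto simp: Hinf_def bounded_holomorphic_def intro!: boundedI[of _ K])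
qed

section \<open>Sufficiency: the candidate lies in the star-invariant subspace\<close>

context bounded_cauchy_data
begin

lemma model_fun_in_Kinf: "model_fun \<in> Kinf (blaschke a)"
proof -
  interpret f: bounded_holomorphic model_fun "2 * C + C0"
    by unfold_locales (auto intro: holomorphic_model_fun norm_model_fun_le)
  interpret g: bounded_holomorphic conj_fun C0
    by unfold_locales (auto intro: holomorphic_conj_fun norm_conj_fun_le)
  have "model_fun \<in> Hinf" using f.bounded_holomorphic_axioms Hinf_iff by blast
  moreover have "conj_fun \<in> Hinf0"
    using g.bounded_holomorphic_axioms Hinf_iff by (auto simp: Hinf0_def conj_fun_def)
  moreover have "AE t in arc_measure. boundary_fun model_fun (cis t)
      = boundary_fun (blaschke a) (cis t) * cnj (boundary_fun conj_fun (cis t))"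
    using norm_radial_lim_blaschke AE_arcI[OF B.radial_tendsto] AE_arcI[OF g.radial_tendsto]
      AE_arcI[OF B.boundary_fun_eq] AE_arcI[OF g.boundary_fun_eq]
  proof eventually_elim
    case (elim t)
    let ?z = "\<lambda>r. complex_of_real r * cis t"
    have "((\<lambda>r. 2 * C * (1 - cmod (blaschke a (?z r)))) \<longlongrightarrow> 2 * C * (1 - cmod (radial_lim (blaschke a) t))) (at_left (1::real))"
      by (intro tendsto_intros elim)
    then have lim0: "((\<lambda>r. 2 * C * (1 - cmod (blaschke a (?z r)))) \<longlongrightarrow> 0) (at_left (1::real))"
      using elim by simp
    have "\<forall>\<^sub>F r in at_left (1::real). r \<in> {0<..<1}" by (rule eventually_at_left_real) simp
    then have "\<forall>\<^sub>F r in at_left (1::real). cmod (model_fun (?z r) - blaschke a (?z r) * cnj (conj_fun (?z r)))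
        \<le> 2 * C * (1 - cmod (blaschke a (?z r)))"
      by eventually_elim (auto intro!: model_fun_minus_conj simp: norm_mult)
    then have "((\<lambda>r. model_fun (?z r) - blaschke a (?z r) * cnj (conj_fun (?z r))) \<longlongrightarrow> 0) (at_left 1)"
      using lim0 by (rule Lim_null_comparison)
    moreover have "((\<lambda>r. blaschke a (?z r) * cnj (conj_fun (?z r)))
        \<longlongrightarrow> radial_lim (blaschke a) t * cnj (radial_lim conj_fun t)) (at_left 1)"
      by (intro tendsto_intros elim)
    ultimately have "((\<lambda>r. (model_fun (?z r) - blaschke a (?z r) * cnj (conj_fun (?z r))) + blaschke a (?z r) * cnj (conj_fun (?z r)))
        \<longlongrightarrow> 0 + radial_lim (blaschke a) t * cnj (radial_lim conj_fun t)) (at_left 1)"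
      by (rule tendsto_add)
    then have "((\<lambda>r. model_fun (?z r)) \<longlongrightarrow> radial_lim (blaschke a) t * cnj (radial_lim conj_fun t)) (at_left 1)"
      by simp
    then have "boundary_fun model_fun (cis t) = radial_lim (blaschke a) t * cnj (radial_lim conj_fun t)"
      unfolding boundary_fun_def by (intro tendsto_Lim) auto
    then show ?case using elim by simp
  qed
  then have "AE \<zeta> in circle_measure. boundary_fun model_fun \<zeta> = boundary_fun (blaschke a) \<zeta> * cnj (boundary_fun conj_fun \<zeta>)"
    by (rule AE_circle_measureI)
  ultimately show ?thesis unfolding Kinf_def by blast
qed

end

section \<open>Necessity: evaluation of the sums by interpolation at finitely many zeros\<close>

context interpolating_sequence
begin

lemma norm_deriv_blaschke_ge: "\<delta> / (2 * \<mu> j) \<le> cmod (deriv (blaschke a) (a j))"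
proof -
  have "\<delta> \<le> cmod (deriv (blaschke a) (a j)) * (1 - (cmod (a j))\<^sup>2)"
    using norm_deriv_blaschke[of j] uniformly_separated[of j] by simp
  also have "\<dots> \<le> cmod (deriv (blaschke a) (a j)) * (2 * \<mu> j)"
    using one_minus_sq_bounds(2)[of j] by (intro mult_left_mono) auto
  finally show ?thesis using \<mu>_pos[of j] by (simp add: pos_divide_le_eq)
qed

lemma deriv_blaschke_nonzero: "deriv (blaschke a) (a j) \<noteq> 0"
  using norm_deriv_blaschke[of j] uniformly_separated[of j] \<delta>_pos by auto

text \<open>For \<open>j < n\<close>, the product of the first \<open>n\<close> factors divided by
  \<open>z - a j\<close>, with the singularity cancelled: up to its value at \<open>a j\<close>, a
  Lagrange basis function that is bounded on the disc.\<close>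

definition lagrange :: "nat \<Rightarrow> nat \<Rightarrow> complex \<Rightarrow> complex" where
  "lagrange n j z = - blaschke_const (a j) * (\<Prod>i\<in>{..<n} - {j}. \<beta> i z) / (1 - cnj (a j) * z)"

lemma lagrange_mult:
  assumes "j < n" "cmod z \<le> 1" shows "(z - a j) * lagrange n j z = (\<Prod>i<n. \<beta> i z)"
proof -
  have "(\<Prod>i<n. \<beta> i z) = \<beta> j z * (\<Prod>i\<in>{..<n} - {j}. \<beta> i z)"
    using assms by (intro prod.remove) auto
  then show ?thesis by (simp add: lagrange_def \<beta>_def blaschke_factor_eq mult_ac)
qed

lemma lagrange_at_other: "i < n \<Longrightarrow> i \<noteq> j \<Longrightarrow> lagrange n j (a i) = 0"
  using \<beta>_eq_0_iff[of "a i" i] in_disc[of i] by (simp add: lagrange_def prod_zero_iff) blast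

text \<open>The full product is the partial product times the tail, so dividing it by
  \<open>z - a j\<close> and evaluating at \<open>a j\<close> gives the derivative. This fixes the
  normalisation of the interpolation coefficients.\<close>

lemma lagrange_at_self:
  assumes "j < n" shows "lagrange n j (a j) * blaschke_on a {n..} (a j) = deriv (blaschke a) (a j)"
proof -
  have "blaschke_on a (- {j}) (a j) = (\<Prod>i\<in>{..<n} - {j}. \<beta> i (a j)) * blaschke_on a {n..} (a j)"
  proof -
    have "- {j} \<inter> {..<n} = {..<n} - {j}" "- {j} \<inter> {n..} = {n..}" using assms by auto
    then show ?thesis using blaschke_on_split[OF in_disc[of j], of "- {j}" n] by simp
  qed
  moreover note one_minus_cnj_self[of "a j"]
  ultimately show ?thesis unfolding lagrange_def DERIV_imp_deriv[OF DERIV_blaschke] by simp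
qed

lemma holomorphic_lagrange: "lagrange n j holomorphic_on ball 0 1"
  unfolding lagrange_def[abs_def]
  by (intro holomorphic_intros holomorphic_on_subset[OF holomorphic_\<beta>])
    (use one_minus_cnj_mult_nonzero[OF in_disc] in auto)

lemma norm_lagrange_le:
  assumes "cmod z < 1" shows "cmod (lagrange n j z) \<le> 1 / \<mu> j"
proof -
  have "cmod (\<Prod>i\<in>{..<n} - {j}. \<beta> i z) \<le> 1"
    unfolding prod_norm[symmetric] using norm_\<beta>_le_1[of z] assms by (intro prod_le_1) auto
  then show ?thesis
    unfolding lagrange_def norm_divide norm_mult norm_minus_cancel norm_blaschke_const mult_1_left
    using one_minus_norm_mult_ge(1)[of "a j" z] in_disc[of j] \<mu>_pos[of j] assms
    by (intro frac_le) (auto simp: \<mu>_def)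
qed

lemma lagrange_radial_tendsto: "(\<lambda>m. lagrange n j (rpt m t)) \<longlonglongrightarrow> lagrange n j (cis t)"
proof -
  have "(\<lambda>m. of_real (rad m) * cis t) \<longlonglongrightarrow> of_real 1 * cis t" by (intro tendsto_intros rad_tendsto)
  moreover have "1 - cnj (a j) * cis t \<noteq> 0" using one_minus_cnj_mult_nonzero[OF in_disc, of "cis t" j] by simp
  ultimately show ?thesis
    unfolding lagrange_def by (intro tendsto_intros \<beta>_radial_tendsto) auto
qed

text \<open>
  Here \<open>f - p\<close>, with \<open>p\<close> the Lagrange interpolant of \<open>f\<close> at \<open>a 0, \<dots>, a (n - 1)\<close>, is divisible by the
  partial product, which turns the residue computation of the sum into Cauchy's formula.
\<close>

lemma Kinf_sum_bound:
  assumes f: "bounded_holomorphic f Kf" and g: "bounded_holomorphic g Kg" and g0: "g 0 = 0"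
    and rel: "AE t in arc_measure. radial_lim f t = radial_lim (blaschke a) t * cnj (radial_lim g t)"
  shows "cmod (\<Sum>j. f (a j) / (deriv (blaschke a) (a j) * (1 - a j * cnj (a k)))) \<le> Kg"
proof -
  interpret f: bounded_holomorphic f Kf by (rule f)
  interpret g: bounded_holomorphic g Kg by (rule g)
  \<comment> \<open>\<open>G\<close> is g z / z, still bounded by \<open>Kg\<close>; the sum in the
    conclusion will turn out to be \<open>cnj (G (a k))\<close>.\<close>
  obtain G where G: "G holomorphic_on ball 0 1" "\<And>z. cmod z < 1 \<Longrightarrow> cmod (G z) \<le> Kg"
      "\<And>z. cmod z < 1 \<Longrightarrow> g z = blaschke_factor 0 z * G z"
    using divide_blaschke_factor[OF g.hol g.bnd _ g0] by auto
  have gG: "g z = z * G z" if "cmod z < 1" for z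
    using G(3)[OF that] by (simp add: blaschke_factor_eq blaschke_const_def)
  interpret G: bounded_holomorphic G Kg by unfold_locales (use G in auto)
  \<comment> \<open>The coefficients for which the combination of \<open>lagrange n j\<close>
    interpolates \<open>f\<close>. The tail factor stems from the value of
    \<open>lagrange n j\<close> at \<open>a j\<close> and tends to 1 as \<open>n\<close>
    grows.\<close>
  define c where "c = (\<lambda>n j. f (a j) * blaschke_on a {n..} (a j) / deriv (blaschke a) (a j))"
  \<comment> \<open>On the circle this is 1 / cnj (cis t - a k), so that integrating
    \<open>cnj g\<close> against it is a conjugated Cauchy formula for \<open>G\<close> at
    \<open>a k\<close>.\<close>
  define Kk where "Kk = (\<lambda>t. cis t / (1 - cnj (a k) * cis t))"
  have nzK: "1 - cnj (a k) * cis t \<noteq> 0" for t using one_minus_cnj_mult_nonzero[OF in_disc, of "cis t" k] by simp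
  have Kk_cont: "continuous_on UNIV Kk" unfolding Kk_def using nzK by (intro continuous_intros) auto
  then have [measurable]: "Kk \<in> borel_measurable borel" by (rule borel_measurable_continuous_onI)
  have Kk_bound: "cmod (Kk t) \<le> 1 / \<mu> k" for t
    unfolding Kk_def norm_divide using one_minus_norm_mult_ge(1)[of "a k" "cis t"] in_disc[of k] \<mu>_pos[of k]
    by (intro frac_le) (auto simp: \<mu>_def)
  note [measurable] = f.radial_lim_measurable g.radial_lim_measurable G.radial_lim_measurable
  have [measurable]: "cnj \<in> borel_measurable borel" "cis \<in> borel_measurable borel"
    by (intro borel_measurable_continuous_onI continuous_intros)+
  have Gpair: "(\<integral>t. cnj (radial_lim g t) * Kk t \<partial>arc_measure) = 2 * of_real pi * cnj (G (a k))"
  proof -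
    have "AE t in arc_measure. cnj (radial_lim g t) * Kk t = cnj (radial_lim G t * (cis t / (cis t - a k)))"
      using AE_arcI[OF g.radial_seq_tendsto] AE_arcI[OF G.radial_seq_tendsto]
    proof eventually_elim
      case (elim t)
      have "(\<lambda>n. of_real (rad n) * cis t * G (rpt n t)) \<longlonglongrightarrow> of_real 1 * cis t * radial_lim G t"
        by (intro tendsto_intros rad_tendsto elim)
      then have gt: "radial_lim g t = cis t * radial_lim G t"
        using elim(1) LIMSEQ_unique gG[OF norm_rpt] by simp
      have cc: "cnj (cis t) * cis t = 1" by (simp add: cis_cnj cis_mult)
      have "cnj (cis t - a k) * cis t = 1 - cnj (a k) * cis t" using cc by (simp add: algebra_simps)
      moreover have "cis t \<noteq> a k"
      proof
        assume "cis t = a k"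
        then have "cmod (cis t) < 1" using in_disc[of k] by (simp only:)
        then show False by simp
      qed
      then have "cnj (cis t - a k) \<noteq> 0" by (simp only: complex_cnj_zero_iff) simp
      ultimately have "Kk t = 1 / cnj (cis t - a k)"
        unfolding Kk_def using nzK[of t] by (auto simp: eq_divide_eq divide_eq_eq mult.commute)
      then show ?case by (simp add: gt)
    qed
    then have "(\<integral>t. cnj (radial_lim g t) * Kk t \<partial>arc_measure) = (\<integral>t. cnj (radial_lim G t * (cis t / (cis t - a k))) \<partial>arc_measure)"
    proof (intro integral_cong_AE)
      show "(\<lambda>t. cnj (radial_lim g t) * Kk t) \<in> borel_measurable arc_measure"
        by (rule arc_measurable) measurable
      show "(\<lambda>t. cnj (radial_lim G t * (cis t / (cis t - a k)))) \<in> borel_measurable arc_measure"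
        by (rule arc_measurable) measurable
    qed
    also have "\<dots> = cnj (2 * of_real pi * G (a k))"
      unfolding Bochner_Integration.integral_cnj G.Cauchy_integral_radial_lim[OF in_disc] ..
    finally show ?thesis by simp
  qed
  \<comment> \<open>Write \<open>f\<close> as its interpolant plus the partial product times
    \<open>e\<close>. Dividing the boundary relation by the partial product, which has no zeros on
    the circle, leaves tail * cnj g = e + sum of c n j / (cis t - a j). Against \<open>Kk\<close>
    the term with \<open>e\<close> integrates to a multiple of \<open>E 0 = 0\<close>, and Cauchy's
    formula evaluates the others.\<close>
  have main: "(\<integral>t. tail_lim n t * (cnj (radial_lim g t) * Kk t) \<partial>arc_measure)
      = 2 * of_real pi * (\<Sum>j<n. c n j / (1 - a j * cnj (a k)))" for n
  proof -
    define p where "p = (\<lambda>z. \<Sum>j<n. c n j * lagrange n j z)"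
    have holp: "p holomorphic_on ball 0 1"
      unfolding p_def by (intro holomorphic_intros holomorphic_lagrange)
    have zero: "f (a i) - p (a i) = 0" if "i < n" for i
    proof -
      have "p (a i) = (\<Sum>j\<in>{i}. c n j * lagrange n j (a i))"
        unfolding p_def using that lagrange_at_other[OF that] by (intro sum.mono_neutral_right) auto
      also have "\<dots> = f (a i) * (lagrange n i (a i) * blaschke_on a {n..} (a i)) / deriv (blaschke a) (a i)"
        by (simp add: c_def)
      also have "\<dots> = f (a i)" unfolding lagrange_at_self[OF that] using deriv_blaschke_nonzero by simp
      finally show ?thesis by simp
    qed
    have bd: "cmod (f z - p z) \<le> Kf + (\<Sum>j<n. cmod (c n j) * (1 / \<mu> j))" if z: "cmod z < 1" for z
    proof -
      have "cmod (p z) \<le> (\<Sum>j<n. cmod (c n j) * (1 / \<mu> j))"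
        unfolding p_def using norm_lagrange_le[OF z]
        by (intro order_trans[OF norm_sum] sum_mono) (simp only: norm_mult mult_left_mono norm_ge_zero)
      then show ?thesis using f.bnd[OF z] norm_triangle_ineq4[of "f z" "p z"] by simp
    qed
    have inj: "inj a" by (auto simp: inj_def a_inj)
    obtain e where e: "e holomorphic_on ball 0 1"
        "\<And>z. cmod z < 1 \<Longrightarrow> cmod (e z) \<le> Kf + (\<Sum>j<n. cmod (c n j) * (1 / \<mu> j))"
        "\<And>z. cmod z < 1 \<Longrightarrow> f z - p z = (\<Prod>j<n. \<beta> j z) * e z"
      using divide_partial_blaschke[OF inj holomorphic_on_diff[OF f.hol holp] bd zero] by blast
    define Ke where "Ke = Kf + (\<Sum>j<n. cmod (c n j) * (1 / \<mu> j))"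
    define E where "E = (\<lambda>z. z * e z / (1 - cnj (a k) * z))"
    interpret e: bounded_holomorphic e Ke by unfold_locales (use e in \<open>auto simp: Ke_def\<close>)
    interpret E: bounded_holomorphic E "Ke / \<mu> k"
    proof
      show "E holomorphic_on ball 0 1"
        unfolding E_def by (intro holomorphic_intros e) (use one_minus_cnj_mult_nonzero[OF in_disc] in auto)
      fix z :: complex assume z: "cmod z < 1"
      have "cmod z * cmod (e z) \<le> 1 * Ke" using z e.bnd[OF z] by (intro mult_mono) auto
      then show "cmod (E z) \<le> Ke / \<mu> k"
        unfolding E_def norm_divide norm_mult
        using one_minus_norm_mult_ge(1)[of "a k" z] in_disc[of k] \<mu>_pos[of k] z e.K_nonneg
        by (intro frac_le) (auto simp: \<mu>_def)
    qed
    have cis_ne: "cis t \<noteq> a j" for t j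
    proof
      assume "cis t = a j"
      then have "cmod (cis t) < 1" using in_disc[of j] by (simp only:)
      then show False by simp
    qed
    let ?Q = "\<lambda>t. radial_lim E t + (\<Sum>j<n. c n j * (1 / (1 - cnj (a k) * cis t) * cis t / (cis t - a j)))"
    have AEeq: "AE t in arc_measure. tail_lim n t * (cnj (radial_lim g t) * Kk t) = ?Q t"
      using rel AE_arcI[OF radial_lim_blaschke_split[of n]] AE_arcI[OF f.radial_seq_tendsto]
        AE_arcI[OF e.radial_seq_tendsto] AE_arcI[OF E.radial_seq_tendsto]
    proof eventually_elim
      case (elim t)
      let ?b = "\<Prod>j<n. \<beta> j (cis t)"
      have b: "?b \<noteq> 0" using \<beta>_eq_0_iff[of "cis t"] cis_ne by auto
      have "(\<lambda>m. (\<Prod>j<n. \<beta> j (rpt m t)) * e (rpt m t) + p (rpt m t))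
          \<longlonglongrightarrow> ?b * radial_lim e t + (\<Sum>j<n. c n j * lagrange n j (cis t))"
        unfolding p_def by (intro tendsto_intros \<beta>_radial_tendsto lagrange_radial_tendsto elim)
      moreover have "(\<Prod>j<n. \<beta> j (rpt m t)) * e (rpt m t) + p (rpt m t)
          = f (rpt m t)" for m
        using e(3)[OF norm_rpt[of m t]] by (simp add: algebra_simps)
      ultimately have "(\<lambda>m. f (rpt m t)) \<longlonglongrightarrow> ?b * radial_lim e t + (\<Sum>j<n. c n j * lagrange n j (cis t))"
        by simp
      then have "radial_lim f t = ?b * radial_lim e t + (\<Sum>j<n. c n j * lagrange n j (cis t))"
        using elim(3) LIMSEQ_unique by blast
      also have "(\<Sum>j<n. c n j * lagrange n j (cis t)) = ?b * (\<Sum>j<n. c n j / (cis t - a j))"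
        unfolding sum_distrib_left
      proof (rule sum.cong[OF refl])
        fix j assume "j \<in> {..<n}"
        then have "(cis t - a j) * lagrange n j (cis t) = ?b" using lagrange_mult[of j n "cis t"] by simp
        then have "lagrange n j (cis t) = ?b / (cis t - a j)"
          using cis_ne[of t j] by (simp add: eq_divide_eq mult.commute)
        then show "c n j * lagrange n j (cis t) = ?b * (c n j / (cis t - a j))" by simp
      qed
      finally have "?b * (tail_lim n t * cnj (radial_lim g t)) = ?b * (radial_lim e t + (\<Sum>j<n. c n j / (cis t - a j)))"
        using elim(1,2) by (simp add: distrib_left mult.assoc)
      then have 1: "tail_lim n t * cnj (radial_lim g t) = radial_lim e t + (\<Sum>j<n. c n j / (cis t - a j))"
        unfolding mult_cancel_left using b by blast
      have rc: "(\<lambda>m. of_real (rad m) * cis t) \<longlonglongrightarrow> of_real 1 * cis t" by (intro tendsto_intros rad_tendsto)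
      have "(\<lambda>m. E (rpt m t)) \<longlonglongrightarrow> of_real 1 * cis t * radial_lim e t / (1 - cnj (a k) * (of_real 1 * cis t))"
        unfolding E_def by (intro tendsto_intros rc elim) (use nzK in simp)
      then have 2: "radial_lim E t = radial_lim e t * Kk t"
        using LIMSEQ_unique[OF elim(5)] by (simp add: Kk_def mult.commute)
      have "tail_lim n t * (cnj (radial_lim g t) * Kk t) = (radial_lim e t + (\<Sum>j<n. c n j / (cis t - a j))) * Kk t"
        using 1 by (simp add: mult.assoc[symmetric])
      also have "\<dots> = ?Q t"
        unfolding 2 distrib_right sum_distrib_right by (simp add: Kk_def mult_ac)
      finally show ?case .
    qed
    have contk: "continuous_on {0..2 * pi} (\<lambda>t. 1 / (1 - cnj (a k) * cis t) * cis t / (cis t - a j))" for j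
      using nzK cis_ne by (intro continuous_intros) auto
    have intk: "integrable arc_measure (\<lambda>t. 1 / (1 - cnj (a k) * cis t) * cis t / (cis t - a j))" for j
      unfolding arc_measure_def
      using borel_integrable_atLeastAtMost'[OF contk[of j]] by (simp add: integrable_restrict_space set_integrable_def)
    have valk: "(\<integral>t. 1 / (1 - cnj (a k) * cis t) * cis t / (cis t - a j) \<partial>arc_measure)
        = 2 * of_real pi * (1 / (1 - cnj (a k) * a j))" for j
    proof (rule integral_arc_has_integral[OF contk])
      show "((\<lambda>t. 1 / (1 - cnj (a k) * cis t) * cis t / (cis t - a j)) has_integral
          2 * of_real pi * (1 / (1 - cnj (a k) * a j))) {0..2 * pi}"
        by (rule Cauchy_integral_unit_circle[of "\<lambda>z. 1 / (1 - cnj (a k) * z)"])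
          (use one_minus_cnj_mult_nonzero[OF in_disc, of _ k] in_disc in \<open>auto intro!: continuous_intros holomorphic_intros\<close>)
    qed
    have intE: "integrable arc_measure (radial_lim E)"
      by (rule integrable_arc[OF E.radial_lim_measurable E.radial_lim_bound])
    have valE: "(\<integral>t. radial_lim E t \<partial>arc_measure) = 0"
      using E.Cauchy_integral_radial_lim[of 0] by (simp add: E_def)
    have "(\<integral>t. tail_lim n t * (cnj (radial_lim g t) * Kk t) \<partial>arc_measure) = (\<integral>t. ?Q t \<partial>arc_measure)"
    proof (rule integral_cong_AE[OF _ _ AEeq])
      show "(\<lambda>t. tail_lim n t * (cnj (radial_lim g t) * Kk t)) \<in> borel_measurable arc_measure"
        by (rule arc_measurable) measurable
      show "?Q \<in> borel_measurable arc_measure"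
        by (intro borel_measurable_integrable Bochner_Integration.integrable_add intE
            Bochner_Integration.integrable_sum integrable_mult_right intk)
    qed
    also have "\<dots> = (\<Sum>j<n. c n j * (2 * of_real pi * (1 / (1 - cnj (a k) * a j))))"
      using intE intk by (subst Bochner_Integration.integral_add)
        (auto simp: valE valk Bochner_Integration.integral_sum simp del: times_divide_eq_left times_divide_eq_right)
    also have "\<dots> = 2 * of_real pi * (\<Sum>j<n. c n j / (1 - a j * cnj (a k)))"
      by (simp add: sum_distrib_left mult_ac)
    finally show ?thesis .
  qed
  define S where "S = (\<lambda>n. \<Sum>j<n. c n j / (1 - a j * cnj (a k)))"
  \<comment> \<open>The tail is close to 1 in the mean, and the remaining integrand is bounded by
    \<open>Kg / \<mu> k\<close>.\<close>
  have diff: "2 * pi * cmod (S n - cnj (G (a k))) \<le> Kg / \<mu> k * tail_dist n" for n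
  proof -
    have b1: "AE t in lborel. cmod (cnj (radial_lim g t) * Kk t) \<le> Kg / \<mu> k"
      using g.radial_lim_bound
    proof eventually_elim
      case (elim t)
      have "cmod (radial_lim g t) * cmod (Kk t) \<le> Kg * (1 / \<mu> k)"
        using elim Kk_bound g.K_nonneg by (intro mult_mono) auto
      then show ?case by (simp add: norm_mult)
    qed
    have b2: "AE t in lborel. cmod (tail_lim n t * (cnj (radial_lim g t) * Kk t)) \<le> 1 * (Kg / \<mu> k)"
      using b1 T.radial_lim_bound[of n]
    proof eventually_elim
      case (elim t)
      then show ?case unfolding norm_mult[of "tail_lim n t"] by (intro mult_mono) auto
    qed
    have i1: "integrable arc_measure (\<lambda>t. cnj (radial_lim g t) * Kk t)"
      by (rule integrable_arc[OF _ b1]) measurable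
    have i2: "integrable arc_measure (\<lambda>t. tail_lim n t * (cnj (radial_lim g t) * Kk t))"
      by (rule integrable_arc[OF _ b2]) measurable
    have "2 * of_real pi * (S n - cnj (G (a k)))
        = (\<integral>t. tail_lim n t * (cnj (radial_lim g t) * Kk t) - cnj (radial_lim g t) * Kk t \<partial>arc_measure)"
      unfolding Bochner_Integration.integral_diff[OF i2 i1] main Gpair S_def by (simp add: algebra_simps)
    moreover have "2 * pi * cmod (S n - cnj (G (a k))) = cmod (2 * of_real pi * (S n - cnj (G (a k))))"
      by (simp add: norm_mult)
    ultimately have "2 * pi * cmod (S n - cnj (G (a k)))
        = cmod (\<integral>t. tail_lim n t * (cnj (radial_lim g t) * Kk t) - cnj (radial_lim g t) * Kk t \<partial>arc_measure)"
      by (simp only:)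
    also have "\<dots> \<le> (\<integral>t. cmod (tail_lim n t * (cnj (radial_lim g t) * Kk t) - cnj (radial_lim g t) * Kk t) \<partial>arc_measure)"
      by (rule integral_norm_bound)
    also have "\<dots> \<le> (\<integral>t. Kg / \<mu> k * cmod (tail_lim n t - 1) \<partial>arc_measure)"
    proof (rule integral_mono_AE)
      show "AE t in arc_measure. cmod (tail_lim n t * (cnj (radial_lim g t) * Kk t) - cnj (radial_lim g t) * Kk t)
          \<le> Kg / \<mu> k * cmod (tail_lim n t - 1)"
        using AE_arcI[OF b1]
      proof eventually_elim
        case (elim t)
        have "tail_lim n t * (cnj (radial_lim g t) * Kk t) - cnj (radial_lim g t) * Kk t
            = (cnj (radial_lim g t) * Kk t) * (tail_lim n t - 1)" by (simp add: algebra_simps)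
        then show ?case using elim by (simp only: norm_mult[of _ "tail_lim n t - 1"]) (intro mult_right_mono, auto)
      qed
    qed (use i1 i2 tail_lim_integrable(3)[of n] in auto)
    finally show ?thesis by simp
  qed
  have "(\<lambda>n. S n - cnj (G (a k))) \<longlonglongrightarrow> 0"
  proof (rule Lim_null_comparison)
    have "(\<lambda>n. Kg / \<mu> k * tail_dist n / (2 * pi)) \<longlonglongrightarrow> Kg / \<mu> k * 0 / (2 * pi)"
      by (intro tendsto_intros tail_lim_L1_tendsto) auto
    then show "(\<lambda>n. Kg / \<mu> k * tail_dist n / (2 * pi)) \<longlonglongrightarrow> 0" by simp
    show "\<forall>\<^sub>F n in sequentially. norm (S n - cnj (G (a k))) \<le> Kg / \<mu> k * tail_dist n / (2 * pi)"
    proof (intro always_eventually allI)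
      fix n
      have "norm (S n - cnj (G (a k))) * (2 * pi) \<le> Kg / \<mu> k * tail_dist n"
        using diff[of n] by (simp only: mult.commute[of _ "2 * pi"])
      then show "norm (S n - cnj (G (a k))) \<le> Kg / \<mu> k * tail_dist n / (2 * pi)"
        by (simp only: pos_le_divide_eq[OF mult_pos_pos[OF zero_less_numeral pi_gt_zero]])
    qed
  qed
  then have S1: "S \<longlonglongrightarrow> cnj (G (a k))" by (simp add: LIM_zero_iff)
  define s where "s = (\<lambda>j. f (a j) / (deriv (blaschke a) (a j) * (1 - a j * cnj (a k))))"
  have ns: "cmod (s j) \<le> 2 * Kf / (\<delta> * \<mu> k) * \<mu> j" for j
  proof -
    have m: "\<mu> k \<le> cmod (1 - a j * cnj (a k))" using zeros_kernel(1)[of k j] by (simp add: mult.commute)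
    have "cmod (s j) = cmod (f (a j)) / (cmod (deriv (blaschke a) (a j)) * cmod (1 - a j * cnj (a k)))"
      by (simp add: s_def norm_divide norm_mult)
    also have "\<dots> \<le> Kf / (\<delta> / (2 * \<mu> j) * \<mu> k)"
      using f.bnd[OF in_disc[of j]] norm_deriv_blaschke_ge[of j] m \<mu>_pos[of j] \<mu>_pos[of k] \<delta>_pos f.K_nonneg by (intro frac_le mult_mono) auto
    also have "\<dots> = 2 * Kf / (\<delta> * \<mu> k) * \<mu> j"
      using \<mu>_pos[of j] \<mu>_pos[of k] \<delta>_pos by (simp add: field_simps)
    finally show ?thesis .
  qed
  \<comment> \<open>The tail from \<open>n\<close> on vanishes at \<open>a j\<close> for
    \<open>j >= n\<close>, so the finite sum is an infinite series whose terms have a majorant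
    independent of \<open>n\<close>; Tannery's theorem then removes the tail factors.\<close>
  have S_eq: "S n = (\<Sum>j. s j * blaschke_on a {n..} (a j))" for n
  proof -
    have "(\<Sum>j. s j * blaschke_on a {n..} (a j)) = (\<Sum>j<n. s j * blaschke_on a {n..} (a j))"
      by (rule suminf_finite) (auto simp: blaschke_on_at_zero)
    then show ?thesis by (simp add: S_def s_def c_def mult_ac)
  qed
  have "((\<lambda>n. \<Sum>j. s j * blaschke_on a {n..} (a j)) \<longlongrightarrow> (\<Sum>j. s j)) sequentially"
  proof -
    have "\<forall>\<^sub>F (j, n) in at_top \<times>\<^sub>F sequentially. norm (s j * blaschke_on a {n..} (a j)) \<le> 2 * Kf / (\<delta> * \<mu> k) * \<mu> j"
    proof (rule always_eventually, clarify)
      fix j n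
      have "norm (s j * blaschke_on a {n..} (a j)) \<le> norm (s j) * 1"
        unfolding norm_mult using norm_blaschke_on_le_1[OF in_disc[of j]] by (intro mult_left_mono) auto
      then show "norm (s j * blaschke_on a {n..} (a j)) \<le> 2 * Kf / (\<delta> * \<mu> k) * \<mu> j" using ns[of j] by simp
    qed
    moreover have "(\<lambda>n. s j * blaschke_on a {n..} (a j)) \<longlonglongrightarrow> s j" for j
      using tendsto_mult_left[OF blaschke_tail_tendsto_1[OF in_disc[of j]], of "s j"] by simp
    moreover have "summable (\<lambda>j. 2 * Kf / (\<delta> * \<mu> k) * \<mu> j)" by (intro summable_mult summable_\<mu>)
    ultimately show ?thesis
      using tannerys_theorem[of "\<lambda>j n. s j * blaschke_on a {n..} (a j)" s sequentially "\<lambda>j. 2 * Kf / (\<delta> * \<mu> k) * \<mu> j"]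
      by simp
  qed
  then have "S \<longlonglongrightarrow> (\<Sum>j. s j)" by (simp add: S_eq[abs_def])
  then have "(\<Sum>j. s j) = cnj (G (a k))" using S1 LIMSEQ_unique by blast
  then show ?thesis using G(2)[OF in_disc[of k]] by (simp add: s_def)
qed

end

text \<open>Since \<open>1 - cmod (a j)\<close> is at most 1 - |a j|^2, the infimum in the
  definition bounds the product of the other factors at \<open>a j\<close> from below and serves
  itself as \<open>\<delta>\<close>.\<close>

lemma interpolating_blaschkeD:
  assumes "interpolating_blaschke a"
  obtains \<delta> where "interpolating_sequence a \<delta>"
proof -
  define \<delta> where "\<delta> = (INF j. cmod (deriv (blaschke a) (a j)) * (1 - cmod (a j)))"
  have disc: "cmod (a j) < 1" for j using assms by (auto simp: interpolating_blaschke_def)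
  interpret blaschke_sequence a
    by unfold_locales (use assms disc in \<open>auto simp: interpolating_blaschke_def\<close>)
  have "\<delta> \<le> cmod (deriv (blaschke a) (a j)) * (1 - cmod (a j))" for j
    unfolding \<delta>_def using disc
    by (intro cINF_lower bdd_belowI2[of _ 0]) (auto intro!: mult_nonneg_nonneg simp: less_imp_le[OF disc])
  moreover have "cmod (deriv (blaschke a) (a j)) * (1 - cmod (a j)) \<le> cmod (blaschke_on a (- {j}) (a j))" for j
  proof -
    have "1 - cmod (a j) \<le> 1 - (cmod (a j))\<^sup>2"
      using disc[of j] by (simp add: power2_eq_square mult_left_le)
    then show ?thesis unfolding norm_deriv_blaschke[symmetric] by (intro mult_left_mono) auto
  qed
  ultimately have "interpolating_sequence a \<delta>"
    by unfold_locales (use assms in \<open>auto simp: interpolating_blaschke_def \<delta>_def intro: order_trans\<close>)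
  then show thesis by (rule that)
qed

theorem theorem1p2:
  fixes a :: "nat \<Rightarrow> complex" and h :: "complex \<Rightarrow> complex"
  assumes "interpolating_blaschke a"
    and "h \<in> Hinf"
  shows "h \<in> Kinf_plus_BHinf (blaschke a) \<longleftrightarrow>
    bdd_above (range (\<lambda>k. cmod (\<Sum>j. h (a j) /
      (deriv (blaschke a) (a j) * (1 - a j * cnj (a k))))))"
proof -
  obtain \<delta> where "interpolating_sequence a \<delta>" using assms(1) by (rule interpolating_blaschkeD)
  then interpret interpolating_sequence a \<delta> .
  obtain Kh where h: "bounded_holomorphic h Kh" using assms(2) Hinf_iff by blast
  then interpret h: bounded_holomorphic h Kh .
  show ?thesis
  proof
    assume "h \<in> Kinf_plus_BHinf (blaschke a)"
    then obtain f q where f: "f \<in> Kinf (blaschke a)" and hf: "\<And>z. z \<in> ball 0 1 \<Longrightarrow> h z = f z + blaschke a z * q z"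
      unfolding Kinf_plus_BHinf_def by blast
    then obtain g where fg: "f \<in> Hinf" "g \<in> Hinf0"
      and rel: "AE \<zeta> in circle_measure. boundary_fun f \<zeta> = boundary_fun (blaschke a) \<zeta> * cnj (boundary_fun g \<zeta>)"
      by (auto simp: Kinf_def)
    obtain Kf where Kf: "bounded_holomorphic f Kf" using fg Hinf_iff by blast
    obtain Kg where Kg: "bounded_holomorphic g Kg" using fg Hinf_iff by (auto simp: Hinf0_def)
    interpret f: bounded_holomorphic f Kf by (rule Kf)
    interpret g: bounded_holomorphic g Kg by (rule Kg)
    have "AE t in arc_measure. radial_lim f t = radial_lim (blaschke a) t * cnj (radial_lim g t)"
      using AE_circle_measureD[OF rel] AE_arcI[OF f.boundary_fun_eq] AE_arcI[OF g.boundary_fun_eq]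
        AE_arcI[OF B.boundary_fun_eq]
      by eventually_elim simp
    from Kinf_sum_bound[OF Kf Kg _ this]
    have "cmod (\<Sum>j. f (a j) / (deriv (blaschke a) (a j) * (1 - a j * cnj (a k)))) \<le> Kg" for k
      using fg by (simp add: Hinf0_def)
    moreover have "h (a j) = f (a j)" for j using hf[of "a j"] in_disc[of j] by simp
    ultimately show "bdd_above (range (\<lambda>k. cmod (\<Sum>j. h (a j) /
        (deriv (blaschke a) (a j) * (1 - a j * cnj (a k))))))"
      by (intro bdd_aboveI2[of _ _ Kg]) simp
  next
    assume "bdd_above (range (\<lambda>k. cmod (\<Sum>j. h (a j) /
        (deriv (blaschke a) (a j) * (1 - a j * cnj (a k))))))"
    then obtain M where M: "\<And>k. cmod (\<Sum>j. h (a j) / (deriv (blaschke a) (a j) * (1 - a j * cnj (a k)))) \<le> M"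
      by (auto simp: bdd_above_def)
    define u where "u = (\<lambda>j. h (a j) / deriv (blaschke a) (a j))"
    \<comment> \<open>Separation gives \<open>2 * Kh / \<delta>\<close> as the constant in the bound
      on \<open>u j\<close>; the summand 1 keeps it positive even for \<open>Kh = 0\<close>.\<close>
    interpret bounded_cauchy_data a \<delta> u "2 * Kh / \<delta> + 1" M
    proof
      show "0 < 2 * Kh / \<delta> + 1" using h.K_nonneg \<delta>_pos by (intro add_nonneg_pos) auto
      show "cmod (\<Sum>j. u j / (1 - a j * cnj (a k))) \<le> M" for k
        using M[of k] by (simp add: u_def)
      fix j
      have "cmod (u j) \<le> Kh / (\<delta> / (2 * \<mu> j))"
        unfolding u_def norm_divide using norm_deriv_blaschke_ge[of j] h.bnd[OF in_disc[of j]] h.K_nonneg \<delta>_pos \<mu>_pos[of j]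
        by (intro frac_le) auto
      also have "\<dots> = 2 * Kh / \<delta> * \<mu> j" by simp
      also have "\<dots> \<le> (2 * Kh / \<delta> + 1) * \<mu> j" using \<mu>_pos[of j] by (intro mult_right_mono) auto
      finally show "cmod (u j) \<le> (2 * Kh / \<delta> + 1) * \<mu> j" .
    qed
    \<comment> \<open>The candidate has the same values as \<open>h\<close> at all zeros of B, so
      that B divides the difference with a bounded quotient.\<close>
    have zero: "h (a j) - model_fun (a j) = 0" for j
      unfolding model_fun_at_zero using deriv_blaschke_nonzero[of j] by (simp add: u_def)
    have bd: "cmod (h z - model_fun z) \<le> Kh + (2 * (2 * Kh / \<delta> + 1) + C0)" if "cmod z < 1" for z
      using norm_triangle_ineq4[of "h z" "model_fun z"] h.bnd[OF that] norm_model_fun_le[OF that] by simp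
    have inj: "inj a" by (auto simp: inj_def a_inj)
    obtain q where q: "q holomorphic_on ball 0 1"
        "\<And>z. cmod z < 1 \<Longrightarrow> cmod (q z) \<le> Kh + (2 * (2 * Kh / \<delta> + 1) + C0)"
        "\<And>z. cmod z < 1 \<Longrightarrow> h z - model_fun z = blaschke a z * q z"
      using divide_blaschke[OF inj holomorphic_on_diff[OF h.hol holomorphic_model_fun] bd zero] by blast
    have "q \<in> Hinf"
      unfolding Hinf_iff by (rule exI[of _ "Kh + (2 * (2 * Kh / \<delta> + 1) + C0)"]) (use q in \<open>auto simp: bounded_holomorphic_def\<close>)
    moreover have "h z = model_fun z + blaschke a z * q z" if "z \<in> ball 0 1" for z
      using q(3)[of z] that by (simp add: algebra_simps)
    ultimately show "h \<in> Kinf_plus_BHinf (blaschke a)"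
      unfolding Kinf_plus_BHinf_def using model_fun_in_Kinf by blast
  qed
qed

end
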